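(* The following are provable in $\mathbf{ZF}$: (i) If $\mathbf{Y}$ is a topological space which is not countably compact, and $\mathbf{X}$ is a topological space such that the projection $\pi_X:\mathbf{X}\times\mathbf{Y}\to\mathbf{X}$ is closed, then $\mathbf{X}$ is a $P$-space. (ii) If $\mathbf{X}$ and $\mathbf{Y}$ are topological spaces such that $\mathbf{X}$ is a $P$-space and $\mathbf{Y}$ is either Lindelöf or second-countable, then the projection $\pi_X:\mathbf{X}\times\mathbf{Y}\to\mathbf{X}$ is closed. (iii) If $\mathbf{Y}$ is a fixed second-countable space which is not countably compact, then, for every topological space $\mathbf{X}$, it holds that $\mathbf{X}$ is a $P$-space if and only if the projection $\pi_X:\mathbf{X}\times\mathbf{Y}\to\mathbf{X}$ is closed. (iv) There exists a second-countable Lindelöf $T_0$-space $\mathbf{Y}$ such that, for every topological space $\mathbf{X}$, it holds that $\mathbf{X}$ is a $P$-space if and only if the projection $\pi_X:\mathbf{X}\times\mathbf{Y}\to\mathbf{X}$ is closed. (v) $\mathbf{CAC}(\mathbb{R})$ is equivalent to the statement: for every $P$-space $\mathbf{X}$, there exists a non-compact Lindelöf $T_1$-space $\mathbf{Y}$ such that the projection $\pi_X:\mathbf{X}\times\mathbf{Y}\to\mathbf{X}$ is closed.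
   Context: The base theory is $\mathbf{ZF}$ (no Axiom of Choice). A set is countable if it is equipotent to a subset of $\omega$, and denumerable if it is infinite and countable. $\mathbf{CAC}(\mathbb{R})$: every denumerable family of non-empty subsets of $\mathbb{R}$ has a choice function. A topological space is a $P$-space if all its $G_\delta$-sets are open (no separation axioms assumed). A space is (countably) compact if every (countable) open cover has a finite subcover, and Lindelöf if every open cover has a countable subcover. A map is closed if it sends closed sets to closed sets. *)

theory Defs
  imports Main
begin

text \<open>
  HOL has a choice operator, so a statement about what is provable in ZF cannot be about HOL
  sets. Instead we fix an arbitrary structure for the language of set theory, that is a type
  \<open>'v\<close> with a binary relation \<open>E\<close> (\<open>E x y\<close> reads ``x is a member of y''), and assume that it
  satisfies the axioms of ZF. Separation and Replacement are first-order schemas: they are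
  available for formulas with parameters, not for arbitrary HOL predicates (the latter would make
  every such structure satisfy the Axiom of Choice). Every notion below quantifies only over \<open>'v\<close>
  and is first-order in \<open>E\<close>, with no HOL set, number or function standing in for an
  internal one. By soundness and completeness of first-order logic, such a statement holds in all
  structures satisfying ZF iff it is provable in ZF.
\<close>

section \<open>The axioms of ZF\<close>

text \<open>Formulas have de Bruijn indices: index 0 belongs to the innermost quantifier.\<close>

datatype fm = Mem nat nat | Eql nat nat | Neg fm | Conj fm fm | Forall fm

primrec sat :: "('v \<Rightarrow> 'v \<Rightarrow> bool) \<Rightarrow> (nat \<Rightarrow> 'v) \<Rightarrow> fm \<Rightarrow> bool" where
  "sat E s (Mem i j) \<longleftrightarrow> E (s i) (s j)"
| "sat E s (Eql i j) \<longleftrightarrow> s i = s j"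
| "sat E s (Neg p) \<longleftrightarrow> \<not> sat E s p"
| "sat E s (Conj p q) \<longleftrightarrow> sat E s p \<and> sat E s q"
| "sat E s (Forall p) \<longleftrightarrow> (\<forall>x. sat E (case_nat x s) p)"

definition is_empty :: "('v \<Rightarrow> 'v \<Rightarrow> bool) \<Rightarrow> 'v \<Rightarrow> bool" where
  "is_empty E a \<longleftrightarrow> (\<forall>x. \<not> E x a)"

definition is_subset :: "('v \<Rightarrow> 'v \<Rightarrow> bool) \<Rightarrow> 'v \<Rightarrow> 'v \<Rightarrow> bool" where
  "is_subset E a b \<longleftrightarrow> (\<forall>x. E x a \<longrightarrow> E x b)"

definition is_succ :: "('v \<Rightarrow> 'v \<Rightarrow> bool) \<Rightarrow> 'v \<Rightarrow> 'v \<Rightarrow> bool" where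
  "is_succ E a b \<longleftrightarrow> (\<forall>x. E x b \<longleftrightarrow> E x a \<or> x = a)"

definition is_inductive :: "('v \<Rightarrow> 'v \<Rightarrow> bool) \<Rightarrow> 'v \<Rightarrow> bool" where
  "is_inductive E w \<longleftrightarrow>
     (\<exists>e. is_empty E e \<and> E e w) \<and> (\<forall>x. E x w \<longrightarrow> (\<exists>y. is_succ E x y \<and> E y w))"

locale ZF =
  fixes E :: "'v \<Rightarrow> 'v \<Rightarrow> bool"
  assumes extensionality: "\<forall>a b. (\<forall>x. E x a \<longleftrightarrow> E x b) \<longrightarrow> a = b"
    and foundation: "\<forall>a. (\<exists>x. E x a) \<longrightarrow> (\<exists>x. E x a \<and> \<not> (\<exists>y. E y x \<and> E y a))"
    and pairing: "\<forall>a b. \<exists>c. \<forall>x. E x c \<longleftrightarrow> x = a \<or> x = b"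
    and union: "\<forall>a. \<exists>u. \<forall>x. E x u \<longleftrightarrow> (\<exists>y. E y a \<and> E x y)"
    and power_set: "\<forall>a. \<exists>p. \<forall>x. E x p \<longleftrightarrow> is_subset E x a"
    and infinity: "\<exists>w. is_inductive E w"
    and separation: "\<forall>p s a. \<exists>b. \<forall>x. E x b \<longleftrightarrow> E x a \<and> sat E (case_nat x s) p"
    and replacement: "\<forall>p s a.
          (\<forall>x. E x a \<longrightarrow> (\<exists>!y. sat E (case_nat y (case_nat x s)) p)) \<longrightarrow>
          (\<exists>b. \<forall>y. E y b \<longleftrightarrow> (\<exists>x. E x a \<and> sat E (case_nat y (case_nat x s)) p))"


section \<open>Basic set theory inside the structure\<close>

text \<open>
  \<open>the_set E P\<close> is the set whose members are exactly the \<open>x\<close> with \<open>P x\<close>. It is used only where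
  ZF proves that this set exists (for the first-order \<open>P\<close> at hand); it is then unique by
  extensionality, so these terms are the usual definite descriptions.
\<close>

definition the_set :: "('v \<Rightarrow> 'v \<Rightarrow> bool) \<Rightarrow> ('v \<Rightarrow> bool) \<Rightarrow> 'v" where
  "the_set E P = (THE a. \<forall>x. E x a \<longleftrightarrow> P x)"

definition empty_set :: "('v \<Rightarrow> 'v \<Rightarrow> bool) \<Rightarrow> 'v" where
  "empty_set E = the_set E (\<lambda>x. False)"

definition succ :: "('v \<Rightarrow> 'v \<Rightarrow> bool) \<Rightarrow> 'v \<Rightarrow> 'v" where
  "succ E a = the_set E (\<lambda>x. E x a \<or> x = a)"

definition union_of :: "('v \<Rightarrow> 'v \<Rightarrow> bool) \<Rightarrow> 'v \<Rightarrow> 'v" where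
  "union_of E s = the_set E (\<lambda>x. \<exists>u. E u s \<and> E x u)"

definition inter :: "('v \<Rightarrow> 'v \<Rightarrow> bool) \<Rightarrow> 'v \<Rightarrow> 'v \<Rightarrow> 'v" where
  "inter E a b = the_set E (\<lambda>x. E x a \<and> E x b)"

definition diff :: "('v \<Rightarrow> 'v \<Rightarrow> bool) \<Rightarrow> 'v \<Rightarrow> 'v \<Rightarrow> 'v" where
  "diff E a b = the_set E (\<lambda>x. E x a \<and> \<not> E x b)"

definition upair :: "('v \<Rightarrow> 'v \<Rightarrow> bool) \<Rightarrow> 'v \<Rightarrow> 'v \<Rightarrow> 'v" where
  "upair E a b = the_set E (\<lambda>x. x = a \<or> x = b)"

definition opair :: "('v \<Rightarrow> 'v \<Rightarrow> bool) \<Rightarrow> 'v \<Rightarrow> 'v \<Rightarrow> 'v" where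
  "opair E a b = upair E (upair E a a) (upair E a b)"

definition cart_prod :: "('v \<Rightarrow> 'v \<Rightarrow> bool) \<Rightarrow> 'v \<Rightarrow> 'v \<Rightarrow> 'v" where
  "cart_prod E a b = the_set E (\<lambda>p. \<exists>x y. E x a \<and> E y b \<and> p = opair E x y)"

definition is_function :: "('v \<Rightarrow> 'v \<Rightarrow> bool) \<Rightarrow> 'v \<Rightarrow> 'v \<Rightarrow> 'v \<Rightarrow> bool" where
  "is_function E f a b \<longleftrightarrow>
     is_subset E f (cart_prod E a b) \<and> (\<forall>x. E x a \<longrightarrow> (\<exists>!y. E (opair E x y) f))"

definition app :: "('v \<Rightarrow> 'v \<Rightarrow> bool) \<Rightarrow> 'v \<Rightarrow> 'v \<Rightarrow> 'v" where
  "app E f x = (THE y. E (opair E x y) f)"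

definition image_of :: "('v \<Rightarrow> 'v \<Rightarrow> bool) \<Rightarrow> 'v \<Rightarrow> 'v \<Rightarrow> 'v" where
  "image_of E f c = the_set E (\<lambda>y. \<exists>x. E x c \<and> E (opair E x y) f)"

definition is_bijection :: "('v \<Rightarrow> 'v \<Rightarrow> bool) \<Rightarrow> 'v \<Rightarrow> 'v \<Rightarrow> 'v \<Rightarrow> bool" where
  "is_bijection E f a b \<longleftrightarrow>
     is_function E f a b \<and> (\<forall>y. E y b \<longrightarrow> (\<exists>!x. E (opair E x y) f))"

definition equipotent :: "('v \<Rightarrow> 'v \<Rightarrow> bool) \<Rightarrow> 'v \<Rightarrow> 'v \<Rightarrow> bool" where
  "equipotent E a b \<longleftrightarrow> (\<exists>f. is_bijection E f a b)"

definition omega :: "('v \<Rightarrow> 'v \<Rightarrow> bool) \<Rightarrow> 'v" where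
  "omega E = the_set E (\<lambda>n. \<forall>w. is_inductive E w \<longrightarrow> E n w)"

definition is_finite :: "('v \<Rightarrow> 'v \<Rightarrow> bool) \<Rightarrow> 'v \<Rightarrow> bool" where
  "is_finite E a \<longleftrightarrow> (\<exists>n. E n (omega E) \<and> equipotent E a n)"

definition is_countable :: "('v \<Rightarrow> 'v \<Rightarrow> bool) \<Rightarrow> 'v \<Rightarrow> bool" where
  "is_countable E a \<longleftrightarrow> (\<exists>b. is_subset E b (omega E) \<and> equipotent E a b)"

definition is_denumerable :: "('v \<Rightarrow> 'v \<Rightarrow> bool) \<Rightarrow> 'v \<Rightarrow> bool" where
  "is_denumerable E a \<longleftrightarrow> \<not> is_finite E a \<and> is_countable E a"


section \<open>The real numbers and countable choice for sets of reals\<close>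

text \<open>Addition and multiplication on \<open>\<omega>\<close> are the functions given by the recursion equations.\<close>

definition add_fun :: "('v \<Rightarrow> 'v \<Rightarrow> bool) \<Rightarrow> 'v" where
  "add_fun E = (THE f. is_function E f (cart_prod E (omega E) (omega E)) (omega E) \<and>
     (\<forall>m. E m (omega E) \<longrightarrow> app E f (opair E m (empty_set E)) = m) \<and>
     (\<forall>m n. E m (omega E) \<and> E n (omega E) \<longrightarrow>
        app E f (opair E m (succ E n)) = succ E (app E f (opair E m n))))"

definition add :: "('v \<Rightarrow> 'v \<Rightarrow> bool) \<Rightarrow> 'v \<Rightarrow> 'v \<Rightarrow> 'v" where
  "add E m n = app E (add_fun E) (opair E m n)"

definition mult_fun :: "('v \<Rightarrow> 'v \<Rightarrow> bool) \<Rightarrow> 'v" where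
  "mult_fun E = (THE f. is_function E f (cart_prod E (omega E) (omega E)) (omega E) \<and>
     (\<forall>m. E m (omega E) \<longrightarrow> app E f (opair E m (empty_set E)) = empty_set E) \<and>
     (\<forall>m n. E m (omega E) \<and> E n (omega E) \<longrightarrow>
        app E f (opair E m (succ E n)) = add E (app E f (opair E m n)) m))"

definition mult :: "('v \<Rightarrow> 'v \<Rightarrow> bool) \<Rightarrow> 'v \<Rightarrow> 'v \<Rightarrow> 'v" where
  "mult E m n = app E (mult_fun E) (opair E m n)"

text \<open>
  A triple \<open>a, b, c\<close> of members of \<open>\<omega>\<close> with \<open>c \<noteq> 0\<close> represents the fraction \<open>(a - b) / c\<close>;
  a rational number is a class of triples that represent the same fraction. For the order,
  \<open>(a - b) / c < (a' - b') / c'\<close> iff \<open>a c' + b' c < a' c + b c'\<close>, and \<open><\<close> on \<open>\<omega>\<close> is membership.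
\<close>

definition is_fraction :: "('v \<Rightarrow> 'v \<Rightarrow> bool) \<Rightarrow> 'v \<Rightarrow> 'v \<Rightarrow> 'v \<Rightarrow> bool" where
  "is_fraction E a b c \<longleftrightarrow>
     E a (omega E) \<and> E b (omega E) \<and> E c (omega E) \<and> c \<noteq> empty_set E"

definition rat :: "('v \<Rightarrow> 'v \<Rightarrow> bool) \<Rightarrow> 'v \<Rightarrow> 'v \<Rightarrow> 'v \<Rightarrow> 'v" where
  "rat E a b c = the_set E (\<lambda>t. \<exists>a' b' c'. is_fraction E a' b' c' \<and>
     t = opair E (opair E a' b') c' \<and>
     add E (mult E a c') (mult E b' c) = add E (mult E a' c) (mult E b c'))"

definition rationals :: "('v \<Rightarrow> 'v \<Rightarrow> bool) \<Rightarrow> 'v" where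
  "rationals E = the_set E (\<lambda>q. \<exists>a b c. is_fraction E a b c \<and> q = rat E a b c)"

definition rat_less :: "('v \<Rightarrow> 'v \<Rightarrow> bool) \<Rightarrow> 'v \<Rightarrow> 'v \<Rightarrow> bool" where
  "rat_less E q r \<longleftrightarrow> (\<exists>a b c a' b' c'. is_fraction E a b c \<and> is_fraction E a' b' c' \<and>
     q = rat E a b c \<and> r = rat E a' b' c' \<and>
     E (add E (mult E a c') (mult E b' c)) (add E (mult E a' c) (mult E b c')))"

text \<open>Real numbers are Dedekind cuts, given by their lower parts without a greatest element.\<close>

definition reals :: "('v \<Rightarrow> 'v \<Rightarrow> bool) \<Rightarrow> 'v" where
  "reals E = the_set E (\<lambda>l. is_subset E l (rationals E) \<and>
     (\<exists>q. E q l) \<and> (\<exists>q. E q (rationals E) \<and> \<not> E q l) \<and>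
     (\<forall>q r. E q l \<and> E r (rationals E) \<and> rat_less E r q \<longrightarrow> E r l) \<and>
     (\<forall>q. E q l \<longrightarrow> (\<exists>r. E r l \<and> rat_less E q r)))"

definition CAC_reals :: "('v \<Rightarrow> 'v \<Rightarrow> bool) \<Rightarrow> bool" where
  "CAC_reals E \<longleftrightarrow> (\<forall>F. is_denumerable E F \<and>
     (\<forall>a. E a F \<longrightarrow> is_subset E a (reals E) \<and> \<not> is_empty E a) \<longrightarrow>
     (\<exists>f. is_function E f F (union_of E F) \<and> (\<forall>a. E a F \<longrightarrow> E (app E f a) a)))"


section \<open>Topological spaces inside the structure\<close>

text \<open>A space is given by its underlying set and its set of open sets.\<close>

definition topology_on :: "('v \<Rightarrow> 'v \<Rightarrow> bool) \<Rightarrow> 'v \<Rightarrow> 'v \<Rightarrow> bool" where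
  "topology_on E X T \<longleftrightarrow>
     (\<forall>U. E U T \<longrightarrow> is_subset E U X) \<and> E (empty_set E) T \<and> E X T \<and>
     (\<forall>U V. E U T \<and> E V T \<longrightarrow> E (inter E U V) T) \<and>
     (\<forall>S. is_subset E S T \<longrightarrow> E (union_of E S) T)"

definition is_closed :: "('v \<Rightarrow> 'v \<Rightarrow> bool) \<Rightarrow> 'v \<Rightarrow> 'v \<Rightarrow> 'v \<Rightarrow> bool" where
  "is_closed E X T C \<longleftrightarrow> is_subset E C X \<and> E (diff E X C) T"

definition is_G_delta :: "('v \<Rightarrow> 'v \<Rightarrow> bool) \<Rightarrow> 'v \<Rightarrow> 'v \<Rightarrow> 'v \<Rightarrow> bool" where
  "is_G_delta E X T G \<longleftrightarrow> (\<exists>S. is_subset E S T \<and> is_countable E S \<and>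
     (\<forall>x. E x G \<longleftrightarrow> E x X \<and> (\<forall>U. E U S \<longrightarrow> E x U)))"

definition P_space :: "('v \<Rightarrow> 'v \<Rightarrow> bool) \<Rightarrow> 'v \<Rightarrow> 'v \<Rightarrow> bool" where
  "P_space E X T \<longleftrightarrow> (\<forall>G. is_G_delta E X T G \<longrightarrow> E G T)"

definition open_cover :: "('v \<Rightarrow> 'v \<Rightarrow> bool) \<Rightarrow> 'v \<Rightarrow> 'v \<Rightarrow> 'v \<Rightarrow> bool" where
  "open_cover E X T S \<longleftrightarrow> is_subset E S T \<and> union_of E S = X"

definition compact_space :: "('v \<Rightarrow> 'v \<Rightarrow> bool) \<Rightarrow> 'v \<Rightarrow> 'v \<Rightarrow> bool" where
  "compact_space E X T \<longleftrightarrow> (\<forall>S. open_cover E X T S \<longrightarrow>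
     (\<exists>S'. is_subset E S' S \<and> is_finite E S' \<and> open_cover E X T S'))"

definition countably_compact_space :: "('v \<Rightarrow> 'v \<Rightarrow> bool) \<Rightarrow> 'v \<Rightarrow> 'v \<Rightarrow> bool" where
  "countably_compact_space E X T \<longleftrightarrow> (\<forall>S. open_cover E X T S \<and> is_countable E S \<longrightarrow>
     (\<exists>S'. is_subset E S' S \<and> is_finite E S' \<and> open_cover E X T S'))"

definition Lindelof_space :: "('v \<Rightarrow> 'v \<Rightarrow> bool) \<Rightarrow> 'v \<Rightarrow> 'v \<Rightarrow> bool" where
  "Lindelof_space E X T \<longleftrightarrow> (\<forall>S. open_cover E X T S \<longrightarrow>
     (\<exists>S'. is_subset E S' S \<and> is_countable E S' \<and> open_cover E X T S'))"

definition second_countable_space :: "('v \<Rightarrow> 'v \<Rightarrow> bool) \<Rightarrow> 'v \<Rightarrow> 'v \<Rightarrow> bool" where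
  "second_countable_space E X T \<longleftrightarrow> (\<exists>B. is_countable E B \<and> is_subset E B T \<and>
     (\<forall>U. E U T \<longrightarrow> (\<exists>S. is_subset E S B \<and> U = union_of E S)))"

definition T0_space :: "('v \<Rightarrow> 'v \<Rightarrow> bool) \<Rightarrow> 'v \<Rightarrow> 'v \<Rightarrow> bool" where
  "T0_space E X T \<longleftrightarrow> (\<forall>x y. E x X \<and> E y X \<and> x \<noteq> y \<longrightarrow>
     (\<exists>U. E U T \<and> (E x U \<and> \<not> E y U \<or> E y U \<and> \<not> E x U)))"

definition T1_space :: "('v \<Rightarrow> 'v \<Rightarrow> bool) \<Rightarrow> 'v \<Rightarrow> 'v \<Rightarrow> bool" where
  "T1_space E X T \<longleftrightarrow> (\<forall>x y. E x X \<and> E y X \<and> x \<noteq> y \<longrightarrow>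
     (\<exists>U. E U T \<and> E x U \<and> \<not> E y U))"

definition open_boxes :: "('v \<Rightarrow> 'v \<Rightarrow> bool) \<Rightarrow> 'v \<Rightarrow> 'v \<Rightarrow> 'v" where
  "open_boxes E TX TY = the_set E (\<lambda>R. \<exists>U V. E U TX \<and> E V TY \<and> R = cart_prod E U V)"

definition product_topology :: "('v \<Rightarrow> 'v \<Rightarrow> bool) \<Rightarrow> 'v \<Rightarrow> 'v \<Rightarrow> 'v" where
  "product_topology E TX TY =
     the_set E (\<lambda>W. \<exists>S. is_subset E S (open_boxes E TX TY) \<and> W = union_of E S)"

definition projection :: "('v \<Rightarrow> 'v \<Rightarrow> bool) \<Rightarrow> 'v \<Rightarrow> 'v \<Rightarrow> 'v" where
  "projection E X Y =
     the_set E (\<lambda>p. \<exists>x y. E x X \<and> E y Y \<and> p = opair E (opair E x y) x)"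

definition closed_map :: "('v \<Rightarrow> 'v \<Rightarrow> bool) \<Rightarrow> 'v \<Rightarrow> 'v \<Rightarrow> 'v \<Rightarrow> 'v \<Rightarrow> 'v \<Rightarrow> bool" where
  "closed_map E f X TX Y TY \<longleftrightarrow>
     (\<forall>C. is_closed E X TX C \<longrightarrow> is_closed E Y TY (image_of E f C))"

definition projection_closed :: "('v \<Rightarrow> 'v \<Rightarrow> bool) \<Rightarrow> 'v \<Rightarrow> 'v \<Rightarrow> 'v \<Rightarrow> 'v \<Rightarrow> bool" where
  "projection_closed E X TX Y TY \<longleftrightarrow>
     closed_map E (projection E X Y) (cart_prod E X Y) (product_topology E TX TY) X TX"

end

theory Submission
  imports Defs
begin

text \<open>
  Closedness of the projection \<open>X \<times> Y \<rightarrow> X\<close> says that for every open \<open>W \<subseteq> X \<times> Y\<close> the set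
  \<open>{x. {x} \<times> Y \<subseteq> W}\<close> is open.

  If \<open>Y\<close> has a countable open cover \<open>V\<^sub>0, V\<^sub>1, \<dots>\<close> without a finite subcover and \<open>G = U\<^sub>0 \<inter> U\<^sub>1 \<inter> \<dots>\<close> with
  open \<open>U\<^sub>m\<close>, then \<open>W = {(x, y). \<forall>m. x \<in> U\<^sub>m \<or> y \<in> V\<^sub>0 \<union> \<dots> \<union> V\<^sub>m}\<close> is open and yields \<open>G\<close>. Conversely, if
  \<open>{x} \<times> Y \<subseteq> W\<close>, the open \<open>V\<close> with \<open>U \<times> V \<subseteq> W\<close> for some open \<open>U\<close> containing \<open>x\<close> have a countable
  subfamily covering \<open>Y\<close>; taking for each such \<open>V\<close> the largest \<open>U\<close> avoids choice, and the intersection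
  of these \<open>U\<close> is a \<open>G\<^sub>\<delta>\<close>-set. For (iv) take \<open>\<omega>\<close> with its initial segments as open sets.

  For (v), \<open>CAC(\<real>)\<close> makes the discrete space \<open>\<omega>\<close> Lindelof, since \<open>P(\<omega>)\<close> embeds into \<open>\<real>\<close>. Conversely, a
  non-compact Lindelof \<open>T\<^sub>1\<close>-space contains an injective sequence all of whose subsets are
  closed. Split it into points \<open>p(a, 0)\<close> and \<open>p(a, q)\<close> for \<open>a\<close> in the given family and \<open>q\<close> rational. A
  real \<open>r \<in> a\<close> is encoded by the open set that contains, among these points, exactly \<open>p(a, 0)\<close> and the
  \<open>p(a, q)\<close> with \<open>q \<in> r\<close>. With one open set missing all \<open>p(a, 0)\<close>, these cover the space, and the first member of a
  countable subcover that contains \<open>p(a, 0)\<close> encodes an element of \<open>a\<close>.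
\<close>

section \<open>Definable predicates and functions\<close>

text \<open>Separation and Replacement reach only formulas with parameters, so every comprehension,
  recursion and induction below has to be backed by a formula. Writing formulas out is avoided:
  definability is a semantic property of HOL predicates and terms, closed under the logical and set
  operations, and the closure rules collected in \<open>dfn_intros\<close> discharge each obligation
  by resolution. Functions are kept as definable HOL functions; sets of pairs appear only at the
  border with \<open>is_function\<close> and \<open>equipotent\<close>.

  The second obstacle is the absence of choice inside the structure. Infinitely many selections at
  once are made by the least code under an injection into \<omega>, or by a canonical object such as
  the union of all open sets with some property. Neither device produces a sequence of points in an
  arbitrary space, or reals from given sets. There the Lindelof property does the selecting: it is
  applied to covers whose members remember the point or the real that they came from.\<close>

primrec ren :: "(nat \<Rightarrow> nat) \<Rightarrow> fm \<Rightarrow> fm" where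
  "ren f (Mem i j) = Mem (f i) (f j)"
| "ren f (Eql i j) = Eql (f i) (f j)"
| "ren f (Neg p) = Neg (ren f p)"
| "ren f (Conj p q) = Conj (ren f p) (ren f q)"
| "ren f (Forall p) = Forall (ren (case_nat 0 (\<lambda>n. Suc (f n))) p)"

lemma sat_ren: "sat E s (ren f p) \<longleftrightarrow> sat E (\<lambda>i. s (f i)) p"
proof (induction p arbitrary: s f)
  case (Forall p)
  have "(\<lambda>i. case_nat x s (case_nat 0 (\<lambda>n. Suc (f n)) i)) = case_nat x (\<lambda>i. s (f i))" for x
    by (auto simp: fun_eq_iff split: nat.split)
  then show ?case using Forall by simp
qed auto

named_theorems dfn_intros

context ZF
begin

abbreviation elem (infix "\<epsilon>" 50) where "x \<epsilon> a \<equiv> E x a"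

text \<open>
  A predicate on assignments is definable if it is given by a formula each of whose variables is
  bound to a coordinate of the assignment (\<open>Inl\<close>) or to a parameter (\<open>Inr\<close>); a term \<open>t\<close> is definable if
  the relation \<open>y = t e\<close> is. Coordinate 0 is the innermost bound variable.
\<close>
definition dfn :: "((nat \<Rightarrow> 'v) \<Rightarrow> bool) \<Rightarrow> bool" where
  "dfn P \<longleftrightarrow> (\<exists>p g. \<forall>e. P e \<longleftrightarrow> sat E (\<lambda>i. case_sum e (\<lambda>c. c) (g i)) p)"

definition dtm :: "((nat \<Rightarrow> 'v) \<Rightarrow> 'v) \<Rightarrow> bool" where
  "dtm t \<longleftrightarrow> dfn (\<lambda>e. e 0 = t (\<lambda>n. e (Suc n)))"

abbreviation pdef :: "('v \<Rightarrow> bool) \<Rightarrow> bool" where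
  "pdef P \<equiv> dfn (\<lambda>e. P (e 0))"

abbreviation fdef :: "('v \<Rightarrow> 'v) \<Rightarrow> bool" where
  "fdef F \<equiv> dtm (\<lambda>e. F (e 0))"

section \<open>Closure of definability under substitution, connectives and quantifiers\<close>

lemma dfn_subst:
  assumes "dfn P"
  shows "dfn (\<lambda>e. P (\<lambda>i. case_sum e (\<lambda>c. c) (f i)))"
proof -
  from assms obtain p g where *: "\<And>e. P e \<longleftrightarrow> sat E (\<lambda>i. case_sum e (\<lambda>c. c) (g i)) p"
    unfolding dfn_def by blast
  have **: "(\<lambda>i. case_sum (\<lambda>i. case_sum e (\<lambda>c. c) (f i)) (\<lambda>c. c) (g i)) =
      (\<lambda>i. case_sum e (\<lambda>c. c) (case_sum f Inr (g i)))" for e :: "nat \<Rightarrow> 'v"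
    by (auto simp: fun_eq_iff split: sum.split)
  show ?thesis unfolding dfn_def
    by (rule exI[of _ p], rule exI[of _ "\<lambda>i. case_sum f Inr (g i)"]) (simp add: * **)
qed

lemma dfn_ren: "dfn P \<Longrightarrow> dfn (\<lambda>e. P (\<lambda>i. e (f i)))"
  using dfn_subst[of P "\<lambda>i. Inl (f i)"] by simp

lemma dfn_mem_var: "dfn (\<lambda>e. e i \<epsilon> e j)"
  unfolding dfn_def
  by (rule exI[of _ "Mem 0 1"], rule exI[of _ "\<lambda>n. if n = 0 then Inl i else Inl j"]) simp

lemma dfn_eq_var: "dfn (\<lambda>e. e i = e j)"
  unfolding dfn_def
  by (rule exI[of _ "Eql 0 1"], rule exI[of _ "\<lambda>n. if n = 0 then Inl i else Inl j"]) simp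

lemma dfn_eq_const: "dfn (\<lambda>e. e i = c)"
  using dfn_subst[OF dfn_eq_var[of 0 1], of "\<lambda>n. if n = 0 then Inl i else Inr c"] by simp

lemma dfn_neg [dfn_intros]: "dfn P \<Longrightarrow> dfn (\<lambda>e. \<not> P e)"
  unfolding dfn_def by (metis sat.simps(3))

lemma dfn_conj [dfn_intros]:
  assumes "dfn P" "dfn Q"
  shows "dfn (\<lambda>e. P e \<and> Q e)"
proof -
  from assms obtain p g q h where
    p: "\<And>e. P e \<longleftrightarrow> sat E (\<lambda>i. case_sum e (\<lambda>c. c) (g i)) p" and
    q: "\<And>e. Q e \<longleftrightarrow> sat E (\<lambda>i. case_sum e (\<lambda>c. c) (h i)) q"
    unfolding dfn_def by blast
  \<comment> \<open>The two formulas come with unrelated bindings; even indices for the one and odd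
    indices for the other make a single binding serve both.\<close>
  show ?thesis unfolding dfn_def
    by (rule exI[of _ "Conj (ren (\<lambda>i. 2 * i) p) (ren (\<lambda>i. Suc (2 * i)) q)"],
        rule exI[of _ "\<lambda>i. if even i then g (i div 2) else h (i div 2)"])
      (simp add: p q sat_ren)
qed

lemma dfn_all [dfn_intros]:
  assumes "dfn (\<lambda>e. P (\<lambda>n. e (Suc n)) (e 0))"
  shows "dfn (\<lambda>e. \<forall>x. P e x)"
proof -
  from assms obtain p g where
    p: "\<And>e. P (\<lambda>n. e (Suc n)) (e 0) \<longleftrightarrow> sat E (\<lambda>i. case_sum e (\<lambda>c. c) (g i)) p"
    unfolding dfn_def by blast
  \<comment> \<open>Several variables may be bound to coordinate 0; all of them become the
    quantified index 0. The value of \<open>h\<close> at such a variable is never read, so the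
    truncated \<open>j - 1\<close> does no harm.\<close>
  define f where "f i = (if g i = Inl 0 then 0 else Suc i)" for i
  define h where "h i = case_sum (\<lambda>j. Inl (j - 1)) Inr (g i)" for i
  have "(\<lambda>i. case_nat x (\<lambda>i. case_sum e (\<lambda>c. c) (h i)) (f i)) = (\<lambda>i. case_sum (case_nat x e) (\<lambda>c. c) (g i))"
    for x and e :: "nat \<Rightarrow> 'v"
    by (auto simp: fun_eq_iff f_def h_def split: sum.split nat.split)
  then have "P e x \<longleftrightarrow> sat E (case_nat x (\<lambda>i. case_sum e (\<lambda>c. c) (h i))) (ren f p)" for e x
    using p[of "case_nat x e"] by (simp add: sat_ren)
  then have "(\<forall>x. P e x) \<longleftrightarrow> sat E (\<lambda>i. case_sum e (\<lambda>c. c) (h i)) (Forall (ren f p))" for e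
    unfolding sat.simps by blast
  then show ?thesis unfolding dfn_def by blast
qed

lemma dfn_disj [dfn_intros]: "dfn P \<Longrightarrow> dfn Q \<Longrightarrow> dfn (\<lambda>e. P e \<or> Q e)"
  using dfn_neg[OF dfn_conj[OF dfn_neg dfn_neg], of P Q] by simp

lemma dfn_imp [dfn_intros]: "dfn P \<Longrightarrow> dfn Q \<Longrightarrow> dfn (\<lambda>e. P e \<longrightarrow> Q e)"
  unfolding imp_conv_disj by (intro dfn_disj dfn_neg)

lemma dfn_iff [dfn_intros]: "dfn P \<Longrightarrow> dfn Q \<Longrightarrow> dfn (\<lambda>e. P e \<longleftrightarrow> Q e)"
  unfolding iff_conv_conj_imp by (intro dfn_conj dfn_imp)

lemma dfn_ex [dfn_intros]:
  assumes "dfn (\<lambda>e. P (\<lambda>n. e (Suc n)) (e 0))"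
  shows "dfn (\<lambda>e. \<exists>x. P e x)"
  using dfn_neg[OF dfn_all[OF dfn_neg[OF assms]]] by simp

lemma dtm_ren: "dtm t \<Longrightarrow> dtm (\<lambda>e. t (\<lambda>i. e (f i)))"
  unfolding dtm_def using dfn_ren[of "\<lambda>e. e 0 = t (\<lambda>n. e (Suc n))" "case_nat 0 (\<lambda>n. Suc (f n))"] by simp

lemma dtm_var [dfn_intros]: "dtm (\<lambda>e. e i)"
  unfolding dtm_def by (rule dfn_eq_var)

lemma dtm_const [dfn_intros]: "dtm (\<lambda>e. c)"
  unfolding dtm_def by (rule dfn_eq_const)

text \<open>A term enters a formula only through its graph, so substitution becomes an existential
  quantifier over its value.\<close>

lemma dfn_comp:
  assumes "dfn (\<lambda>e. P (\<lambda>n. e (Suc n)) (e 0))" "dtm t"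
  shows "dfn (\<lambda>e. P e (t e))"
proof -
  have "dfn (\<lambda>e. \<exists>x. x = t e \<and> P e x)"
    using assms by (intro dfn_ex dfn_conj) (simp_all add: dtm_def)
  then show ?thesis by simp
qed

lemma dtm_comp:
  assumes "dtm (\<lambda>e. F (\<lambda>n. e (Suc n)) (e 0))" "dtm t"
  shows "dtm (\<lambda>e. F e (t e))"
  unfolding dtm_def
proof (rule dfn_comp[where P = "\<lambda>e x. e 0 = F (\<lambda>n. e (Suc n)) x" and t = "\<lambda>e. t (\<lambda>n. e (Suc n))"])
  show "dtm (\<lambda>e. t (\<lambda>n. e (Suc n)))" by (rule dtm_ren[OF assms(2)])
  show "dfn (\<lambda>e. e (Suc 0) = F (\<lambda>n. e (Suc (Suc n))) (e 0))"
    using dfn_ren[OF assms(1)[unfolded dtm_def], of "case_nat 1 (case_nat 0 (\<lambda>n. Suc (Suc n)))"] by simp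
qed

lemma dfn_comp1: "dfn (\<lambda>e. R (e 0)) \<Longrightarrow> dtm t \<Longrightarrow> dfn (\<lambda>e. R (t e))"
  by (rule dfn_comp[where P = "\<lambda>_. R"])

lemma dfn_comp2:
  assumes "dfn (\<lambda>e. R (e 0) (e (Suc 0)))" "dtm t" "dtm u"
  shows "dfn (\<lambda>e. R (t e) (u e))"
proof -
  have "dfn (\<lambda>e. R (t (\<lambda>n. e (Suc n))) (e 0))"
    by (rule dfn_comp[where P = "\<lambda>e x. R x (e 0)"]) (simp_all add: assms(1) dtm_ren[OF assms(2)])
  from dfn_comp[where P = "\<lambda>e. R (t e)", OF this assms(3)] show ?thesis .
qed

lemma dfn_comp3:
  assumes "dfn (\<lambda>e. R (e 0) (e (Suc 0)) (e (Suc (Suc 0))))" "dtm t" "dtm u" "dtm v"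
  shows "dfn (\<lambda>e. R (t e) (u e) (v e))"
proof -
  have "dfn (\<lambda>e. R (t (\<lambda>n. e (Suc (Suc n)))) (e 0) (e (Suc 0)))"
    by (rule dfn_comp[where P = "\<lambda>e x. R x (e 0) (e (Suc 0))"]) (simp_all add: assms(1) dtm_ren[OF assms(2)])
  then have "dfn (\<lambda>e. R (t (\<lambda>n. e (Suc n))) (u (\<lambda>n. e (Suc n))) (e 0))"
    by (rule dfn_comp[where P = "\<lambda>e x. R (t (\<lambda>n. e (Suc n))) x (e 0)"]) (rule dtm_ren[OF assms(3)])
  from dfn_comp[where P = "\<lambda>e. R (t e) (u e)", OF this assms(4)] show ?thesis .
qed

lemma dtm_comp1: "dtm (\<lambda>e. R (e 0)) \<Longrightarrow> dtm t \<Longrightarrow> dtm (\<lambda>e. R (t e))"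
  by (rule dtm_comp[where F = "\<lambda>_. R"])

lemma dtm_comp2:
  assumes "dtm (\<lambda>e. R (e 0) (e (Suc 0)))" "dtm t" "dtm u"
  shows "dtm (\<lambda>e. R (t e) (u e))"
proof -
  have "dtm (\<lambda>e. R (t (\<lambda>n. e (Suc n))) (e 0))"
    by (rule dtm_comp[where F = "\<lambda>e x. R x (e 0)"]) (simp_all add: assms(1) dtm_ren[OF assms(2)])
  from dtm_comp[where F = "\<lambda>e. R (t e)", OF this assms(3)] show ?thesis .
qed

lemma dtm_comp3:
  assumes "dtm (\<lambda>e. R (e 0) (e (Suc 0)) (e (Suc (Suc 0))))" "dtm t" "dtm u" "dtm v"
  shows "dtm (\<lambda>e. R (t e) (u e) (v e))"
proof -
  have "dtm (\<lambda>e. R (t (\<lambda>n. e (Suc (Suc n)))) (e 0) (e (Suc 0)))"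
    by (rule dtm_comp[where F = "\<lambda>e x. R x (e 0) (e (Suc 0))"]) (simp_all add: assms(1) dtm_ren[OF assms(2)])
  then have "dtm (\<lambda>e. R (t (\<lambda>n. e (Suc n))) (u (\<lambda>n. e (Suc n))) (e 0))"
    by (rule dtm_comp[where F = "\<lambda>e x. R (t (\<lambda>n. e (Suc n))) x (e 0)"]) (rule dtm_ren[OF assms(3)])
  from dtm_comp[where F = "\<lambda>e. R (t e) (u e)", OF this assms(4)] show ?thesis .
qed

lemma dfn_mem [dfn_intros]: "dtm t \<Longrightarrow> dtm u \<Longrightarrow> dfn (\<lambda>e. t e \<epsilon> u e)"
  by (rule dfn_comp2[where R = "\<lambda>x y. x \<epsilon> y"]) (rule dfn_mem_var)

lemma dfn_eq [dfn_intros]: "dtm t \<Longrightarrow> dtm u \<Longrightarrow> dfn (\<lambda>e. t e = u e)"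
  by (rule dfn_comp2[where R = "\<lambda>x y. x = y"]) (rule dfn_eq_var)

lemma dfn_const [dfn_intros]: "dfn (\<lambda>e. B)"
proof -
  have "dfn (\<lambda>e. e 0 = e 0)" by (rule dfn_eq_var)
  moreover have "dfn (\<lambda>e. \<not> e 0 = e 0)" by (rule dfn_neg, rule dfn_eq_var)
  ultimately show ?thesis by (cases B) auto
qed

lemma dfn_ex1 [dfn_intros]:
  assumes "dfn (\<lambda>e. P (\<lambda>n. e (Suc n)) (e 0))"
  shows "dfn (\<lambda>e. \<exists>!x. P e x)"
  unfolding Ex1_def
proof (intro dfn_intros assms)
  show "dfn (\<lambda>e. P (\<lambda>n. e (Suc (Suc n))) (e 0))"
    using dfn_ren[OF assms, of "case_nat 0 (\<lambda>n. Suc (Suc n))"] by simp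
qed

text \<open>Unique existence is demanded at every assignment: where it fails, \<open>THE\<close>
  takes a value that need not depend definably on the assignment.\<close>

lemma dtm_THE:
  assumes "\<And>e. \<exists>!y. P e y" "dfn (\<lambda>e. P (\<lambda>n. e (Suc n)) (e 0))"
  shows "dtm (\<lambda>e. THE y. P e y)"
proof -
  have "e 0 = (THE y. P (\<lambda>n. e (Suc n)) y) \<longleftrightarrow> P (\<lambda>n. e (Suc n)) (e 0)" for e
    using assms(1)[of "\<lambda>n. e (Suc n)"] by (metis (mono_tags) the1_equality theI')
  then show ?thesis using assms(2) by (simp add: dtm_def)
qed

lemma dtm_if [dfn_intros]:
  assumes "dfn P" "dtm t" "dtm u"
  shows "dtm (\<lambda>e. if P e then t e else u e)"
proof -
  have "e 0 = (if P (\<lambda>n. e (Suc n)) then t (\<lambda>n. e (Suc n)) else u (\<lambda>n. e (Suc n))) \<longleftrightarrow>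
     P (\<lambda>n. e (Suc n)) \<and> e 0 = t (\<lambda>n. e (Suc n)) \<or>
     \<not> P (\<lambda>n. e (Suc n)) \<and> e 0 = u (\<lambda>n. e (Suc n))" for e by auto
  then show ?thesis unfolding dtm_def
    by (auto intro!: dfn_intros dfn_ren[OF assms(1)] dtm_ren[OF assms(2)] dtm_ren[OF assms(3)])
qed

section \<open>Separation and Replacement for definable predicates and functions\<close>

lemma separation_dfn:
  assumes "dfn (\<lambda>e. P (\<lambda>n. e (Suc n)) (e 0))"
  shows "\<exists>b. \<forall>x. x \<epsilon> b \<longleftrightarrow> x \<epsilon> a \<and> P e x"
proof -
  from assms obtain p g where
    p: "\<And>e. P (\<lambda>n. e (Suc n)) (e 0) \<longleftrightarrow> sat E (\<lambda>i. case_sum e (\<lambda>c. c) (g i)) p"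
    unfolding dfn_def by blast
  \<comment> \<open>The axiom offers one assignment \<open>s\<close>, into which both the remaining
    coordinates and the parameters are packed; only the variables bound to coordinate 0 stay free
    for the candidate element.\<close>
  define f where "f i = (if g i = Inl 0 then 0 else Suc i)" for i
  define s where "s i = case_sum (\<lambda>j. e (j - 1)) (\<lambda>c. c) (g i)" for i
  have "(\<lambda>i. case_nat x s (f i)) = (\<lambda>i. case_sum (case_nat x e) (\<lambda>c. c) (g i))" for x
    by (auto simp: fun_eq_iff f_def s_def split: sum.split nat.split)
  then have "P e x \<longleftrightarrow> sat E (case_nat x s) (ren f p)" for x
    using p[of "case_nat x e"] by (simp add: sat_ren)
  then show ?thesis using separation by simp
qed

lemma replacement_dfn:
  assumes "dtm (\<lambda>e. F (\<lambda>n. e (Suc n)) (e 0))"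
  shows "\<exists>b. \<forall>y. y \<epsilon> b \<longleftrightarrow> (\<exists>x. x \<epsilon> a \<and> y = F e x)"
proof -
  from assms obtain p g where
    p: "\<And>e. e 0 = F (\<lambda>n. e (Suc (Suc n))) (e (Suc 0)) \<longleftrightarrow> sat E (\<lambda>i. case_sum e (\<lambda>c. c) (g i)) p"
    unfolding dfn_def dtm_def by blast
  define f where "f i = (if g i = Inl 0 then 0 else if g i = Inl 1 then 1 else Suc (Suc i))" for i
  define s where "s i = case_sum (\<lambda>j. e (j - 2)) (\<lambda>c. c) (g i)" for i
  have "(\<lambda>i. case_nat y (case_nat x s) (f i)) =
      (\<lambda>i. case_sum (case_nat y (case_nat x e)) (\<lambda>c. c) (g i))" for x y
    by (auto simp: fun_eq_iff f_def s_def numeral_2_eq_2 split: sum.split nat.split)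
  then have *: "sat E (case_nat y (case_nat x s)) (ren f p) \<longleftrightarrow> y = F e x" for x y
    using p[of "case_nat y (case_nat x e)"] by (simp add: sat_ren)
  show ?thesis using replacement[rule_format, of a s "ren f p"] by (simp add: *)
qed

lemma set_ext: "(\<And>x. x \<epsilon> a \<longleftrightarrow> x \<epsilon> b) \<Longrightarrow> a = b"
  using extensionality by blast

lemma mem_the_set: "\<exists>a. \<forall>x. x \<epsilon> a \<longleftrightarrow> P x \<Longrightarrow> x \<epsilon> the_set E P \<longleftrightarrow> P x"
proof -
  assume "\<exists>a. \<forall>x. x \<epsilon> a \<longleftrightarrow> P x"
  then obtain a where a: "\<forall>x. x \<epsilon> a \<longleftrightarrow> P x" by blast
  have "the_set E P = a" unfolding the_set_def
    by (rule the_equality) (use a in \<open>auto intro: set_ext\<close>)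
  with a show ?thesis by simp
qed

lemma dtm_the_set:
  assumes "\<And>e. \<exists>a. \<forall>x. x \<epsilon> a \<longleftrightarrow> P e x" "dfn (\<lambda>e. P (\<lambda>n. e (Suc n)) (e 0))"
  shows "dtm (\<lambda>e. the_set E (P e))"
  unfolding the_set_def
proof (rule dtm_THE)
  show "\<exists>!a. \<forall>x. x \<epsilon> a \<longleftrightarrow> P e x" for e using assms(1)[of e] by (auto intro: set_ext)
  show "dfn (\<lambda>e. \<forall>x. x \<epsilon> e 0 \<longleftrightarrow> P (\<lambda>n. e (Suc n)) x)"
  proof (intro dfn_intros)
    show "dfn (\<lambda>e. P (\<lambda>n. e (Suc (Suc n))) (e 0))"
      using dfn_ren[OF assms(2), of "case_nat 0 (\<lambda>n. Suc (Suc n))"] by simp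
  qed
qed

text \<open>Any HOL predicate may be written here, but only for a definable one does the description
  denote the intended set; hence the premise of \<open>mem_sep\<close>.\<close>

definition sep :: "'v \<Rightarrow> ('v \<Rightarrow> bool) \<Rightarrow> 'v" where
  "sep a P = the_set E (\<lambda>x. x \<epsilon> a \<and> P x)"

definition rep :: "'v \<Rightarrow> ('v \<Rightarrow> 'v) \<Rightarrow> 'v" where
  "rep a F = the_set E (\<lambda>y. \<exists>x. x \<epsilon> a \<and> y = F x)"

lemma mem_sep: "pdef P \<Longrightarrow> x \<epsilon> sep a P \<longleftrightarrow> x \<epsilon> a \<and> P x"
  unfolding sep_def by (rule mem_the_set) (rule separation_dfn[of "\<lambda>_. P"])

lemma mem_rep: "fdef F \<Longrightarrow> y \<epsilon> rep a F \<longleftrightarrow> (\<exists>x. x \<epsilon> a \<and> y = F x)"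
  unfolding rep_def by (rule mem_the_set) (rule replacement_dfn[of "\<lambda>_. F"])

lemma dtm_sep [dfn_intros]:
  assumes t: "dtm t" and P: "dfn (\<lambda>e. P (\<lambda>n. e (Suc n)) (e 0))"
  shows "dtm (\<lambda>e. sep (t e) (P e))"
  unfolding sep_def
  by (rule dtm_the_set, rule separation_dfn[OF P]) (intro dfn_intros P dtm_ren[OF t])

lemma dtm_rep [dfn_intros]:
  assumes t: "dtm t" and F: "dtm (\<lambda>e. F (\<lambda>n. e (Suc n)) (e 0))"
  shows "dtm (\<lambda>e. rep (t e) (F e))"
  unfolding rep_def
proof (rule dtm_the_set, rule replacement_dfn[OF F], intro dfn_intros)
  show "dtm (\<lambda>e. t (\<lambda>n. e (Suc (Suc n))))" by (rule dtm_ren[OF t])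
  show "dtm (\<lambda>e. F (\<lambda>n. e (Suc (Suc n))) (e 0))"
    using dtm_ren[OF F, of "case_nat 0 (\<lambda>n. Suc (Suc n))"] by simp
qed

section \<open>Basic set theory\<close>

lemma bounded_set_ex:
  assumes "pdef P" "\<And>x. P x \<Longrightarrow> x \<epsilon> a"
  shows "\<exists>b. \<forall>x. x \<epsilon> b \<longleftrightarrow> P x"
  using mem_sep[OF assms(1), of _ a] assms(2) by blast

lemma empty_ex: "\<exists>a. \<forall>x. x \<epsilon> a \<longleftrightarrow> False"
  using mem_sep[OF dfn_const[of False]] by blast

lemma mem_empty [simp]: "\<not> x \<epsilon> empty_set E"
  unfolding empty_set_def using mem_the_set[OF empty_ex] by simp

lemma empty_iff: "a = empty_set E \<longleftrightarrow> (\<forall>x. \<not> x \<epsilon> a)"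
  by (auto intro: set_ext)

lemma upair_ex: "\<exists>a. \<forall>x. x \<epsilon> a \<longleftrightarrow> x = b \<or> x = c"
  using pairing by blast

lemma mem_upair [simp]: "x \<epsilon> upair E b c \<longleftrightarrow> x = b \<or> x = c"
  unfolding upair_def by (rule mem_the_set[OF upair_ex])

lemma union_ex: "\<exists>a. \<forall>x. x \<epsilon> a \<longleftrightarrow> (\<exists>u. u \<epsilon> s \<and> x \<epsilon> u)"
  using union by blast

lemma mem_union_of [simp]: "x \<epsilon> union_of E s \<longleftrightarrow> (\<exists>u. u \<epsilon> s \<and> x \<epsilon> u)"
  unfolding union_of_def by (rule mem_the_set[OF union_ex])

lemma un_ex: "\<exists>a. \<forall>x. x \<epsilon> a \<longleftrightarrow> x \<epsilon> b \<or> x \<epsilon> c"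
  by (rule exI[of _ "union_of E (upair E b c)"]) auto

lemma succ_ex: "\<exists>a. \<forall>x. x \<epsilon> a \<longleftrightarrow> x \<epsilon> b \<or> x = b"
  using un_ex[of b "upair E b b"] by simp

lemma mem_succ [simp]: "x \<epsilon> succ E b \<longleftrightarrow> x \<epsilon> b \<or> x = b"
  unfolding succ_def by (rule mem_the_set[OF succ_ex])

lemma inter_ex: "\<exists>a. \<forall>x. x \<epsilon> a \<longleftrightarrow> x \<epsilon> b \<and> x \<epsilon> c"
  by (rule bounded_set_ex[of _ b]) (auto intro!: dfn_intros)

lemma mem_inter [simp]: "x \<epsilon> inter E b c \<longleftrightarrow> x \<epsilon> b \<and> x \<epsilon> c"
  unfolding inter_def by (rule mem_the_set[OF inter_ex])

lemma diff_ex: "\<exists>a. \<forall>x. x \<epsilon> a \<longleftrightarrow> x \<epsilon> b \<and> \<not> x \<epsilon> c"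
  by (rule bounded_set_ex[of _ b]) (auto intro!: dfn_intros)

lemma mem_diff [simp]: "x \<epsilon> diff E b c \<longleftrightarrow> x \<epsilon> b \<and> \<not> x \<epsilon> c"
  unfolding diff_def by (rule mem_the_set[OF diff_ex])

lemma upair_eq: "upair E x y = upair E z w \<longleftrightarrow> x = z \<and> y = w \<or> x = w \<and> y = z"
proof
  assume eq: "upair E x y = upair E z w"
  have "u = x \<or> u = y \<longleftrightarrow> u = z \<or> u = w" for u
    using mem_upair[of u x y] unfolding eq by simp
  from this[of x] this[of y] this[of z] this[of w]
  show "x = z \<and> y = w \<or> x = w \<and> y = z" by auto
next
  assume "x = z \<and> y = w \<or> x = w \<and> y = z"
  then show "upair E x y = upair E z w" by (intro set_ext) (simp only: mem_upair, blast)
qed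

lemma opair_eq [simp]: "opair E a b = opair E c d \<longleftrightarrow> a = c \<and> b = d"
  unfolding opair_def upair_eq by auto

lemma dtm_upair [dfn_intros]: "dtm t \<Longrightarrow> dtm u \<Longrightarrow> dtm (\<lambda>e. upair E (t e) (u e))"
  by (rule dtm_comp2[where R = "upair E"], unfold upair_def, rule dtm_the_set, rule upair_ex, intro dfn_intros)

lemma dtm_opair [dfn_intros]: "dtm t \<Longrightarrow> dtm u \<Longrightarrow> dtm (\<lambda>e. opair E (t e) (u e))"
  unfolding opair_def by (intro dfn_intros)

lemma dtm_union_of [dfn_intros]: "dtm t \<Longrightarrow> dtm (\<lambda>e. union_of E (t e))"
  by (rule dtm_comp1[where R = "union_of E"], unfold union_of_def, rule dtm_the_set, rule union_ex, intro dfn_intros)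

lemma dtm_succ [dfn_intros]: "dtm t \<Longrightarrow> dtm (\<lambda>e. succ E (t e))"
  by (rule dtm_comp1[where R = "succ E"], unfold succ_def, rule dtm_the_set, rule succ_ex, intro dfn_intros)

lemma dtm_inter [dfn_intros]: "dtm t \<Longrightarrow> dtm u \<Longrightarrow> dtm (\<lambda>e. inter E (t e) (u e))"
  by (rule dtm_comp2[where R = "inter E"], unfold inter_def, rule dtm_the_set, rule inter_ex, intro dfn_intros)

lemma dtm_diff [dfn_intros]: "dtm t \<Longrightarrow> dtm u \<Longrightarrow> dtm (\<lambda>e. diff E (t e) (u e))"
  by (rule dtm_comp2[where R = "diff E"], unfold diff_def, rule dtm_the_set, rule diff_ex, intro dfn_intros)

lemma dfn_is_subset [dfn_intros]: "dtm t \<Longrightarrow> dtm u \<Longrightarrow> dfn (\<lambda>e. is_subset E (t e) (u e))"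
  by (rule dfn_comp2[where R = "is_subset E"], unfold is_subset_def, intro dfn_intros)

definition pow :: "'v \<Rightarrow> 'v" where
  "pow a = the_set E (\<lambda>x. is_subset E x a)"

lemma pow_ex: "\<exists>p. \<forall>x. x \<epsilon> p \<longleftrightarrow> is_subset E x a"
  using power_set by blast

lemma mem_pow [simp]: "x \<epsilon> pow a \<longleftrightarrow> is_subset E x a"
  unfolding pow_def by (rule mem_the_set[OF pow_ex])

lemma cart_prod_ex: "\<exists>c. \<forall>p. p \<epsilon> c \<longleftrightarrow> (\<exists>x y. x \<epsilon> a \<and> y \<epsilon> b \<and> p = opair E x y)"
proof (rule exI, rule allI)
  fix p
  have F: "fdef (\<lambda>x. rep b (opair E x))" "\<And>x. fdef (opair E x)"
    by (intro dfn_intros)+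
  show "p \<epsilon> union_of E (rep a (\<lambda>x. rep b (opair E x))) \<longleftrightarrow> (\<exists>x y. x \<epsilon> a \<and> y \<epsilon> b \<and> p = opair E x y)"
    by (auto simp: mem_rep[OF F(1)] mem_rep[OF F(2)])
qed

lemma mem_cart_prod: "p \<epsilon> cart_prod E a b \<longleftrightarrow> (\<exists>x y. x \<epsilon> a \<and> y \<epsilon> b \<and> p = opair E x y)"
  unfolding cart_prod_def by (rule mem_the_set[OF cart_prod_ex])

lemma opair_mem_cart_prod [simp]: "opair E x y \<epsilon> cart_prod E a b \<longleftrightarrow> x \<epsilon> a \<and> y \<epsilon> b"
  by (auto simp: mem_cart_prod)

lemma dtm_cart_prod [dfn_intros]: "dtm t \<Longrightarrow> dtm u \<Longrightarrow> dtm (\<lambda>e. cart_prod E (t e) (u e))"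
  by (rule dtm_comp2[where R = "cart_prod E"], unfold cart_prod_def, rule dtm_the_set, rule cart_prod_ex, intro dfn_intros)

lemma dfn_is_function [dfn_intros]:
  "dtm t \<Longrightarrow> dtm u \<Longrightarrow> dtm v \<Longrightarrow> dfn (\<lambda>e. is_function E (t e) (u e) (v e))"
  by (rule dfn_comp3[where R = "is_function E"], unfold is_function_def, intro dfn_intros)

lemma dfn_is_bijection [dfn_intros]:
  "dtm t \<Longrightarrow> dtm u \<Longrightarrow> dtm v \<Longrightarrow> dfn (\<lambda>e. is_bijection E (t e) (u e) (v e))"
  by (rule dfn_comp3[where R = "is_bijection E"], unfold is_bijection_def, intro dfn_intros)

lemma dfn_equipotent [dfn_intros]: "dtm t \<Longrightarrow> dtm u \<Longrightarrow> dfn (\<lambda>e. equipotent E (t e) (u e))"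
  by (rule dfn_comp2[where R = "equipotent E"], unfold equipotent_def, intro dfn_intros)

lemma dfn_is_finite [dfn_intros]: "dtm t \<Longrightarrow> dfn (\<lambda>e. is_finite E (t e))"
  by (rule dfn_comp1[where R = "is_finite E"], unfold is_finite_def, intro dfn_intros)

text \<open>
  Unlike \<open>app\<close>, this is definable on all arguments: the union of a singleton replaces the definite
  description, whose value is arbitrary when there is no unique witness.
\<close>
definition ap :: "'v \<Rightarrow> 'v \<Rightarrow> 'v" where
  "ap f x = union_of E (sep (union_of E (union_of E f)) (\<lambda>y. opair E x y \<epsilon> f))"

lemma dtm_ap [dfn_intros]: "dtm t \<Longrightarrow> dtm u \<Longrightarrow> dtm (\<lambda>e. ap (t e) (u e))"
  by (rule dtm_comp2[where R = ap], unfold ap_def, intro dfn_intros)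

lemma ap_eq:
  assumes "\<And>z. opair E x z \<epsilon> f \<longleftrightarrow> z = y"
  shows "ap f x = y"
proof -
  have D: "pdef (\<lambda>y. opair E x y \<epsilon> f)" by (intro dfn_intros)
  have "y \<epsilon> union_of E (union_of E f)"
  proof -
    have "y \<epsilon> upair E x y" "upair E x y \<epsilon> opair E x y" "opair E x y \<epsilon> f"
      using assms[of y] by (simp_all add: opair_def)
    then show ?thesis unfolding mem_union_of by blast
  qed
  then have "z \<epsilon> sep (union_of E (union_of E f)) (\<lambda>y. opair E x y \<epsilon> f) \<longleftrightarrow> z = y" for z
    unfolding mem_sep[OF D] using assms by blast
  then show ?thesis unfolding ap_def by (intro set_ext) simp
qed

lemma app_eq: "(\<And>z. opair E x z \<epsilon> f \<longleftrightarrow> z = y) \<Longrightarrow> app E f x = y"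
  unfolding app_def by blast

lemma function_ap:
  assumes "is_function E f a b" "x \<epsilon> a"
  shows "ap f x \<epsilon> b" "opair E x y \<epsilon> f \<longleftrightarrow> y = ap f x" "app E f x = ap f x"
proof -
  from assms obtain z where z: "\<And>y. opair E x y \<epsilon> f \<longleftrightarrow> y = z" unfolding is_function_def by blast
  with ap_eq have *: "ap f x = z" by blast
  from z * show "opair E x y \<epsilon> f \<longleftrightarrow> y = ap f x" by simp
  from assms z have "opair E x z \<epsilon> cart_prod E a b" unfolding is_function_def is_subset_def by blast
  with * show "ap f x \<epsilon> b" by simp
  show "app E f x = ap f x" using app_eq[OF z] * by simp
qed

lemma function_mem:
  assumes "is_function E f a b" "p \<epsilon> f"
  shows "\<exists>x. x \<epsilon> a \<and> p = opair E x (ap f x)"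
proof -
  obtain x y where "x \<epsilon> a" "p = opair E x y"
    using assms unfolding is_function_def is_subset_def mem_cart_prod by blast
  with function_ap(2)[OF assms(1)] assms(2) show ?thesis by auto
qed

lemma function_eqI:
  assumes "is_function E f a b" "is_function E g a b" "\<And>x. x \<epsilon> a \<Longrightarrow> ap f x = ap g x"
  shows "f = g"
proof (rule set_ext)
  fix p show "p \<epsilon> f \<longleftrightarrow> p \<epsilon> g"
  proof
    assume "p \<epsilon> f"
    then obtain x where "x \<epsilon> a" "p = opair E x (ap f x)" using function_mem[OF assms(1)] by blast
    then show "p \<epsilon> g" using assms(3) function_ap(2)[OF assms(2)] by simp
  next
    assume "p \<epsilon> g"
    then obtain x where "x \<epsilon> a" "p = opair E x (ap g x)" using function_mem[OF assms(2)] by blast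
    then show "p \<epsilon> f" using assms(3) function_ap(2)[OF assms(1)] by simp
  qed
qed

definition lam :: "'v \<Rightarrow> ('v \<Rightarrow> 'v) \<Rightarrow> 'v" where
  "lam a F = rep a (\<lambda>x. opair E x (F x))"

lemma mem_lam: "fdef F \<Longrightarrow> p \<epsilon> lam a F \<longleftrightarrow> (\<exists>x. x \<epsilon> a \<and> p = opair E x (F x))"
  unfolding lam_def by (rule mem_rep) (intro dfn_intros)

lemma ap_lam: "fdef F \<Longrightarrow> x \<epsilon> a \<Longrightarrow> ap (lam a F) x = F x"
  by (rule ap_eq) (auto simp: mem_lam)

lemma lam_function: "fdef F \<Longrightarrow> (\<And>x. x \<epsilon> a \<Longrightarrow> F x \<epsilon> b) \<Longrightarrow> is_function E (lam a F) a b"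
  by (auto simp: is_function_def is_subset_def mem_lam mem_cart_prod)

abbreviation ext_of :: "'v \<Rightarrow> 'v set" where "ext_of a \<equiv> {x. x \<epsilon> a}"

text \<open>\<open>ap\<close> turns an internal bijection into a definable HOL function, and
  \<open>lam\<close> goes back. From here on cardinality arguments can use \<open>bij_betw\<close>
  and \<open>inj_on\<close> on extensions.\<close>

lemma equipotent_iff: "equipotent E a b \<longleftrightarrow> (\<exists>F. fdef F \<and> bij_betw F (ext_of a) (ext_of b))"
proof
  assume "equipotent E a b"
  then obtain f where f: "is_function E f a b" "\<And>y. y \<epsilon> b \<Longrightarrow> \<exists>!x. opair E x y \<epsilon> f"
    unfolding equipotent_def is_bijection_def by blast
  have "bij_betw (ap f) (ext_of a) (ext_of b)"
    unfolding bij_betw_def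
  proof
    show "inj_on (ap f) (ext_of a)"
    proof (rule inj_onI)
      fix x y assume *: "x \<in> ext_of a" "y \<in> ext_of a" "ap f x = ap f y"
      then have "opair E x (ap f x) \<epsilon> f" "opair E y (ap f x) \<epsilon> f" "ap f x \<epsilon> b"
        using function_ap[OF f(1)] by auto
      then show "x = y" using f(2) by blast
    qed
    show "ap f ` ext_of a = ext_of b"
    proof
      show "ap f ` ext_of a \<subseteq> ext_of b" using function_ap(1)[OF f(1)] by auto
      show "ext_of b \<subseteq> ap f ` ext_of a"
      proof
        fix y assume "y \<in> ext_of b"
        then obtain x where "opair E x y \<epsilon> f" using f(2) by blast
        then show "y \<in> ap f ` ext_of a" using function_mem[OF f(1)] by force
      qed
    qed
  qed
  then show "\<exists>F. fdef F \<and> bij_betw F (ext_of a) (ext_of b)"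
    by (intro exI[of _ "ap f"] conjI dfn_intros)
next
  assume "\<exists>F. fdef F \<and> bij_betw F (ext_of a) (ext_of b)"
  then obtain F where F: "fdef F" "inj_on F (ext_of a)" "F ` ext_of a = ext_of b"
    unfolding bij_betw_def by blast
  have "is_function E (lam a F) a b" using F by (intro lam_function) auto
  moreover have "\<exists>!x. opair E x y \<epsilon> lam a F" if "y \<epsilon> b" for y
  proof -
    from that F(3) obtain x where x: "x \<epsilon> a" "y = F x" by blast
    show ?thesis using x F(2) by (auto simp: mem_lam[OF F(1)] inj_on_def)
  qed
  ultimately show "equipotent E a b" unfolding equipotent_def is_bijection_def by blast
qed

section \<open>Inductive sets and \<omega>\<close>

lemma dfn_is_empty [dfn_intros]: "dtm t \<Longrightarrow> dfn (\<lambda>e. is_empty E (t e))"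
  by (rule dfn_comp1[where R = "is_empty E"], unfold is_empty_def, intro dfn_intros)

lemma dfn_is_succ [dfn_intros]: "dtm t \<Longrightarrow> dtm u \<Longrightarrow> dfn (\<lambda>e. is_succ E (t e) (u e))"
  by (rule dfn_comp2[where R = "is_succ E"], unfold is_succ_def, intro dfn_intros)

lemma dfn_is_inductive [dfn_intros]: "dtm t \<Longrightarrow> dfn (\<lambda>e. is_inductive E (t e))"
  by (rule dfn_comp1[where R = "is_inductive E"], unfold is_inductive_def, intro dfn_intros)

lemma is_inductive_iff:
  "is_inductive E w \<longleftrightarrow> empty_set E \<epsilon> w \<and> (\<forall>x. x \<epsilon> w \<longrightarrow> succ E x \<epsilon> w)"
proof -
  have "is_empty E e \<longleftrightarrow> e = empty_set E" for e unfolding is_empty_def empty_iff by simp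
  moreover have "is_succ E x y \<longleftrightarrow> y = succ E x" for x y
    unfolding is_succ_def by (auto intro: set_ext)
  ultimately show ?thesis unfolding is_inductive_def by auto
qed

lemma omega_ex: "\<exists>a. \<forall>n. n \<epsilon> a \<longleftrightarrow> (\<forall>w. is_inductive E w \<longrightarrow> n \<epsilon> w)"
proof -
  obtain w where "is_inductive E w" using infinity by blast
  then show ?thesis by (intro bounded_set_ex[of _ w] dfn_intros) auto
qed

lemma mem_omega: "n \<epsilon> omega E \<longleftrightarrow> (\<forall>w. is_inductive E w \<longrightarrow> n \<epsilon> w)"
  unfolding omega_def by (rule mem_the_set[OF omega_ex])

lemma zero_mem_omega [simp]: "empty_set E \<epsilon> omega E"
  by (simp add: mem_omega is_inductive_iff)

lemma succ_mem_omega [simp]: "n \<epsilon> omega E \<Longrightarrow> succ E n \<epsilon> omega E"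
  by (simp add: mem_omega is_inductive_iff)

text \<open>The definability premise is essential: seen from outside, the structure may have
  nonstandard numbers, and induction over them can fail for HOL predicates. For the same reason
  varying hypotheses are put inside the induction statement as quantifiers and implications.\<close>

lemma omega_induct [consumes 1, case_names zero succ def]:
  assumes "n \<epsilon> omega E" "P (empty_set E)"
    "\<And>n. n \<epsilon> omega E \<Longrightarrow> P n \<Longrightarrow> P (succ E n)" "pdef P"
  shows "P n"
proof -
  have "is_inductive E (sep (omega E) P)"
    using assms(2,3) by (simp add: is_inductive_iff mem_sep[OF assms(4)])
  then show ?thesis using assms(1) mem_sep[OF assms(4)] unfolding mem_omega by blast
qed

section \<open>The natural numbers\<close>

lemma omega_mem_omega: "n \<epsilon> omega E \<Longrightarrow> m \<epsilon> n \<Longrightarrow> m \<epsilon> omega E"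
proof -
  assume "n \<epsilon> omega E"
  then have "\<forall>m. m \<epsilon> n \<longrightarrow> m \<epsilon> omega E"
    by (induction n rule: omega_induct) (auto intro!: dfn_intros)
  then show "m \<epsilon> n \<Longrightarrow> m \<epsilon> omega E" by blast
qed

lemma omega_trans: "n \<epsilon> omega E \<Longrightarrow> m \<epsilon> n \<Longrightarrow> k \<epsilon> m \<Longrightarrow> k \<epsilon> n"
proof -
  assume "n \<epsilon> omega E"
  then have "\<forall>m. m \<epsilon> n \<longrightarrow> (\<forall>k. k \<epsilon> m \<longrightarrow> k \<epsilon> n)"
    by (induction n rule: omega_induct) (auto intro!: dfn_intros)
  then show "m \<epsilon> n \<Longrightarrow> k \<epsilon> m \<Longrightarrow> k \<epsilon> n" by blast
qed

lemma mem_irrefl [simp]: "\<not> x \<epsilon> x"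
  using foundation[rule_format, of "upair E x x"] by auto

lemma mem_asym: "x \<epsilon> y \<Longrightarrow> \<not> y \<epsilon> x"
  using foundation[rule_format, of "upair E x y"] by auto

lemma zero_less_succ: "n \<epsilon> omega E \<Longrightarrow> empty_set E \<epsilon> succ E n"
  by (induction n rule: omega_induct) (auto intro!: dfn_intros)

lemma succ_le: "n \<epsilon> omega E \<Longrightarrow> m \<epsilon> n \<Longrightarrow> succ E m \<epsilon> succ E n"
proof -
  assume "n \<epsilon> omega E"
  then have "\<forall>m. m \<epsilon> n \<longrightarrow> succ E m \<epsilon> succ E n"
  proof (induction n rule: omega_induct)
    case (succ n)
    then show ?case by fastforce
  qed (auto intro!: dfn_intros)
  then show "m \<epsilon> n \<Longrightarrow> succ E m \<epsilon> succ E n" by blast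
qed

lemma omega_linear:
  assumes "m \<epsilon> omega E" "n \<epsilon> omega E"
  shows "m \<epsilon> n \<or> m = n \<or> n \<epsilon> m"
  using assms(1)
proof (induction m rule: omega_induct)
  case zero
  then show ?case using zero_less_succ[OF assms(2)] by auto
next
  case (succ m)
  then show ?case using succ_le[OF assms(2), of m] by auto
qed (intro dfn_intros)

lemma succ_inj: "m \<epsilon> omega E \<Longrightarrow> n \<epsilon> omega E \<Longrightarrow> succ E m = succ E n \<longleftrightarrow> m = n"
  using mem_asym mem_succ by metis

lemma succ_mem_succ: "m \<epsilon> omega E \<Longrightarrow> n \<epsilon> omega E \<Longrightarrow> succ E m \<epsilon> succ E n \<longleftrightarrow> m \<epsilon> n"
  using succ_le omega_linear mem_asym mem_succ mem_irrefl by metis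

lemma omega_cases: "n \<epsilon> omega E \<Longrightarrow> n = empty_set E \<or> (\<exists>m. m \<epsilon> omega E \<and> n = succ E m)"
  by (induction n rule: omega_induct) (auto intro!: dfn_intros)

lemma foundation_set: "x \<epsilon> a \<Longrightarrow> \<exists>x. x \<epsilon> a \<and> (\<forall>y. y \<epsilon> x \<longrightarrow> \<not> y \<epsilon> a)"
  using foundation by blast

text \<open>Minimum in \<omega>, written as the union of a singleton so that it is definable on all
  arguments. It is the selector that stands in for choice.\<close>

definition lst :: "'v \<Rightarrow> 'v" where
  "lst b = union_of E (sep b (\<lambda>m. \<forall>k. k \<epsilon> b \<longrightarrow> \<not> k \<epsilon> m))"

lemma dtm_lst [dfn_intros]: "dtm t \<Longrightarrow> dtm (\<lambda>e. lst (t e))"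
  by (rule dtm_comp1[where R = lst], unfold lst_def, intro dfn_intros)

lemma lst:
  assumes "is_subset E b (omega E)" "x \<epsilon> b"
  shows "lst b \<epsilon> b" "\<And>k. k \<epsilon> b \<Longrightarrow> \<not> k \<epsilon> lst b"
proof -
  have D: "pdef (\<lambda>m. \<forall>k. k \<epsilon> b \<longrightarrow> \<not> k \<epsilon> m)" by (intro dfn_intros)
  obtain m where m: "m \<epsilon> b" "\<And>y. y \<epsilon> m \<Longrightarrow> \<not> y \<epsilon> b" using foundation_set[OF assms(2)] by blast
  have "z \<epsilon> sep b (\<lambda>m. \<forall>k. k \<epsilon> b \<longrightarrow> \<not> k \<epsilon> m) \<longleftrightarrow> z = m" for z
    unfolding mem_sep[OF D] using m omega_linear[of z m] assms(1) unfolding is_subset_def by blast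
  then have "lst b = m" unfolding lst_def by (intro set_ext) simp
  with m show "lst b \<epsilon> b" "\<And>k. k \<epsilon> b \<Longrightarrow> \<not> k \<epsilon> lst b" by blast+
qed

lemma lst_le:
  assumes "is_subset E b (omega E)" "x \<epsilon> b"
  shows "lst b \<epsilon> succ E x"
  using lst[OF assms] assms omega_linear[of "lst b" x] unfolding is_subset_def by auto

section \<open>Recursion on the natural numbers\<close>

lemma dtm_subst: "dtm t \<Longrightarrow> dtm (\<lambda>e. t (\<lambda>i. case_sum e (\<lambda>c. c) (f i)))"
proof -
  assume "dtm t"
  from dfn_subst[OF this[unfolded dtm_def], of "case_nat (Inl 0) (\<lambda>i. map_sum Suc id (f i))"]
  have "dfn (\<lambda>e. e 0 = t (\<lambda>n. case_sum e (\<lambda>c. c) (map_sum Suc id (f n))))" by simp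
  moreover have "case_sum e (\<lambda>c. c) (map_sum Suc id r) = case_sum (\<lambda>n. e (Suc n)) (\<lambda>c. c) r"
    for e :: "nat \<Rightarrow> 'v" and r by (cases r) auto
  ultimately show ?thesis unfolding dtm_def by simp
qed

abbreviation fdef2 :: "('v \<Rightarrow> 'v \<Rightarrow> 'v) \<Rightarrow> bool" where
  "fdef2 h \<equiv> dtm (\<lambda>e. h (e 0) (e (Suc 0)))"

text \<open>The approximation \<open>f\<close> is an arbitrary set read through the total
  \<open>ap\<close>, which spares all bookkeeping about domains; only its values up to
  \<open>n\<close> matter.\<close>

definition rec_rel :: "'v \<Rightarrow> ('v \<Rightarrow> 'v \<Rightarrow> 'v) \<Rightarrow> 'v \<Rightarrow> 'v \<Rightarrow> bool" where
  "rec_rel z h n y \<longleftrightarrow> (\<exists>f. ap f (empty_set E) = z \<and>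
     (\<forall>m. m \<epsilon> n \<longrightarrow> ap f (succ E m) = h m (ap f m)) \<and> ap f n = y)"

text \<open>The explicit default outside \<omega> gives unique existence for every \<open>n\<close>,
  as \<open>dtm_THE\<close> demands.\<close>

definition rec :: "'v \<Rightarrow> ('v \<Rightarrow> 'v \<Rightarrow> 'v) \<Rightarrow> 'v \<Rightarrow> 'v" where
  "rec z h n = (THE y. n \<epsilon> omega E \<and> rec_rel z h n y \<or> \<not> n \<epsilon> omega E \<and> y = empty_set E)"

lemma rec_step:
  assumes h: "fdef2 h" and n: "n \<epsilon> omega E" and r: "rec_rel z h n y"
  shows "rec_rel z h (succ E n) (h n y)"
proof -
  note h' = dtm_comp2[where R = h, OF h]
  from r obtain f where f: "ap f (empty_set E) = z" "\<And>m. m \<epsilon> n \<Longrightarrow> ap f (succ E m) = h m (ap f m)"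
    "ap f n = y" unfolding rec_rel_def by blast
  \<comment> \<open>Only the value at \<open>succ E n\<close> is new; it is the last argument in the
    domain \<open>succ E (succ E n)\<close> below.\<close>
  define F where "F m = (if m \<epsilon> succ E n then ap f m else h n (ap f n))" for m
  have F: "fdef F" unfolding F_def by (intro dfn_intros)
  let ?g = "lam (succ E (succ E n)) F"
  have g: "m \<epsilon> succ E n \<Longrightarrow> ap ?g m = ap f m" for m by (subst ap_lam[OF F]) (auto simp: F_def)
  have g': "ap ?g (succ E n) = h n y" by (subst ap_lam[OF F]) (auto simp: F_def f(3))
  have "ap ?g (succ E m) = h m (ap ?g m)" if "m \<epsilon> succ E n" for m
  proof (cases "m = n")
    case True
    then show ?thesis using g[OF that] g' f(3) by simp
  next
    case False
    then have "m \<epsilon> n" using that by simp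
    then show ?thesis using g[OF that] g[OF succ_le[OF n]] f(2) by simp
  qed
  then show ?thesis unfolding rec_rel_def using g[OF zero_less_succ[OF n]] f(1) g' by auto
qed

lemma dfn_rec_rel [dfn_intros]:
  assumes "dtm z" "dtm n" "dtm y" "dtm (\<lambda>e. h (\<lambda>i. e (Suc (Suc i))) (e (Suc 0)) (e 0))"
  shows "dfn (\<lambda>e. rec_rel (z e) (h e) (n e) (y e))"
  unfolding rec_rel_def
proof (intro dfn_intros dtm_ren[OF assms(1)] dtm_ren[OF assms(2)] dtm_ren[OF assms(3)])
  have "dtm (\<lambda>e. h (\<lambda>i. e (Suc (Suc (Suc i)))) (e (Suc 0)) (e 0))"
    using dtm_ren[OF assms(4), of "case_nat 0 (case_nat 1 (\<lambda>i. Suc (Suc (Suc i))))"] by simp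
  from dtm_comp[where F = "\<lambda>e. h (\<lambda>i. e (Suc (Suc i))) (e 0)" and t = "\<lambda>e. ap (e (Suc 0)) (e 0)", OF this]
  show "dtm (\<lambda>e. h (\<lambda>n. e (Suc (Suc n))) (e 0) (ap (e (Suc 0)) (e 0)))" by (simp add: dfn_intros)
qed

lemma rec_ex:
  assumes h: "fdef2 h" and n: "n \<epsilon> omega E"
  shows "\<exists>y. rec_rel z h n y"
  using n
proof (induction n rule: omega_induct)
  case zero
  have "ap (lam (succ E (empty_set E)) (\<lambda>_. z)) (empty_set E) = z"
    by (rule ap_lam) (auto intro: dfn_intros)
  then show ?case unfolding rec_rel_def by auto
next
  case (succ n)
  then show ?case using rec_step[OF h] by blast
next
  have "dtm (\<lambda>e. h (e (Suc 0)) (e 0))" by (rule dtm_comp2[where R = h, OF h]) (intro dfn_intros)+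
  then show "pdef (\<lambda>n. \<exists>y. rec_rel z h n y)" by (intro dfn_intros)
qed

lemma rec_unique:
  assumes h: "fdef2 h" and n: "n \<epsilon> omega E" and r: "rec_rel z h n y" "rec_rel z h n y'"
  shows "y = y'"
proof -
  from r obtain f g where f: "ap f (empty_set E) = z" "\<And>m. m \<epsilon> n \<Longrightarrow> ap f (succ E m) = h m (ap f m)"
    "ap f n = y" and g: "ap g (empty_set E) = z" "\<And>m. m \<epsilon> n \<Longrightarrow> ap g (succ E m) = h m (ap g m)"
    "ap g n = y'" unfolding rec_rel_def by blast
  from n have "n \<epsilon> succ E n \<longrightarrow> ap f n = ap g n"
  proof (rule omega_induct[where P = "\<lambda>m. m \<epsilon> succ E n \<longrightarrow> ap f m = ap g m"])
    fix m assume m: "m \<epsilon> omega E" "m \<epsilon> succ E n \<longrightarrow> ap f m = ap g m"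
    show "succ E m \<epsilon> succ E n \<longrightarrow> ap f (succ E m) = ap g (succ E m)"
      using m f(2) g(2) succ_mem_succ[OF m(1) n] by simp
  qed (auto simp: f(1) g(1) intro!: dfn_intros)
  then show ?thesis using f(3) g(3) by simp
qed

lemma rec_ex1:
  assumes "fdef2 h"
  shows "\<exists>!y. n \<epsilon> omega E \<and> rec_rel z h n y \<or> \<not> n \<epsilon> omega E \<and> y = empty_set E"
proof (cases "n \<epsilon> omega E")
  case True
  then show ?thesis using rec_ex[OF assms True, of z] rec_unique[OF assms True, of z] by blast
qed auto

lemma rec_eqI:
  assumes "fdef2 h" "n \<epsilon> omega E" "rec_rel z h n y"
  shows "rec z h n = y"
  unfolding rec_def by (rule the1_equality[OF rec_ex1[OF assms(1)]]) (use assms in simp)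

lemma rec_zero:
  assumes "fdef2 h"
  shows "rec z h (empty_set E) = z"
proof (rule rec_eqI[OF assms zero_mem_omega])
  have "ap (lam (succ E (empty_set E)) (\<lambda>_. z)) (empty_set E) = z"
    by (rule ap_lam) (auto intro: dfn_intros)
  then show "rec_rel z h (empty_set E) z" unfolding rec_rel_def by auto
qed

lemma rec_succ:
  assumes "fdef2 h" "n \<epsilon> omega E"
  shows "rec z h (succ E n) = h n (rec z h n)"
proof -
  obtain y where y: "rec_rel z h n y" using rec_ex[OF assms] by blast
  show ?thesis using rec_eqI[OF assms y] rec_eqI[OF assms(1) _ rec_step[OF assms y]] assms(2) by simp
qed

lemma dtm_rec [dfn_intros]:
  assumes "dtm z" "dtm n" "dtm (\<lambda>e. h (\<lambda>i. e (Suc (Suc i))) (e (Suc 0)) (e 0))"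
  shows "dtm (\<lambda>e. rec (z e) (h e) (n e))"
  unfolding rec_def
proof (rule dtm_THE)
  fix e
  \<comment> \<open>The coordinates of the fixed \<open>e\<close> are frozen into parameters, which
    leaves a binary operation that \<open>rec_ex1\<close> can handle.\<close>
  have "dtm (\<lambda>e'. h e (e' 0) (e' (Suc 0)))"
    using dtm_subst[OF assms(3), of "case_nat (Inl 1) (case_nat (Inl 0) (\<lambda>i. Inr (e i)))"] by simp
  then show "\<exists>!y. n e \<epsilon> omega E \<and> rec_rel (z e) (h e) (n e) y \<or> \<not> n e \<epsilon> omega E \<and> y = empty_set E"
    by (rule rec_ex1)
next
  have "dtm (\<lambda>e. h (\<lambda>i. e (Suc (Suc (Suc i)))) (e (Suc 0)) (e 0))"
    using dtm_ren[OF assms(3), of "case_nat 0 (case_nat 1 (\<lambda>i. Suc (Suc (Suc i))))"] by simp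
  then show "dfn (\<lambda>e. n (\<lambda>n. e (Suc n)) \<epsilon> omega E \<and> rec_rel (z (\<lambda>n. e (Suc n))) (h (\<lambda>n. e (Suc n))) (n (\<lambda>n. e (Suc n))) (e 0) \<or>
      \<not> n (\<lambda>n. e (Suc n)) \<epsilon> omega E \<and> e 0 = empty_set E)"
    by (intro dfn_intros dtm_ren[OF assms(1)] dtm_ren[OF assms(2)])
qed

section \<open>Finite and countable sets\<close>

lemma is_finiteI:
  assumes "n \<epsilon> omega E" "fdef F" "bij_betw F (ext_of a) (ext_of n)"
  shows "is_finite E a"
  unfolding is_finite_def equipotent_iff using assms by blast

lemma is_finiteE:
  assumes "is_finite E a"
  obtains n F where "n \<epsilon> omega E" "fdef F" "bij_betw F (ext_of a) (ext_of n)"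
  using assms unfolding is_finite_def equipotent_iff by blast

lemma is_countableI:
  assumes "fdef F" "inj_on F (ext_of a)" "\<And>x. x \<epsilon> a \<Longrightarrow> F x \<epsilon> omega E"
  shows "is_countable E a"
proof -
  have "is_subset E (rep a F) (omega E)" using assms(3) by (auto simp: is_subset_def mem_rep[OF assms(1)])
  moreover have "equipotent E a (rep a F)"
    unfolding equipotent_iff bij_betw_def
    by (rule exI[of _ F]) (auto simp: assms(1,2) mem_rep[OF assms(1)])
  ultimately show ?thesis unfolding is_countable_def by blast
qed

lemma is_countableE:
  assumes "is_countable E a"
  obtains F where "fdef F" "\<And>x y. x \<epsilon> a \<Longrightarrow> y \<epsilon> a \<Longrightarrow> F x = F y \<Longrightarrow> x = y" "\<And>x. x \<epsilon> a \<Longrightarrow> F x \<epsilon> omega E"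
proof -
  from assms obtain b F where b: "is_subset E b (omega E)" "fdef F" "bij_betw F (ext_of a) (ext_of b)"
    unfolding is_countable_def equipotent_iff by blast
  show ?thesis
  proof (rule that[OF b(2)])
    show "x = y" if "x \<epsilon> a" "y \<epsilon> a" "F x = F y" for x y
      using b(3) that by (auto simp: bij_betw_def inj_on_def)
    show "F x \<epsilon> omega E" if "x \<epsilon> a" for x
      using b that by (auto simp: bij_betw_def is_subset_def)
  qed
qed

lemma countable_mono:
  assumes "is_countable E a" "\<And>x. x \<epsilon> b \<Longrightarrow> x \<epsilon> a"
  shows "is_countable E b"
proof -
  from assms(1) obtain F where F: "fdef F"
    "\<And>x y. x \<epsilon> a \<Longrightarrow> y \<epsilon> a \<Longrightarrow> F x = F y \<Longrightarrow> x = y" "\<And>x. x \<epsilon> a \<Longrightarrow> F x \<epsilon> omega E"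
    by (rule is_countableE) (rule that)
  show ?thesis using F assms(2) by (intro is_countableI[of F]) (auto simp: inj_on_def)
qed

lemma countable_inj:
  assumes "is_countable E b" "fdef F" "inj_on F (ext_of a)" "\<And>x. x \<epsilon> a \<Longrightarrow> F x \<epsilon> b"
  shows "is_countable E a"
proof -
  from assms(1) obtain G where G: "fdef G"
    "\<And>x y. x \<epsilon> b \<Longrightarrow> y \<epsilon> b \<Longrightarrow> G x = G y \<Longrightarrow> x = y" "\<And>x. x \<epsilon> b \<Longrightarrow> G x \<epsilon> omega E"
    by (rule is_countableE) (rule that)
  note [dfn_intros] = dtm_comp1[where R = F, OF assms(2)] dtm_comp1[where R = G, OF G(1)]
  show ?thesis
  proof (rule is_countableI[of "\<lambda>x. G (F x)"])
    show "fdef (\<lambda>x. G (F x))" by (intro dfn_intros)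
    show "inj_on (\<lambda>x. G (F x)) (ext_of a)"
      using G(2) assms(3,4) by (auto simp: inj_on_def)
    show "G (F x) \<epsilon> omega E" if "x \<epsilon> a" for x using G(3) assms(4) that by blast
  qed
qed

lemma countable_omega: "is_countable E (omega E)"
  by (rule is_countableI[of "\<lambda>x. x"]) (auto intro: dfn_intros)

text \<open>A value of \<open>H\<close> is coded by the least code among its preimages, so no
  preimage has to be chosen.\<close>

lemma countable_rep:
  assumes "is_countable E a" and H: "fdef H"
  shows "is_countable E (rep a H)"
proof -
  from assms(1) obtain F where F: "fdef F"
    "\<And>x y. x \<epsilon> a \<Longrightarrow> y \<epsilon> a \<Longrightarrow> F x = F y \<Longrightarrow> x = y" "\<And>x. x \<epsilon> a \<Longrightarrow> F x \<epsilon> omega E"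
    by (rule is_countableE) (rule that)
  note [dfn_intros] = dtm_comp1[where R = F, OF F(1)] dtm_comp1[where R = H, OF H]
  define G where "G y = lst (rep (sep a (\<lambda>x. H x = y)) F)" for y
  have D: "pdef (\<lambda>x. H x = y)" for y by (intro dfn_intros)
  have G: "\<exists>x. x \<epsilon> a \<and> H x = y \<and> G y = F x" if y: "y \<epsilon> rep a H" for y
  proof -
    from y obtain x where "x \<epsilon> a" "y = H x" by (auto simp: mem_rep[OF H])
    then have "F x \<epsilon> rep (sep a (\<lambda>x. H x = y)) F" by (auto simp: mem_rep[OF F(1)] mem_sep[OF D])
    moreover have "is_subset E (rep (sep a (\<lambda>x. H x = y)) F) (omega E)"
      by (auto simp: is_subset_def mem_rep[OF F(1)] mem_sep[OF D] F(3))
    ultimately have "G y \<epsilon> rep (sep a (\<lambda>x. H x = y)) F" unfolding G_def by (intro lst(1))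
    then show ?thesis by (auto simp: mem_rep[OF F(1)] mem_sep[OF D])
  qed
  show ?thesis
  proof (rule is_countableI[of G])
    show "fdef G" unfolding G_def by (intro dfn_intros)
    show "inj_on G (ext_of (rep a H))"
    proof (rule inj_onI)
      fix y z assume *: "y \<in> ext_of (rep a H)" "z \<in> ext_of (rep a H)" "G y = G z"
      from * G obtain u where u: "u \<epsilon> a" "H u = y" "G y = F u" by blast
      from * G obtain w where w: "w \<epsilon> a" "H w = z" "G z = F w" by blast
      show "y = z" using F(2)[OF u(1) w(1)] u w * by simp
    qed
    show "G x \<epsilon> omega E" if "x \<epsilon> rep a H" for x using G[OF that] F(3) by auto
  qed
qed

lemma finite_countable:
  assumes "is_finite E a"
  shows "is_countable E a"
proof -
  from assms obtain n F where n: "n \<epsilon> omega E" "fdef F" "bij_betw F (ext_of a) (ext_of n)"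
    by (rule is_finiteE) (rule that)
  show ?thesis
  proof (rule is_countableI[OF n(2)])
    show "inj_on F (ext_of a)" using n(3) by (simp add: bij_betw_def)
    show "F x \<epsilon> omega E" if "x \<epsilon> a" for x
      using n that omega_mem_omega[OF n(1)] by (auto simp: bij_betw_def)
  qed
qed

lemma finite_empty: "is_finite E (empty_set E)"
  by (rule is_finiteI[of "empty_set E" "\<lambda>x. x"]) (auto intro: dfn_intros simp: bij_betw_def)

lemma finite_insert:
  assumes "is_finite E a" "\<And>y. y \<epsilon> b \<longleftrightarrow> y \<epsilon> a \<or> y = x"
  shows "is_finite E b"
proof (cases "x \<epsilon> a")
  case True
  then have "b = a" by (intro set_ext) (use assms(2) in auto)
  with assms(1) show ?thesis by simp
next
  case False
  from assms(1) obtain n F where n: "n \<epsilon> omega E" "fdef F" "bij_betw F (ext_of a) (ext_of n)"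
    by (rule is_finiteE) (rule that)
  note [dfn_intros] = dtm_comp1[where R = F, OF n(2)]
  show ?thesis
  proof (rule is_finiteI[of "succ E n" "\<lambda>y. if y = x then n else F y"])
    show "succ E n \<epsilon> omega E" using n(1) by simp
    show "fdef (\<lambda>y. if y = x then n else F y)" by (intro dfn_intros)
    have "bij_betw (\<lambda>y. if y = x then n else F y) (ext_of a) (ext_of n)"
      using n(3) False by (subst bij_betw_cong[of _ _ F]) auto
    from bij_betw_combine[OF this, of "{x}" "{n}"]
    have "bij_betw (\<lambda>y. if y = x then n else F y) (ext_of a \<union> {x}) (ext_of n \<union> {n})"
      by (simp add: bij_betw_def)
    moreover have "ext_of b = ext_of a \<union> {x}" "ext_of (succ E n) = ext_of n \<union> {n}"
      using assms(2) by auto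
    ultimately show "bij_betw (\<lambda>y. if y = x then n else F y) (ext_of b) (ext_of (succ E n))" by simp
  qed
qed

text \<open>Raising the bound by one adds at most one element, because the codes are
  injective.\<close>

lemma finite_initial:
  assumes F: "fdef F" and inj: "\<And>x y. x \<epsilon> a \<Longrightarrow> y \<epsilon> a \<Longrightarrow> F x = F y \<Longrightarrow> x = y"
    and n: "n \<epsilon> omega E"
  shows "is_finite E (sep a (\<lambda>x. F x \<epsilon> n))"
proof -
  note [dfn_intros] = dtm_comp1[where R = F, OF F]
  have D: "pdef (\<lambda>x. F x \<epsilon> n)" for n by (intro dfn_intros)
  from n show ?thesis
  proof (induction n rule: omega_induct)
    case zero
    have "sep a (\<lambda>x. F x \<epsilon> empty_set E) = empty_set E" by (intro set_ext, unfold mem_sep[OF D]) simp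
    then show ?case using finite_empty by simp
  next
    case (succ n)
    show ?case
    proof (cases "\<exists>x. x \<epsilon> a \<and> F x = n")
      case True
      then obtain x where "x \<epsilon> a" "F x = n" by blast
      then show ?thesis using inj by (intro finite_insert[OF succ.IH], unfold mem_sep[OF D]) auto
    next
      case False
      then have "sep a (\<lambda>x. F x \<epsilon> succ E n) = sep a (\<lambda>x. F x \<epsilon> n)"
        by (intro set_ext, unfold mem_sep[OF D]) auto
      then show ?thesis using succ.IH by simp
    qed
  qed (intro dfn_intros)
qed

section \<open>Topology\<close>

text \<open>
  These keep the simplifier out of the body of a comprehension, where it would destroy the form in
  which definability has been proved.
\<close>
lemma sep_weak_cong [cong]: "a = b \<Longrightarrow> sep a P = sep b P"
  by simp

lemma rep_weak_cong [cong]: "a = b \<Longrightarrow> rep a F = rep b F"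
  by simp

lemma is_subsetI: "(\<And>x. x \<epsilon> a \<Longrightarrow> x \<epsilon> b) \<Longrightarrow> is_subset E a b"
  unfolding is_subset_def by blast

lemma is_subsetD: "is_subset E a b \<Longrightarrow> x \<epsilon> a \<Longrightarrow> x \<epsilon> b"
  unfolding is_subset_def by blast

section \<open>Product topology, closed projections and local openness\<close>

lemma mem_open_boxes: "R \<epsilon> open_boxes E TX TY \<longleftrightarrow> (\<exists>U V. U \<epsilon> TX \<and> V \<epsilon> TY \<and> R = cart_prod E U V)"
  unfolding open_boxes_def
  by (rule mem_the_set, rule bounded_set_ex[of _ "pow (cart_prod E (union_of E TX) (union_of E TY))"])
    (intro dfn_intros, auto simp: is_subset_def mem_cart_prod, blast+)

lemma mem_product_topology:
  "W \<epsilon> product_topology E TX TY \<longleftrightarrow>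
   (\<forall>p. p \<epsilon> W \<longrightarrow> (\<exists>U V. U \<epsilon> TX \<and> V \<epsilon> TY \<and> p \<epsilon> cart_prod E U V \<and> is_subset E (cart_prod E U V) W))"
  (is "_ \<longleftrightarrow> ?R")
proof -
  let ?B = "open_boxes E TX TY"
  have D: "pdef (\<lambda>R. is_subset E R W)" by (intro dfn_intros)
  have "W \<epsilon> product_topology E TX TY \<longleftrightarrow> (\<exists>S. is_subset E S ?B \<and> W = union_of E S)"
    unfolding product_topology_def
    by (rule mem_the_set, rule bounded_set_ex[of _ "pow (union_of E ?B)"])
      (intro dfn_intros, auto simp: is_subset_def, blast)
  also have "\<dots> \<longleftrightarrow> ?R"
  proof
    assume "\<exists>S. is_subset E S ?B \<and> W = union_of E S"
    then obtain S where S: "is_subset E S ?B" "W = union_of E S" by blast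
    show ?R
    proof (intro allI impI)
      fix p assume "p \<epsilon> W"
      then obtain R where R: "R \<epsilon> S" "p \<epsilon> R" using S(2) by auto
      then obtain U V where "U \<epsilon> TX" "V \<epsilon> TY" "R = cart_prod E U V"
        using S(1) unfolding is_subset_def mem_open_boxes by blast
      moreover have "is_subset E R W" unfolding S(2) is_subset_def using R(1) by auto
      ultimately show "\<exists>U V. U \<epsilon> TX \<and> V \<epsilon> TY \<and> p \<epsilon> cart_prod E U V \<and> is_subset E (cart_prod E U V) W"
        using R(2) by blast
    qed
  next
    assume R: ?R
    \<comment> \<open>All boxes inside \<open>W\<close> are taken at once, so no box has to be
      chosen for each point.\<close>
    let ?S = "sep ?B (\<lambda>R. is_subset E R W)"
    have "W = union_of E ?S"
    proof (rule set_ext)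
      fix p show "p \<epsilon> W \<longleftrightarrow> p \<epsilon> union_of E ?S"
        unfolding mem_union_of mem_sep[OF D] using R unfolding mem_open_boxes is_subset_def by blast
    qed
    moreover have "is_subset E ?S ?B" by (simp add: is_subset_def mem_sep[OF D])
    ultimately show "\<exists>S. is_subset E S ?B \<and> W = union_of E S" by blast
  qed
  finally show ?thesis .
qed

lemma mem_projection: "p \<epsilon> projection E X Y \<longleftrightarrow> (\<exists>x y. x \<epsilon> X \<and> y \<epsilon> Y \<and> p = opair E (opair E x y) x)"
  unfolding projection_def
  by (rule mem_the_set, rule bounded_set_ex[of _ "cart_prod E (cart_prod E X Y) X"])
    (intro dfn_intros, auto)

lemma mem_image_of: "y \<epsilon> image_of E f c \<longleftrightarrow> (\<exists>x. x \<epsilon> c \<and> opair E x y \<epsilon> f)"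
  unfolding image_of_def
proof (rule mem_the_set, rule bounded_set_ex[of _ "union_of E (union_of E f)"])
  show "y \<epsilon> union_of E (union_of E f)" if "\<exists>x. x \<epsilon> c \<and> opair E x y \<epsilon> f" for y
  proof -
    from that obtain x where "opair E x y \<epsilon> f" by blast
    moreover have "y \<epsilon> upair E x y" "upair E x y \<epsilon> opair E x y" by (simp_all add: opair_def)
    ultimately show ?thesis unfolding mem_union_of by blast
  qed
qed (intro dfn_intros)

lemma mem_image_projection:
  "x \<epsilon> image_of E (projection E X Y) C \<longleftrightarrow> x \<epsilon> X \<and> (\<exists>y. y \<epsilon> Y \<and> opair E x y \<epsilon> C)"
  by (auto simp: mem_image_of mem_projection)

lemma topologyD:
  assumes "topology_on E X T"
  shows "U \<epsilon> T \<Longrightarrow> x \<epsilon> U \<Longrightarrow> x \<epsilon> X" "X \<epsilon> T" "empty_set E \<epsilon> T"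
    "U \<epsilon> T \<Longrightarrow> V \<epsilon> T \<Longrightarrow> inter E U V \<epsilon> T" "is_subset E S T \<Longrightarrow> union_of E S \<epsilon> T"
  using assms unfolding topology_on_def is_subset_def by blast+

definition tube :: "'v \<Rightarrow> 'v \<Rightarrow> 'v \<Rightarrow> 'v" where
  "tube X Y W = sep X (\<lambda>x. \<forall>y. y \<epsilon> Y \<longrightarrow> opair E x y \<epsilon> W)"

lemma mem_tube: "x \<epsilon> tube X Y W \<longleftrightarrow> x \<epsilon> X \<and> (\<forall>y. y \<epsilon> Y \<longrightarrow> opair E x y \<epsilon> W)"
  unfolding tube_def by (rule mem_sep) (intro dfn_intros)

lemma projection_closed_iff:
  assumes X: "topology_on E X TX" and Y: "topology_on E Y TY"
  shows "projection_closed E X TX Y TY \<longleftrightarrow>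
    (\<forall>W. W \<epsilon> product_topology E TX TY \<longrightarrow> tube X Y W \<epsilon> TX)"
proof -
  let ?P = "product_topology E TX TY" and ?XY = "cart_prod E X Y" and ?\<pi> = "projection E X Y"
  \<comment> \<open>Open sets of the product lie in the carrier, so that taking complements twice
    returns the given set.\<close>
  have sub: "p \<epsilon> ?XY" if "W \<epsilon> ?P" "p \<epsilon> W" for W p
  proof -
    from that obtain U V where "U \<epsilon> TX" "V \<epsilon> TY" "p \<epsilon> cart_prod E U V"
      unfolding mem_product_topology by blast
    then show ?thesis using topologyD(1)[OF X] topologyD(1)[OF Y] by (auto simp: mem_cart_prod)
  qed
  have tube: "diff E X (image_of E ?\<pi> C) = tube X Y (diff E ?XY C)" for C
    by (rule set_ext) (auto simp: mem_tube mem_image_projection)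
  have "is_closed E X TX (image_of E ?\<pi> C) \<longleftrightarrow> tube X Y (diff E ?XY C) \<epsilon> TX" for C
    unfolding is_closed_def tube by (auto simp: is_subset_def mem_image_projection)
  then have "projection_closed E X TX Y TY \<longleftrightarrow>
      (\<forall>C. is_subset E C ?XY \<and> diff E ?XY C \<epsilon> ?P \<longrightarrow> tube X Y (diff E ?XY C) \<epsilon> TX)"
    unfolding projection_closed_def closed_map_def is_closed_def by blast
  also have "\<dots> \<longleftrightarrow> (\<forall>W. W \<epsilon> ?P \<longrightarrow> tube X Y W \<epsilon> TX)"
  proof (intro iffI allI impI)
    fix W assume *: "\<forall>C. is_subset E C ?XY \<and> diff E ?XY C \<epsilon> ?P \<longrightarrow> tube X Y (diff E ?XY C) \<epsilon> TX" "W \<epsilon> ?P"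
    have "diff E ?XY (diff E ?XY W) = W" by (rule set_ext) (use sub[OF *(2)] in auto)
    with *(1)[rule_format, of "diff E ?XY W"] *(2) show "tube X Y W \<epsilon> TX"
      by (simp add: is_subset_def)
  qed blast
  finally show ?thesis .
qed

text \<open>The union of all open subsets of \<open>A\<close> exhausts \<open>A\<close>; no
  neighbourhood is chosen.\<close>

lemma open_locally:
  assumes "topology_on E X T" "\<And>x. x \<epsilon> A \<Longrightarrow> \<exists>U. U \<epsilon> T \<and> x \<epsilon> U \<and> is_subset E U A"
  shows "A \<epsilon> T"
proof -
  have D: "pdef (\<lambda>U. is_subset E U A)" by (intro dfn_intros)
  have "union_of E (sep T (\<lambda>U. is_subset E U A)) \<epsilon> T"
    by (rule topologyD(5)[OF assms(1)]) (simp add: is_subset_def[of E _ T] mem_sep[OF D])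
  moreover have "union_of E (sep T (\<lambda>U. is_subset E U A)) = A"
    using assms(2) by (intro set_ext) (auto simp: mem_sep[OF D] is_subset_def)
  ultimately show ?thesis by simp
qed

text \<open>Finiteness enters as a bound on injective codes, so that induction adds at most one open
  set per step. Intersecting within \<open>X\<close> makes the empty intersection equal to
  \<open>X\<close>.\<close>

lemma finite_inter_open:
  assumes T: "topology_on E X T" and S: "is_subset E S T" and h: "fdef h"
    and inj: "\<And>U V. U \<epsilon> S \<Longrightarrow> V \<epsilon> S \<Longrightarrow> h U = h V \<Longrightarrow> U = V" and n: "n \<epsilon> omega E"
  shows "sep X (\<lambda>x. \<forall>U. U \<epsilon> S \<and> h U \<epsilon> n \<longrightarrow> x \<epsilon> U) \<epsilon> T"
proof -
  note [dfn_intros] = dtm_comp1[where R = h, OF h]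
  let ?A = "\<lambda>n. sep X (\<lambda>x. \<forall>U. U \<epsilon> S \<and> h U \<epsilon> n \<longrightarrow> x \<epsilon> U)"
  have D: "pdef (\<lambda>x. \<forall>U. U \<epsilon> S \<and> h U \<epsilon> n \<longrightarrow> x \<epsilon> U)" for n by (intro dfn_intros)
  from n show ?thesis
  proof (induction n rule: omega_induct)
    case zero
    have "?A (empty_set E) = X" by (intro set_ext, unfold mem_sep[OF D]) simp
    then show ?case using topologyD(2)[OF T] by simp
  next
    case (succ n)
    show ?case
    proof (cases "\<exists>U. U \<epsilon> S \<and> h U = n")
      case True
      then obtain U where U: "U \<epsilon> S" "h U = n" by blast
      then have "?A (succ E n) = inter E (?A n) U"
        using inj by (intro set_ext, unfold mem_inter mem_sep[OF D]) auto
      then show ?thesis using topologyD(4)[OF T succ.IH] is_subsetD[OF S U(1)] by simp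
    next
      case False
      then have "?A (succ E n) = ?A n" by (intro set_ext, unfold mem_sep[OF D]) auto
      then show ?thesis using succ.IH by simp
    qed
  qed (intro dfn_intros)
qed

text \<open>\<open>W\<close> is open because near a point of a cover member with code
  \<open>m\<close> every condition for a set of code at least \<open>m\<close> holds automatically,
  and only finitely many conditions remain. Its tube is the given intersection because a point
  missing from one \<open>U\<close> would let the finitely many cover members with code at most that
  of \<open>U\<close> cover \<open>Y\<close>.\<close>

lemma P_space_if_projection_closed:
  assumes Y: "topology_on E Y TY" and nc: "\<not> countably_compact_space E Y TY"
    and X: "topology_on E X TX" and cl: "projection_closed E X TX Y TY"
  shows "P_space E X TX"
  unfolding P_space_def
proof (intro allI impI)
  fix G assume "is_G_delta E X TX G"
  then obtain R where R: "is_subset E R TX" "is_countable E R"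
    "\<And>x. x \<epsilon> G \<longleftrightarrow> x \<epsilon> X \<and> (\<forall>U. U \<epsilon> R \<longrightarrow> x \<epsilon> U)" unfolding is_G_delta_def by blast
  from nc obtain S where S: "is_subset E S TY" "union_of E S = Y" "is_countable E S"
    and nf: "\<And>S'. is_subset E S' S \<Longrightarrow> is_finite E S' \<Longrightarrow> \<not> open_cover E Y TY S'"
    unfolding countably_compact_space_def open_cover_def by blast
  from R(2) obtain h where h: "fdef h"
    "\<And>U V. U \<epsilon> R \<Longrightarrow> V \<epsilon> R \<Longrightarrow> h U = h V \<Longrightarrow> U = V" "\<And>U. U \<epsilon> R \<Longrightarrow> h U \<epsilon> omega E"
    by (rule is_countableE) (rule that)
  from S(3) obtain g where g: "fdef g"
    "\<And>U V. U \<epsilon> S \<Longrightarrow> V \<epsilon> S \<Longrightarrow> g U = g V \<Longrightarrow> U = V" "\<And>U. U \<epsilon> S \<Longrightarrow> g U \<epsilon> omega E"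
    by (rule is_countableE) (rule that)
  note [dfn_intros] = dtm_comp1[where R = h, OF h(1)] dtm_comp1[where R = g, OF g(1)]
  \<comment> \<open>Codes replace indices: the condition at \<open>U\<close> admits the cover
    members with code at most \<open>h U\<close>. Gaps in the two enumerations, or a finite family
    \<open>R\<close>, then need no separate treatment.\<close>
  define Q where "Q x y \<longleftrightarrow> (\<forall>U. U \<epsilon> R \<longrightarrow> x \<epsilon> U \<or> (\<exists>V. V \<epsilon> S \<and> g V \<epsilon> succ E (h U) \<and> y \<epsilon> V))" for x y
  have D: "pdef (\<lambda>p. \<exists>x y. p = opair E x y \<and> Q x y)" unfolding Q_def by (intro dfn_intros)
  define W where "W = sep (cart_prod E X Y) (\<lambda>p. \<exists>x y. p = opair E x y \<and> Q x y)"
  have W: "opair E x y \<epsilon> W \<longleftrightarrow> x \<epsilon> X \<and> y \<epsilon> Y \<and> Q x y" for x y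
    unfolding W_def mem_sep[OF D] by auto
  have "W \<epsilon> product_topology E TX TY"
    unfolding mem_product_topology
  proof (intro allI impI)
    fix p assume "p \<epsilon> W"
    then obtain x y where p: "p = opair E x y" "x \<epsilon> X" "y \<epsilon> Y" "Q x y"
      unfolding W_def mem_sep[OF D] by auto
    from p(3) S(2) obtain V\<^sub>0 where V\<^sub>0: "V\<^sub>0 \<epsilon> S" "y \<epsilon> V\<^sub>0" by auto
    let ?m = "g V\<^sub>0"
    have m: "?m \<epsilon> omega E" using g(3) V\<^sub>0 by simp
    have D1: "pdef (\<lambda>U. x \<epsilon> U)" "pdef (\<lambda>V. y \<epsilon> V)" by (intro dfn_intros)+
    let ?R = "sep R (\<lambda>U. x \<epsilon> U)" and ?S = "sep S (\<lambda>V. y \<epsilon> V)"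
    \<comment> \<open>The bound for \<open>?N\<close> is strict, since sets of code at least
      \<open>?m\<close> are served by \<open>V\<^sub>0\<close>. The bound for \<open>?M\<close> is
      not: it has to include \<open>V\<^sub>0\<close> itself.\<close>
    let ?N = "sep X (\<lambda>x. \<forall>U. U \<epsilon> ?R \<and> h U \<epsilon> ?m \<longrightarrow> x \<epsilon> U)"
    let ?M = "sep Y (\<lambda>y. \<forall>V. V \<epsilon> ?S \<and> g V \<epsilon> succ E ?m \<longrightarrow> y \<epsilon> V)"
    have D2: "pdef (\<lambda>x. \<forall>U. U \<epsilon> ?R \<and> h U \<epsilon> ?m \<longrightarrow> x \<epsilon> U)"
      "pdef (\<lambda>y. \<forall>V. V \<epsilon> ?S \<and> g V \<epsilon> succ E ?m \<longrightarrow> y \<epsilon> V)" by (intro dfn_intros)+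
    have "?N \<epsilon> TX"
      by (rule finite_inter_open[OF X _ h(1) _ m])
        (use h(2) is_subsetD[OF R(1)] in \<open>auto simp: mem_sep[OF D1(1)] intro!: is_subsetI\<close>)
    moreover have "?M \<epsilon> TY"
      by (rule finite_inter_open[OF Y _ g(1) _ succ_mem_omega[OF m]])
        (use g(2) is_subsetD[OF S(1)] in \<open>auto simp: mem_sep[OF D1(2)] intro!: is_subsetI\<close>)
    moreover have "p \<epsilon> cart_prod E ?N ?M"
      using p by (simp add: mem_sep[OF D1(1)] mem_sep[OF D1(2)] mem_sep[OF D2(1)] mem_sep[OF D2(2)])
    moreover have "is_subset E (cart_prod E ?N ?M) W"
    proof (rule is_subsetI)
      fix q assume "q \<epsilon> cart_prod E ?N ?M"
      then obtain x' y' where q: "q = opair E x' y'" "x' \<epsilon> ?N" "y' \<epsilon> ?M" unfolding mem_cart_prod by blast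
      have x': "x' \<epsilon> X" "\<And>U. U \<epsilon> R \<Longrightarrow> x \<epsilon> U \<Longrightarrow> h U \<epsilon> ?m \<Longrightarrow> x' \<epsilon> U"
        using q(2)[unfolded mem_sep[OF D2(1)]] unfolding mem_sep[OF D1(1)] by blast+
      have y': "y' \<epsilon> Y" "\<And>V. V \<epsilon> S \<Longrightarrow> y \<epsilon> V \<Longrightarrow> g V \<epsilon> succ E ?m \<Longrightarrow> y' \<epsilon> V"
        using q(3)[unfolded mem_sep[OF D2(2)]] unfolding mem_sep[OF D1(2)] by blast+
      have "Q x' y'" unfolding Q_def
      proof (intro allI impI)
        fix U assume U: "U \<epsilon> R"
        show "x' \<epsilon> U \<or> (\<exists>V. V \<epsilon> S \<and> g V \<epsilon> succ E (h U) \<and> y' \<epsilon> V)"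
        proof (cases "h U \<epsilon> ?m")
          case True
          show ?thesis
          proof (cases "x \<epsilon> U")
            case False
            then obtain V where V: "V \<epsilon> S" "g V \<epsilon> succ E (h U)" "y \<epsilon> V" using p(4) U unfolding Q_def by blast
            then have "g V \<epsilon> ?m" using True omega_trans[OF m True] by auto
            then show ?thesis using V y'(2) by auto
          qed (use x'(2) U True in blast)
        next
          case False
          then have "?m \<epsilon> succ E (h U)" using omega_linear[OF h(3)[OF U] m] by auto
          then show ?thesis using V\<^sub>0 y'(2) by auto
        qed
      qed
      then show "q \<epsilon> W" using q(1) x'(1) y'(1) W by simp
    qed
    ultimately show "\<exists>U V. U \<epsilon> TX \<and> V \<epsilon> TY \<and> p \<epsilon> cart_prod E U V \<and> is_subset E (cart_prod E U V) W" by blast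
  qed
  then have "tube X Y W \<epsilon> TX" using cl projection_closed_iff[OF X Y] by blast
  moreover have "tube X Y W = G"
  proof (rule set_ext)
    fix x
    have "x \<epsilon> U" if x: "x \<epsilon> X" "\<And>y. y \<epsilon> Y \<Longrightarrow> Q x y" and U: "U \<epsilon> R" for U
    proof (rule ccontr)
      assume "\<not> x \<epsilon> U"
      then have *: "\<exists>V. V \<epsilon> S \<and> g V \<epsilon> succ E (h U) \<and> y \<epsilon> V" if "y \<epsilon> Y" for y
        using x(2)[OF that] U unfolding Q_def by blast
      have D3: "pdef (\<lambda>V. g V \<epsilon> succ E (h U))" by (intro dfn_intros)
      let ?S = "sep S (\<lambda>V. g V \<epsilon> succ E (h U))"
      have "is_finite E ?S" by (rule finite_initial[OF g(1,2)]) (use h(3)[OF U] in auto)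
      moreover have "is_subset E ?S S" by (simp add: is_subset_def mem_sep[OF D3])
      moreover have "union_of E ?S = Y"
        using * S(2) by (intro set_ext, unfold mem_union_of mem_sep[OF D3]) auto
      moreover have "is_subset E ?S TY" using S(1) by (simp add: is_subset_def mem_sep[OF D3])
      ultimately show False using nf[of ?S] unfolding open_cover_def by blast
    qed
    then show "x \<epsilon> tube X Y W \<longleftrightarrow> x \<epsilon> G"
      unfolding mem_tube R(3) W by (auto simp: Q_def)
  qed
  ultimately show "G \<epsilon> TX" by simp
qed

text \<open>In the second-countable case the basic sets that already belong to \<open>S\<close> form
  the countable subfamily. Closure under smaller open sets guarantees that they still cover, and
  taking all of them avoids choosing.\<close>

lemma countable_open_refinement:
  assumes "Lindelof_space E Y TY \<or> second_countable_space E Y TY"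
    and "is_subset E S TY" "\<And>y. y \<epsilon> Y \<Longrightarrow> \<exists>V. V \<epsilon> S \<and> y \<epsilon> V" "\<And>V y. V \<epsilon> S \<Longrightarrow> y \<epsilon> V \<Longrightarrow> y \<epsilon> Y"
    and down: "\<And>V V'. V \<epsilon> S \<Longrightarrow> V' \<epsilon> TY \<Longrightarrow> is_subset E V' V \<Longrightarrow> V' \<epsilon> S"
  shows "\<exists>S'. is_subset E S' S \<and> is_countable E S' \<and> (\<forall>y. y \<epsilon> Y \<longrightarrow> (\<exists>V. V \<epsilon> S' \<and> y \<epsilon> V))"
  using assms(1)
proof
  assume L: "Lindelof_space E Y TY"
  have "union_of E S = Y" using assms(3,4) by (intro set_ext) auto
  then have "open_cover E Y TY S" using assms(2) by (simp add: open_cover_def)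
  with L obtain S' where "is_subset E S' S" "is_countable E S'" "union_of E S' = Y"
    unfolding Lindelof_space_def open_cover_def by blast
  then show ?thesis by (intro exI[of _ S']) auto
next
  assume "second_countable_space E Y TY"
  then obtain B where B: "is_countable E B" "is_subset E B TY"
    "\<And>U. U \<epsilon> TY \<Longrightarrow> \<exists>S. is_subset E S B \<and> U = union_of E S"
    unfolding second_countable_space_def by blast
  have "\<exists>V. V \<epsilon> inter E B S \<and> y \<epsilon> V" if y: "y \<epsilon> Y" for y
  proof -
    obtain V where V: "V \<epsilon> S" "y \<epsilon> V" using assms(3)[OF y] by blast
    with B(3) assms(2) obtain C where C: "is_subset E C B" "V = union_of E C" by (meson is_subsetD)
    then obtain V' where V': "V' \<epsilon> C" "y \<epsilon> V'" using V(2) by auto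
    have "is_subset E V' V" using C(2) V'(1) by (auto intro!: is_subsetI)
    moreover have "V' \<epsilon> B" using C(1) V'(1) by (rule is_subsetD)
    ultimately show ?thesis using down[OF V(1)] V'(2) is_subsetD[OF B(2)] by auto
  qed
  moreover have "is_countable E (inter E B S)" by (rule countable_mono[OF B(1)]) simp
  moreover have "is_subset E (inter E B S) S" by (simp add: is_subset_def)
  ultimately show ?thesis by blast
qed

lemma projection_closed_if_P_space:
  assumes X: "topology_on E X TX" and Y: "topology_on E Y TY" and P: "P_space E X TX"
    and L: "Lindelof_space E Y TY \<or> second_countable_space E Y TY"
  shows "projection_closed E X TX Y TY"
  unfolding projection_closed_iff[OF X Y]
proof (intro allI impI)
  fix W assume W: "W \<epsilon> product_topology E TX TY"
  show "tube X Y W \<epsilon> TX"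
  proof (rule open_locally[OF X])
    fix x assume "x \<epsilon> tube X Y W"
    then have x: "x \<epsilon> X" "\<And>y. y \<epsilon> Y \<Longrightarrow> opair E x y \<epsilon> W" unfolding mem_tube by blast+
    have D: "pdef (\<lambda>V. \<exists>U. U \<epsilon> TX \<and> x \<epsilon> U \<and> is_subset E (cart_prod E U V) W)"
      "pdef (\<lambda>U. is_subset E (cart_prod E U V) W)" for V by (intro dfn_intros)+
    \<comment> \<open>This family is closed under passing to smaller open sets, since the same
      \<open>U\<close> keeps working.\<close>
    let ?S = "sep TY (\<lambda>V. \<exists>U. U \<epsilon> TX \<and> x \<epsilon> U \<and> is_subset E (cart_prod E U V) W)"
    have "\<exists>S'. is_subset E S' ?S \<and> is_countable E S' \<and> (\<forall>y. y \<epsilon> Y \<longrightarrow> (\<exists>V. V \<epsilon> S' \<and> y \<epsilon> V))"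
    proof (rule countable_open_refinement[OF L])
      show "is_subset E ?S TY" by (simp add: is_subset_def mem_sep[OF D(1)])
      show "\<exists>V. V \<epsilon> ?S \<and> y \<epsilon> V" if y: "y \<epsilon> Y" for y
      proof -
        obtain U V where "U \<epsilon> TX" "V \<epsilon> TY" "opair E x y \<epsilon> cart_prod E U V" "is_subset E (cart_prod E U V) W"
          using W x(2)[OF y] unfolding mem_product_topology by blast
        then show ?thesis unfolding mem_sep[OF D(1)] by auto
      qed
      show "y \<epsilon> Y" if "V \<epsilon> ?S" "y \<epsilon> V" for V y
        using that topologyD(1)[OF Y] unfolding mem_sep[OF D(1)] by blast
      show "V' \<epsilon> ?S" if V: "V \<epsilon> ?S" "V' \<epsilon> TY" "is_subset E V' V" for V V'
      proof -
        obtain U where "U \<epsilon> TX" "x \<epsilon> U" "is_subset E (cart_prod E U V) W"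
          using V(1) unfolding mem_sep[OF D(1)] by blast
        moreover have "is_subset E (cart_prod E U V') (cart_prod E U V)"
          using V(3) unfolding is_subset_def mem_cart_prod by blast
        ultimately have "is_subset E (cart_prod E U V') W" unfolding is_subset_def by blast
        then show ?thesis using V(2) \<open>U \<epsilon> TX\<close> \<open>x \<epsilon> U\<close> unfolding mem_sep[OF D(1)] by blast
      qed
    qed
    then obtain S' where S': "is_subset E S' ?S" "is_countable E S'" "\<And>y. y \<epsilon> Y \<Longrightarrow> \<exists>V. V \<epsilon> S' \<and> y \<epsilon> V"
      by blast
    \<comment> \<open>Different \<open>V\<close> may share their largest \<open>U\<close>;
      \<open>countable_rep\<close> still makes the family of these \<open>U\<close>
      countable.\<close>
    define H where "H V = union_of E (sep TX (\<lambda>U. is_subset E (cart_prod E U V) W))" for V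
    have H: "fdef H" unfolding H_def by (intro dfn_intros)
    have D2: "pdef (\<lambda>x. \<forall>U. U \<epsilon> rep S' H \<longrightarrow> x \<epsilon> U)" by (intro dfn_intros)
    let ?G = "sep X (\<lambda>x. \<forall>U. U \<epsilon> rep S' H \<longrightarrow> x \<epsilon> U)"
    have mem_H: "z \<epsilon> H V \<longleftrightarrow> (\<exists>U. U \<epsilon> TX \<and> z \<epsilon> U \<and> is_subset E (cart_prod E U V) W)" for z V
      unfolding H_def mem_union_of mem_sep[OF D(2)] by blast
    have mem_G: "z \<epsilon> ?G \<longleftrightarrow> z \<epsilon> X \<and> (\<forall>V. V \<epsilon> S' \<longrightarrow> z \<epsilon> H V)" for z
      by (auto simp: mem_sep[OF D2] mem_rep[OF H])
    have "H V \<epsilon> TX" for V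
      unfolding H_def by (rule topologyD(5)[OF X]) (simp add: is_subset_def[of E _ TX] mem_sep[OF D(2)])
    then have "is_subset E (rep S' H) TX" by (auto simp: is_subset_def mem_rep[OF H])
    then have "is_G_delta E X TX ?G"
      unfolding is_G_delta_def using countable_rep[OF S'(2) H] mem_sep[OF D2] by blast
    then have "?G \<epsilon> TX" using P unfolding P_space_def by blast
    moreover have "x \<epsilon> ?G" unfolding mem_G mem_H
      using x(1) is_subsetD[OF S'(1)] unfolding mem_sep[OF D(1)] by blast
    moreover have "is_subset E ?G (tube X Y W)"
    proof (rule is_subsetI, unfold mem_tube, intro conjI allI impI)
      fix z y assume z: "z \<epsilon> ?G" and "y \<epsilon> Y"
      then obtain V where V: "V \<epsilon> S'" "y \<epsilon> V" using S'(3) by blast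
      then obtain U where "z \<epsilon> U" "is_subset E (cart_prod E U V) W" using z unfolding mem_G mem_H by blast
      then show "opair E z y \<epsilon> W" using V(2) by (simp add: is_subset_def)
    qed (simp add: mem_G)
    ultimately show "\<exists>U. U \<epsilon> TX \<and> x \<epsilon> U \<and> is_subset E U (tube X Y W)" by blast
  qed
qed

section \<open>The topology of initial segments of \<omega>\<close>

lemma initial_segment:
  assumes "is_subset E A (omega E)" "\<And>m k. m \<epsilon> A \<Longrightarrow> k \<epsilon> m \<Longrightarrow> k \<epsilon> A"
  shows "A \<epsilon> succ E (omega E)"
proof (cases "A = omega E")
  case False
  then obtain n where n: "n \<epsilon> omega E" "\<not> n \<epsilon> A" using assms(1) set_ext[of A "omega E"] is_subsetD by blast
  then have "n \<epsilon> diff E (omega E) A" by simp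
  then obtain m where m: "m \<epsilon> omega E" "\<not> m \<epsilon> A" "\<And>k. k \<epsilon> m \<Longrightarrow> \<not> k \<epsilon> diff E (omega E) A"
    using foundation_set mem_diff by metis
  \<comment> \<open>A von Neumann numeral is the set of the smaller ones, so a proper initial
    segment is its own least missing number. The initial segments are thus exactly the members of
    \<open>succ E (omega E)\<close>.\<close>
  have "A = m"
  proof (rule set_ext)
    fix x show "x \<epsilon> A \<longleftrightarrow> x \<epsilon> m"
      using m assms omega_linear[OF _ m(1), of x] omega_mem_omega[OF m(1)] unfolding is_subset_def
      by (metis mem_diff)
  qed
  with m(1) show ?thesis by simp
qed simp

lemma finite_bounded:
  assumes "is_finite E a" "is_subset E a (omega E)"
  shows "\<exists>k. k \<epsilon> omega E \<and> (\<forall>x. x \<epsilon> a \<longrightarrow> x \<epsilon> k)"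
proof -
  from assms(1) obtain n F where n: "n \<epsilon> omega E" and F: "fdef F" "bij_betw F (ext_of a) (ext_of n)"
    by (rule is_finiteE) (rule that)
  note [dfn_intros] = dtm_comp1[where R = F, OF F(1)]
  from n have "\<exists>k. k \<epsilon> omega E \<and> (\<forall>x. x \<epsilon> a \<and> F x \<epsilon> n \<longrightarrow> x \<epsilon> k)"
  proof (induction n rule: omega_induct)
    case zero
    show ?case using zero_mem_omega mem_empty by blast
  next
    case (succ n)
    then obtain k where k: "k \<epsilon> omega E" "\<And>x. x \<epsilon> a \<Longrightarrow> F x \<epsilon> n \<Longrightarrow> x \<epsilon> k" by blast
    show ?case
    proof (cases "\<exists>x. x \<epsilon> a \<and> F x = n")
      case False
      then show ?thesis using k by auto
    next
      case True
      then obtain x where x: "x \<epsilon> a" "F x = n" by blast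
      have x': "x \<epsilon> omega E" using assms(2) x(1) by (rule is_subsetD)
      have inj: "y = x" if "y \<epsilon> a" "F y = n" for y
        using that x F(2) by (auto simp: bij_betw_def inj_on_def)
      show ?thesis
      proof (cases "x \<epsilon> k")
        case True
        then show ?thesis using k inj by auto
      next
        case False
        then have "y \<epsilon> x" if "y \<epsilon> k" for y using that omega_linear[OF x' k(1)] omega_trans[OF x'] by auto
        then show ?thesis using k(2) inj x' by (intro exI[of _ "succ E x"]) auto
      qed
    qed
  qed (intro dfn_intros)
  then show ?thesis using F(2) by (auto simp: bij_betw_def)
qed

text \<open>As numerals are initial segments, \<omega> is at once the space and an open cover of it,
  in the topology of initial segments as well as in the discrete one.\<close>

lemma omega_cover: "union_of E (omega E) = omega E"
proof (rule set_ext)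
  fix x
  have "x \<epsilon> succ E x" by simp
  then show "x \<epsilon> union_of E (omega E) \<longleftrightarrow> x \<epsilon> omega E"
    unfolding mem_union_of using omega_mem_omega succ_mem_omega by blast
qed

lemma omega_no_finite_subcover:
  assumes "is_finite E S" "is_subset E S (omega E)"
  shows "union_of E S \<noteq> omega E"
proof
  assume *: "union_of E S = omega E"
  obtain k where k: "k \<epsilon> omega E" "\<And>x. x \<epsilon> S \<Longrightarrow> x \<epsilon> k" using finite_bounded[OF assms] by blast
  then obtain x where "x \<epsilon> S" "k \<epsilon> x" using * mem_union_of by metis
  then show False using k(2) mem_asym by blast
qed

lemma initial_topology:
  "topology_on E (omega E) (succ E (omega E))"
  "second_countable_space E (omega E) (succ E (omega E))"
  "Lindelof_space E (omega E) (succ E (omega E))"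
  "T0_space E (omega E) (succ E (omega E))"
  "\<not> countably_compact_space E (omega E) (succ E (omega E))"
proof -
  let ?T = "succ E (omega E)"
  have *: "x \<epsilon> omega E" "y \<epsilon> x \<Longrightarrow> y \<epsilon> U" if U: "U \<epsilon> ?T" "x \<epsilon> U" for U x y
  proof -
    from U(1) consider "U = omega E" | "U \<epsilon> omega E" by auto
    then have "x \<epsilon> omega E \<and> (y \<epsilon> x \<longrightarrow> y \<epsilon> U)"
      by cases (use U(2) omega_mem_omega omega_trans in blast)+
    then show "x \<epsilon> omega E" "y \<epsilon> x \<Longrightarrow> y \<epsilon> U" by auto
  qed
  show "topology_on E (omega E) ?T"
    unfolding topology_on_def
  proof (intro conjI allI impI)
    show "is_subset E U (omega E)" if "U \<epsilon> ?T" for U using *(1)[OF that] by (rule is_subsetI)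
    show "inter E U V \<epsilon> ?T" if UV: "U \<epsilon> ?T \<and> V \<epsilon> ?T" for U V
    proof (rule initial_segment)
      show "is_subset E (inter E U V) (omega E)" using UV *(1) by (intro is_subsetI) (unfold mem_inter, blast)
      show "k \<epsilon> inter E U V" if "m \<epsilon> inter E U V" "k \<epsilon> m" for m k
        using UV *(2) that unfolding mem_inter by blast
    qed
    show "union_of E S \<epsilon> ?T" if "is_subset E S ?T" for S
    proof (rule initial_segment)
      show "is_subset E (union_of E S) (omega E)"
        using is_subsetD[OF that] *(1) by (intro is_subsetI) (unfold mem_union_of, blast)
      show "k \<epsilon> union_of E S" if "m \<epsilon> union_of E S" "k \<epsilon> m" for m k
        using that is_subsetD[OF \<open>is_subset E S ?T\<close>] *(2) unfolding mem_union_of by blast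
    qed
  qed auto
  \<comment> \<open>A shift by one makes room for \<omega> itself. With the whole topology
    countable, it is its own countable base and every open cover is already countable.\<close>
  have "fdef (\<lambda>x. if x = omega E then empty_set E else succ E x)" by (intro dfn_intros)
  then have c: "is_countable E ?T"
  proof (rule is_countableI)
    show "inj_on (\<lambda>x. if x = omega E then empty_set E else succ E x) (ext_of ?T)"
    proof (rule inj_onI)
      fix x y assume "x \<in> ext_of ?T" "y \<in> ext_of ?T"
        "(if x = omega E then empty_set E else succ E x) = (if y = omega E then empty_set E else succ E y)"
      moreover have "empty_set E \<noteq> succ E z" "succ E z \<noteq> empty_set E" for z
        using mem_empty[of z] mem_succ[of z z] by metis+
      ultimately show "x = y" using succ_inj by (auto split: if_splits)
    qed
  qed auto
  have self: "U = union_of E (upair E U U)" for U by (rule set_ext) auto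
  show "second_countable_space E (omega E) ?T"
    unfolding second_countable_space_def
  proof (rule exI[of _ ?T], intro conjI allI impI c)
    show "\<exists>S. is_subset E S ?T \<and> U = union_of E S" if "U \<epsilon> ?T" for U
      using that self by (intro exI[of _ "upair E U U"] conjI is_subsetI) (simp_all only: mem_upair disj_absorb)
  qed (simp add: is_subset_def)
  show "Lindelof_space E (omega E) ?T"
    unfolding Lindelof_space_def
  proof (intro allI impI)
    fix S assume S: "open_cover E (omega E) ?T S"
    then have "is_countable E S"
      using is_subsetD[of S ?T] by (intro countable_mono[OF c]) (simp only: open_cover_def)
    with S show "\<exists>S'. is_subset E S' S \<and> is_countable E S' \<and> open_cover E (omega E) ?T S'"
      by (intro exI[of _ S]) (simp add: is_subset_def)
  qed
  show "T0_space E (omega E) ?T"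
    unfolding T0_space_def
  proof (intro allI impI)
    fix x y assume xy: "x \<epsilon> omega E \<and> y \<epsilon> omega E \<and> x \<noteq> y"
    then show "\<exists>U. U \<epsilon> ?T \<and> (x \<epsilon> U \<and> \<not> y \<epsilon> U \<or> y \<epsilon> U \<and> \<not> x \<epsilon> U)"
      using omega_linear[of x y] by (metis mem_irrefl mem_succ)
  qed
  show "\<not> countably_compact_space E (omega E) ?T"
  proof
    assume "countably_compact_space E (omega E) ?T"
    moreover have "open_cover E (omega E) ?T (omega E)"
      by (simp add: open_cover_def is_subset_def omega_cover)
    ultimately obtain S where "is_subset E S (omega E)" "is_finite E S" "union_of E S = omega E"
      unfolding countably_compact_space_def open_cover_def using countable_omega by blast
    then show False using omega_no_finite_subcover by blast
  qed
qed

section \<open>Arithmetic\<close>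

abbreviation om ("\<omega>") where "\<omega> \<equiv> omega E"
abbreviation zer ("\<zero>") where "\<zero> \<equiv> empty_set E"
abbreviation suc ("\<sigma>") where "\<sigma> \<equiv> succ E"

lemma succ_not_zero [simp]: "\<sigma> n \<noteq> \<zero>"
  using mem_succ[of n n] mem_empty[of n] by metis

text \<open>A total definable operation. \<open>add\<close> cannot be used in comprehensions
  directly, because \<open>app\<close> is only determined on pairs from \<omega>; the two are
  identified in \<open>add_eq\<close>. The same holds for \<open>ml\<close> and
  \<open>mult\<close>.\<close>

definition ad :: "'v \<Rightarrow> 'v \<Rightarrow> 'v" (infixl "\<oplus>" 65) where
  "m \<oplus> n = rec m (\<lambda>_ y. \<sigma> y) n"

definition ml :: "'v \<Rightarrow> 'v \<Rightarrow> 'v" (infixl "\<otimes>" 70) where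
  "m \<otimes> n = rec \<zero> (\<lambda>_ y. y \<oplus> m) n"

lemma dtm_ad [dfn_intros]: "dtm t \<Longrightarrow> dtm u \<Longrightarrow> dtm (\<lambda>e. t e \<oplus> u e)"
  by (rule dtm_comp2[where R = "(\<oplus>)"], unfold ad_def, intro dfn_intros)

lemma dtm_ml [dfn_intros]: "dtm t \<Longrightarrow> dtm u \<Longrightarrow> dtm (\<lambda>e. t e \<otimes> u e)"
  by (rule dtm_comp2[where R = "(\<otimes>)"], unfold ml_def, intro dfn_intros)

lemma ad_zero [simp]: "m \<oplus> \<zero> = m"
  unfolding ad_def by (rule rec_zero) (intro dfn_intros)

lemma ad_succ [simp]: "n \<epsilon> \<omega> \<Longrightarrow> m \<oplus> \<sigma> n = \<sigma> (m \<oplus> n)"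
  unfolding ad_def by (rule rec_succ) (intro dfn_intros)

lemma ml_zero [simp]: "m \<otimes> \<zero> = \<zero>"
  unfolding ml_def by (rule rec_zero) (intro dfn_intros)

lemma ml_succ [simp]: "n \<epsilon> \<omega> \<Longrightarrow> m \<otimes> \<sigma> n = m \<otimes> n \<oplus> m"
  unfolding ml_def by (rule rec_succ) (intro dfn_intros)

lemma ad_closed [simp]: "m \<epsilon> \<omega> \<Longrightarrow> n \<epsilon> \<omega> \<Longrightarrow> m \<oplus> n \<epsilon> \<omega>"
  by (rotate_tac, induction n rule: omega_induct) (auto intro!: dfn_intros)

lemma ml_closed [simp]: "m \<epsilon> \<omega> \<Longrightarrow> n \<epsilon> \<omega> \<Longrightarrow> m \<otimes> n \<epsilon> \<omega>"
  by (rotate_tac, induction n rule: omega_induct) (auto intro!: dfn_intros)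

definition bin_fun :: "('v \<Rightarrow> 'v \<Rightarrow> 'v) \<Rightarrow> 'v" where
  "bin_fun F = sep (cart_prod E (cart_prod E \<omega> \<omega>) \<omega>) (\<lambda>q. \<exists>m n. q = opair E (opair E m n) (F m n))"

lemma bin_fun:
  assumes F: "fdef2 F" and cl: "\<And>m n. m \<epsilon> \<omega> \<Longrightarrow> n \<epsilon> \<omega> \<Longrightarrow> F m n \<epsilon> \<omega>"
  shows "is_function E (bin_fun F) (cart_prod E \<omega> \<omega>) \<omega>"
    "m \<epsilon> \<omega> \<Longrightarrow> n \<epsilon> \<omega> \<Longrightarrow> ap (bin_fun F) (opair E m n) = F m n"
proof -
  note [dfn_intros] = dtm_comp2[where R = F, OF F]
  have D: "pdef (\<lambda>q. \<exists>m n. q = opair E (opair E m n) (F m n))" by (intro dfn_intros)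
  have *: "opair E (opair E m n) y \<epsilon> bin_fun F \<longleftrightarrow> y = F m n" if "m \<epsilon> \<omega>" "n \<epsilon> \<omega>" for m n y
    using that cl by (auto simp: bin_fun_def mem_sep[OF D])
  show "is_function E (bin_fun F) (cart_prod E \<omega> \<omega>) \<omega>"
    unfolding is_function_def
  proof (intro conjI allI impI)
    show "is_subset E (bin_fun F) (cart_prod E (cart_prod E \<omega> \<omega>) \<omega>)"
      by (simp add: is_subset_def bin_fun_def mem_sep[OF D])
    show "\<exists>!y. opair E x y \<epsilon> bin_fun F" if "x \<epsilon> cart_prod E \<omega> \<omega>" for x
      using that * by (auto simp: mem_cart_prod)
  qed
  show "m \<epsilon> \<omega> \<Longrightarrow> n \<epsilon> \<omega> \<Longrightarrow> ap (bin_fun F) (opair E m n) = F m n"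
    by (rule ap_eq) (rule *)
qed

text \<open>Common core of \<open>add_eq\<close> and \<open>mult_eq\<close>, with \<open>R\<close>
  the recursion equations: the internal graph of \<open>F\<close> satisfies them, and an induction
  supplied as \<open>uniq\<close> shows that nothing else does.\<close>

lemma the_bin_fun:
  assumes F: "fdef2 F" and cl: "\<And>m n. m \<epsilon> \<omega> \<Longrightarrow> n \<epsilon> \<omega> \<Longrightarrow> F m n \<epsilon> \<omega>"
    and sat: "\<And>f. is_function E f (cart_prod E \<omega> \<omega>) \<omega> \<Longrightarrow>
      (\<And>m n. m \<epsilon> \<omega> \<Longrightarrow> n \<epsilon> \<omega> \<Longrightarrow> ap f (opair E m n) = F m n) \<Longrightarrow> R f"
    and uniq: "\<And>f m n. is_function E f (cart_prod E \<omega> \<omega>) \<omega> \<Longrightarrow> R f \<Longrightarrow>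
      m \<epsilon> \<omega> \<Longrightarrow> n \<epsilon> \<omega> \<Longrightarrow> ap f (opair E m n) = F m n"
    and m: "m \<epsilon> \<omega>" and n: "n \<epsilon> \<omega>"
  shows "app E (THE f. is_function E f (cart_prod E \<omega> \<omega>) \<omega> \<and> R f) (opair E m n) = F m n"
proof -
  have "(THE f. is_function E f (cart_prod E \<omega> \<omega>) \<omega> \<and> R f) = bin_fun F"
  proof (rule the_equality)
    show "is_function E (bin_fun F) (cart_prod E \<omega> \<omega>) \<omega> \<and> R (bin_fun F)"
      using sat[OF bin_fun(1)[OF F cl]] bin_fun(1)[OF F cl] bin_fun(2)[OF F cl] by blast
    fix f assume f: "is_function E f (cart_prod E \<omega> \<omega>) \<omega> \<and> R f"
    show "f = bin_fun F"
    proof (rule function_eqI[OF conjunct1[OF f] bin_fun(1)[OF F cl]])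
      fix x assume "x \<epsilon> cart_prod E \<omega> \<omega>"
      then show "ap f x = ap (bin_fun F) x"
        using uniq f bin_fun(2)[OF F cl] by (auto simp: mem_cart_prod)
    qed
  qed
  then show ?thesis using function_ap(3)[OF bin_fun(1)[OF F cl]] bin_fun(2)[OF F cl] m n by simp
qed

lemma app_ap_omega:
  "is_function E f (cart_prod E \<omega> \<omega>) b \<Longrightarrow> m \<epsilon> \<omega> \<Longrightarrow> n \<epsilon> \<omega> \<Longrightarrow> app E f (opair E m n) = ap f (opair E m n)"
  by (rule function_ap(3)) auto

lemma add_eq: "m \<epsilon> \<omega> \<Longrightarrow> n \<epsilon> \<omega> \<Longrightarrow> add E m n = m \<oplus> n"
  unfolding add_def add_fun_def
proof (rule the_bin_fun[where F = "(\<oplus>)"], intro dfn_intros)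
  fix f m n assume f: "is_function E f (cart_prod E \<omega> \<omega>) \<omega>" and m: "m \<epsilon> \<omega>" and n: "n \<epsilon> \<omega>" and
    R: "(\<forall>m. m \<epsilon> \<omega> \<longrightarrow> app E f (opair E m \<zero>) = m) \<and>
        (\<forall>m n. m \<epsilon> \<omega> \<and> n \<epsilon> \<omega> \<longrightarrow> app E f (opair E m (\<sigma> n)) = \<sigma> (app E f (opair E m n)))"
  from n show "ap f (opair E m n) = m \<oplus> n"
    by (induction n rule: omega_induct)
      (use m R app_ap_omega[OF f] in \<open>auto intro!: dfn_intros\<close>)
qed (use app_ap_omega in auto)

lemma mult_eq: "m \<epsilon> \<omega> \<Longrightarrow> n \<epsilon> \<omega> \<Longrightarrow> mult E m n = m \<otimes> n"
  unfolding mult_def mult_fun_def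
proof (rule the_bin_fun[where F = "(\<otimes>)"], intro dfn_intros)
  fix f m n assume f: "is_function E f (cart_prod E \<omega> \<omega>) \<omega>" and m: "m \<epsilon> \<omega>" and n: "n \<epsilon> \<omega>" and
    R: "(\<forall>m. m \<epsilon> \<omega> \<longrightarrow> app E f (opair E m \<zero>) = \<zero>) \<and>
        (\<forall>m n. m \<epsilon> \<omega> \<and> n \<epsilon> \<omega> \<longrightarrow> app E f (opair E m (\<sigma> n)) = add E (app E f (opair E m n)) m)"
  from n show "ap f (opair E m n) = m \<otimes> n"
    by (induction n rule: omega_induct)
      (use m R app_ap_omega[OF f] in \<open>auto intro!: dfn_intros simp: add_eq\<close>)
qed (use app_ap_omega in \<open>auto simp: add_eq\<close>)

lemma zero_ad [simp]: "n \<epsilon> \<omega> \<Longrightarrow> \<zero> \<oplus> n = n"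
  by (induction n rule: omega_induct) (auto intro!: dfn_intros)

lemma succ_ad [simp]: "n \<epsilon> \<omega> \<Longrightarrow> m \<epsilon> \<omega> \<Longrightarrow> \<sigma> m \<oplus> n = \<sigma> (m \<oplus> n)"
  by (induction n rule: omega_induct) (auto intro!: dfn_intros)

lemma ad_comm: "n \<epsilon> \<omega> \<Longrightarrow> m \<epsilon> \<omega> \<Longrightarrow> m \<oplus> n = n \<oplus> m"
  by (induction n rule: omega_induct) (auto intro!: dfn_intros)

lemma ad_assoc: "k \<epsilon> \<omega> \<Longrightarrow> m \<epsilon> \<omega> \<Longrightarrow> n \<epsilon> \<omega> \<Longrightarrow> m \<oplus> n \<oplus> k = m \<oplus> (n \<oplus> k)"
  by (induction k rule: omega_induct) (auto intro!: dfn_intros)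

lemma ad_left_comm: "k \<epsilon> \<omega> \<Longrightarrow> m \<epsilon> \<omega> \<Longrightarrow> n \<epsilon> \<omega> \<Longrightarrow> m \<oplus> (n \<oplus> k) = n \<oplus> (m \<oplus> k)"
  using ad_assoc[of k m n] ad_assoc[of k n m] ad_comm[of n m] by simp

lemmas ad_ac = ad_comm ad_assoc ad_left_comm

lemma zero_ml [simp]: "n \<epsilon> \<omega> \<Longrightarrow> \<zero> \<otimes> n = \<zero>"
  by (induction n rule: omega_induct) (auto intro!: dfn_intros)

lemma succ_ml [simp]: "n \<epsilon> \<omega> \<Longrightarrow> m \<epsilon> \<omega> \<Longrightarrow> \<sigma> m \<otimes> n = m \<otimes> n \<oplus> n"
proof (induction n rule: omega_induct)
  case (succ n)
  then show ?case by (simp add: ad_assoc ad_comm[of n m])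
qed (auto intro!: dfn_intros)

lemma ml_comm: "n \<epsilon> \<omega> \<Longrightarrow> m \<epsilon> \<omega> \<Longrightarrow> m \<otimes> n = n \<otimes> m"
  by (induction n rule: omega_induct) (auto intro!: dfn_intros)

lemma distrib_left: "k \<epsilon> \<omega> \<Longrightarrow> m \<epsilon> \<omega> \<Longrightarrow> n \<epsilon> \<omega> \<Longrightarrow> (m \<oplus> n) \<otimes> k = m \<otimes> k \<oplus> n \<otimes> k"
proof (induction k rule: omega_induct)
  case (succ k)
  then show ?case by (simp add: ad_ac)
qed (auto intro!: dfn_intros)

lemma distrib_right: "k \<epsilon> \<omega> \<Longrightarrow> m \<epsilon> \<omega> \<Longrightarrow> n \<epsilon> \<omega> \<Longrightarrow> k \<otimes> (m \<oplus> n) = k \<otimes> m \<oplus> k \<otimes> n"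
  using distrib_left[of k m n] by (simp add: ml_comm)

lemma ml_assoc: "k \<epsilon> \<omega> \<Longrightarrow> m \<epsilon> \<omega> \<Longrightarrow> n \<epsilon> \<omega> \<Longrightarrow> m \<otimes> n \<otimes> k = m \<otimes> (n \<otimes> k)"
proof (induction k rule: omega_induct)
  case (succ k)
  then show ?case by (simp add: distrib_right)
qed (auto intro!: dfn_intros)

lemma ml_left_comm: "k \<epsilon> \<omega> \<Longrightarrow> m \<epsilon> \<omega> \<Longrightarrow> n \<epsilon> \<omega> \<Longrightarrow> m \<otimes> (n \<otimes> k) = n \<otimes> (m \<otimes> k)"
  using ml_assoc[of k m n] ml_assoc[of k n m] ml_comm[of n m] by simp

lemmas ml_ac = ml_comm ml_assoc ml_left_comm

lemma ad_less: "z \<epsilon> \<omega> \<Longrightarrow> x \<epsilon> \<omega> \<Longrightarrow> y \<epsilon> \<omega> \<Longrightarrow> x \<epsilon> y \<Longrightarrow> x \<oplus> z \<epsilon> y \<oplus> z"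
proof (induction z rule: omega_induct)
  case (succ z)
  then show ?case using succ_mem_succ[of "x \<oplus> z" "y \<oplus> z"] by simp
qed (auto intro!: dfn_intros)

lemma ad_less_iff [simp]:
  assumes "x \<epsilon> \<omega>" "y \<epsilon> \<omega>" "z \<epsilon> \<omega>"
  shows "x \<oplus> z \<epsilon> y \<oplus> z \<longleftrightarrow> x \<epsilon> y"
  using omega_linear[OF assms(1,2)] ad_less[OF assms(3)] assms mem_asym mem_irrefl by metis

lemma ad_cancel [simp]:
  assumes "x \<epsilon> \<omega>" "y \<epsilon> \<omega>" "z \<epsilon> \<omega>"
  shows "x \<oplus> z = y \<oplus> z \<longleftrightarrow> x = y"
  using omega_linear[OF assms(1,2)] ad_less[OF assms(3)] assms mem_irrefl by metis

lemma less_trans: "x \<epsilon> y \<Longrightarrow> y \<epsilon> z \<Longrightarrow> z \<epsilon> \<omega> \<Longrightarrow> x \<epsilon> z"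
  using omega_trans by blast

lemma le_less_trans: "x \<epsilon> \<sigma> y \<Longrightarrow> y \<epsilon> z \<Longrightarrow> z \<epsilon> \<omega> \<Longrightarrow> x \<epsilon> z"
  using less_trans mem_succ by metis

lemma less_le_trans: "x \<epsilon> y \<Longrightarrow> y \<epsilon> \<sigma> z \<Longrightarrow> z \<epsilon> \<omega> \<Longrightarrow> x \<epsilon> z"
  using less_trans mem_succ by metis

lemma le_trans: "x \<epsilon> \<sigma> y \<Longrightarrow> y \<epsilon> \<sigma> z \<Longrightarrow> z \<epsilon> \<omega> \<Longrightarrow> x \<epsilon> \<sigma> z"
  using less_trans mem_succ by metis

lemma less_add_mono:
  assumes "x \<epsilon> y" "u \<epsilon> v" "y \<epsilon> \<omega>" "v \<epsilon> \<omega>"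
  shows "x \<oplus> u \<epsilon> y \<oplus> v"
proof -
  have w: "x \<epsilon> \<omega>" "u \<epsilon> \<omega>" using assms omega_mem_omega by blast+
  have "x \<oplus> u \<epsilon> y \<oplus> u" using ad_less w assms by blast
  moreover have "y \<oplus> u \<epsilon> y \<oplus> v" using ad_less[of y u v] w assms by (simp add: ad_comm)
  ultimately show ?thesis using less_trans assms by simp
qed

lemma ml_less:
  assumes "x \<epsilon> y" "y \<epsilon> \<omega>" "z \<epsilon> \<omega>" "z \<noteq> \<zero>"
  shows "x \<otimes> z \<epsilon> y \<otimes> z"
proof -
  have x: "x \<epsilon> \<omega>" using assms omega_mem_omega by blast
  have "x \<otimes> \<sigma> w \<epsilon> y \<otimes> \<sigma> w" if "w \<epsilon> \<omega>" for w
    using that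
  proof (induction w rule: omega_induct)
    case (succ w)
    then show ?case using less_add_mono[OF succ.IH assms(1)] assms x by simp
  qed (use assms x in \<open>auto intro!: dfn_intros\<close>)
  then show ?thesis using omega_cases[OF assms(3)] assms(4) by blast
qed

lemma ml_less_iff:
  assumes "x \<epsilon> \<omega>" "y \<epsilon> \<omega>" "z \<epsilon> \<omega>" "z \<noteq> \<zero>"
  shows "x \<otimes> z \<epsilon> y \<otimes> z \<longleftrightarrow> x \<epsilon> y"
  using omega_linear[OF assms(1,2)] ml_less[OF _ _ assms(3,4)] assms mem_asym mem_irrefl by metis

lemma ml_cancel:
  assumes "x \<epsilon> \<omega>" "y \<epsilon> \<omega>" "z \<epsilon> \<omega>" "z \<noteq> \<zero>"
  shows "x \<otimes> z = y \<otimes> z \<longleftrightarrow> x = y"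
  using omega_linear[OF assms(1,2)] ml_less[OF _ _ assms(3,4)] assms mem_irrefl by metis

lemma ml_le:
  assumes "x \<epsilon> \<sigma> y" "y \<epsilon> \<omega>" "z \<epsilon> \<omega>"
  shows "x \<otimes> z \<epsilon> \<sigma> (y \<otimes> z)"
proof (cases "z = \<zero>")
  case False
  then show ?thesis using assms ml_less[OF _ assms(2,3)] by auto
qed simp

lemma ad_le:
  assumes "x \<epsilon> \<sigma> y" "y \<epsilon> \<omega>" "z \<epsilon> \<omega>"
  shows "x \<oplus> z \<epsilon> \<sigma> (y \<oplus> z)"
  using assms ad_less omega_mem_omega mem_succ by metis

lemma le_ad1: "x \<epsilon> \<omega> \<Longrightarrow> y \<epsilon> \<omega> \<Longrightarrow> x \<epsilon> \<sigma> (x \<oplus> y)"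
  using ad_le[of \<zero> y x] zero_less_succ[of y] by (simp add: ad_comm)

text \<open>With \<open>s = m + n\<close> the code is \<open>s^2 + m\<close>. Consecutive squares
  are \<open>2s + 1\<close> apart, which leaves room for the offsets \<open>m <= s\<close>; unlike
  Cantor's pairing this involves no halving.\<close>

definition pairing_code :: "'v \<Rightarrow> 'v \<Rightarrow> 'v" where
  "pairing_code m n = (m \<oplus> n) \<otimes> (m \<oplus> n) \<oplus> m"

lemma dtm_pairing_code [dfn_intros]: "dtm t \<Longrightarrow> dtm u \<Longrightarrow> dtm (\<lambda>e. pairing_code (t e) (u e))"
  unfolding pairing_code_def by (intro dfn_intros)

lemma pairing_code_closed [simp]: "m \<epsilon> \<omega> \<Longrightarrow> n \<epsilon> \<omega> \<Longrightarrow> pairing_code m n \<epsilon> \<omega>"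
  by (simp add: pairing_code_def)

lemma pairing_code_less:
  assumes w: "m \<epsilon> \<omega>" "n \<epsilon> \<omega>" "m' \<epsilon> \<omega>" "n' \<epsilon> \<omega>" and less: "m \<oplus> n \<epsilon> m' \<oplus> n'"
  shows "pairing_code m n \<epsilon> pairing_code m' n'"
proof -
  let ?s = "m \<oplus> n" and ?t = "m' \<oplus> n'"
  have st: "?s \<epsilon> \<omega>" "?t \<epsilon> \<omega>" using w by simp_all
  \<comment> \<open>With \<open>s\<close> and \<open>t\<close> for the two sums, the chain is
    \<open>s^2 + m < s^2 + s + 1 <= (s + 1)^2 <= t^2 <= t^2 + m'\<close>.\<close>
  have "m \<epsilon> \<sigma> ?s" by (rule le_ad1[OF w(1,2)])
  then have "m \<oplus> ?s \<otimes> ?s \<epsilon> \<sigma> ?s \<oplus> ?s \<otimes> ?s" using ad_less_iff[of m "\<sigma> ?s" "?s \<otimes> ?s"] w st by simp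
  then have 1: "pairing_code m n \<epsilon> \<sigma> ?s \<oplus> ?s \<otimes> ?s"
    unfolding pairing_code_def using ad_comm[of m "?s \<otimes> ?s"] w st by simp
  have 2: "\<sigma> ?s \<oplus> ?s \<otimes> ?s \<epsilon> \<sigma> (\<sigma> ?s \<otimes> \<sigma> ?s)"
  proof -
    have "\<sigma> ?s \<otimes> \<sigma> ?s = (\<sigma> ?s \<oplus> ?s \<otimes> ?s) \<oplus> ?s" using st by (simp add: ad_ac)
    then show ?thesis using le_ad1[of "\<sigma> ?s \<oplus> ?s \<otimes> ?s" ?s] st by simp
  qed
  have 3: "\<sigma> ?s \<otimes> \<sigma> ?s \<epsilon> \<sigma> (?t \<otimes> ?t)"
  proof -
    have s: "\<sigma> ?s \<epsilon> \<sigma> ?t" by (rule succ_le[OF st(2) less])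
    have "\<sigma> ?s \<otimes> \<sigma> ?s \<epsilon> \<sigma> (?t \<otimes> \<sigma> ?s)" by (rule ml_le[OF s]) (use st in simp_all)
    moreover have "?t \<otimes> \<sigma> ?s \<epsilon> \<sigma> (?t \<otimes> ?t)"
      using ml_le[OF s st(2) st(2)] ml_comm[of ?t "\<sigma> ?s"] st by (simp del: ml_succ succ_ml mem_succ)
    ultimately show ?thesis by (rule le_trans) (use st in simp)
  qed
  have 4: "?t \<otimes> ?t \<epsilon> \<sigma> (pairing_code m' n')"
    unfolding pairing_code_def by (rule le_ad1) (use w st in simp_all)
  have c: "\<sigma> ?s \<otimes> \<sigma> ?s \<epsilon> \<omega>" "?t \<otimes> ?t \<epsilon> \<omega>" "pairing_code m' n' \<epsilon> \<omega>"
    using w st by (simp_all del: ml_succ succ_ml)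
  show ?thesis
    using less_le_trans[OF less_le_trans[OF less_le_trans[OF 1 2 c(1)] 3 c(2)] 4 c(3)] .
qed

lemma pairing_code_inj:
  assumes w: "m \<epsilon> \<omega>" "n \<epsilon> \<omega>" "m' \<epsilon> \<omega>" "n' \<epsilon> \<omega>" and eq: "pairing_code m n = pairing_code m' n'"
  shows "m = m' \<and> n = n'"
proof -
  have s: "m \<oplus> n = m' \<oplus> n'"
    using omega_linear[of "m \<oplus> n" "m' \<oplus> n'"] w eq pairing_code_less[OF w] pairing_code_less[of m' n' m n] by auto
  let ?Q = "(m' \<oplus> n') \<otimes> (m' \<oplus> n')"
  have Q: "?Q \<epsilon> \<omega>" using w by simp
  have "?Q \<oplus> m = ?Q \<oplus> m'" using eq s by (simp only: pairing_code_def)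
  then have "m = m'" unfolding ad_comm[OF w(1) Q] ad_comm[OF w(3) Q] using ad_cancel[OF w(1,3) Q] by blast
  moreover have "n \<oplus> m' = n' \<oplus> m'"
    using s \<open>m = m'\<close> ad_comm[OF w(2,3)] ad_comm[OF w(4,3)] by simp
  ultimately show ?thesis using ad_cancel[OF w(2,4,3)] by blast
qed

section \<open>Rational numbers\<close>

lemma is_fractionD: "is_fraction E a b c \<Longrightarrow> a \<epsilon> \<omega> \<and> b \<epsilon> \<omega> \<and> c \<epsilon> \<omega> \<and> c \<noteq> \<zero>"
  by (simp add: is_fraction_def)

lemma dfn_is_fraction [dfn_intros]:
  "dtm t \<Longrightarrow> dtm u \<Longrightarrow> dtm v \<Longrightarrow> dfn (\<lambda>e. is_fraction E (t e) (u e) (v e))"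
  by (rule dfn_comp3[where R = "is_fraction E"], unfold is_fraction_def, intro dfn_intros)

text \<open>Counterpart of \<open>rat\<close> that is definable on all arguments; the two agree on
  fractions by \<open>rat_eq\<close>.\<close>

definition fraction_class :: "'v \<Rightarrow> 'v \<Rightarrow> 'v \<Rightarrow> 'v" where
  "fraction_class a b c = sep (cart_prod E (cart_prod E \<omega> \<omega>) \<omega>)
     (\<lambda>t. \<exists>a' b' c'. is_fraction E a' b' c' \<and> t = opair E (opair E a' b') c' \<and>
        a \<otimes> c' \<oplus> b' \<otimes> c = a' \<otimes> c \<oplus> b \<otimes> c')"

lemma dtm_fraction_class [dfn_intros]:
  "dtm t \<Longrightarrow> dtm u \<Longrightarrow> dtm v \<Longrightarrow> dtm (\<lambda>e. fraction_class (t e) (u e) (v e))"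
  by (rule dtm_comp3[where R = fraction_class], unfold fraction_class_def, intro dfn_intros)

lemma mem_fraction_class:
  "t \<epsilon> fraction_class a b c \<longleftrightarrow> (\<exists>a' b' c'. is_fraction E a' b' c' \<and> t = opair E (opair E a' b') c' \<and>
        a \<otimes> c' \<oplus> b' \<otimes> c = a' \<otimes> c \<oplus> b \<otimes> c')"
proof -
  have D: "pdef (\<lambda>t. \<exists>a' b' c'. is_fraction E a' b' c' \<and> t = opair E (opair E a' b') c' \<and>
        a \<otimes> c' \<oplus> b' \<otimes> c = a' \<otimes> c \<oplus> b \<otimes> c')" by (intro dfn_intros)
  show ?thesis unfolding fraction_class_def mem_sep[OF D] by (auto simp: is_fraction_def)
qed

lemma rat_eq:
  assumes "is_fraction E a b c"
  shows "rat E a b c = fraction_class a b c"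
proof (rule set_ext)
  fix t
  have *: "add E (mult E a c') (mult E b' c) = add E (mult E a' c) (mult E b c') \<longleftrightarrow>
      a \<otimes> c' \<oplus> b' \<otimes> c = a' \<otimes> c \<oplus> b \<otimes> c'" if "is_fraction E a' b' c'" for a' b' c'
    using is_fractionD[OF that] is_fractionD[OF assms] by (simp add: add_eq mult_eq)
  have **: "(\<exists>a' b' c'. is_fraction E a' b' c' \<and> t = opair E (opair E a' b') c' \<and>
       add E (mult E a c') (mult E b' c) = add E (mult E a' c) (mult E b c')) \<longleftrightarrow> t \<epsilon> fraction_class a b c" for t
    unfolding mem_fraction_class using * by blast
  show "t \<epsilon> rat E a b c \<longleftrightarrow> t \<epsilon> fraction_class a b c"
    unfolding rat_def ** by (rule mem_the_set) blast
qed

lemma mem_rationals: "q \<epsilon> rationals E \<longleftrightarrow> (\<exists>a b c. is_fraction E a b c \<and> q = fraction_class a b c)"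
proof -
  have *: "(\<exists>a b c. is_fraction E a b c \<and> q = rat E a b c) \<longleftrightarrow>
      (\<exists>a b c. is_fraction E a b c \<and> q = fraction_class a b c)" for q
    using rat_eq by metis
  show ?thesis unfolding rationals_def *
  proof (rule mem_the_set, rule bounded_set_ex[of _ "pow (cart_prod E (cart_prod E \<omega> \<omega>) \<omega>)"], intro dfn_intros)
    show "q \<epsilon> pow (cart_prod E (cart_prod E \<omega> \<omega>) \<omega>)"
      if "\<exists>a b c. is_fraction E a b c \<and> q = fraction_class a b c" for q
      using that by (auto simp: is_subset_def mem_fraction_class is_fraction_def)
  qed
qed

text \<open>A rational is coded by the least code of a triple representing it, so no representative
  has to be chosen.\<close>

lemma countable_rationals: "is_countable E (rationals E)"
proof -
  let ?P = "\<lambda>q n. \<exists>a b c. is_fraction E a b c \<and> q = fraction_class a b c \<and> n = pairing_code (pairing_code a b) c"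
  define F where "F q = lst (sep \<omega> (?P q))" for q
  have D: "pdef (?P q)" for q by (intro dfn_intros)
  have F: "F q \<epsilon> \<omega> \<and> ?P q (F q)" if q: "q \<epsilon> rationals E" for q
  proof -
    from q obtain a b c where abc: "is_fraction E a b c" "q = fraction_class a b c" unfolding mem_rationals by blast
    then have "pairing_code (pairing_code a b) c \<epsilon> sep \<omega> (?P q)"
      unfolding mem_sep[OF D] using is_fractionD[OF abc(1)] by auto
    then have "F q \<epsilon> sep \<omega> (?P q)"
      unfolding F_def by (rule lst(1)[rotated]) (simp add: is_subset_def mem_sep[OF D])
    then show ?thesis unfolding mem_sep[OF D] .
  qed
  show ?thesis
  proof (rule is_countableI)
    show "fdef F" unfolding F_def by (intro dfn_intros)
    show "inj_on F (ext_of (rationals E))"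
    proof (rule inj_onI)
      fix q r assume *: "q \<in> ext_of (rationals E)" "r \<in> ext_of (rationals E)" "F q = F r"
      from * F[of q] obtain a b c where q: "is_fraction E a b c" "q = fraction_class a b c"
        "F q = pairing_code (pairing_code a b) c" by blast
      from * F[of r] obtain a' b' c' where r: "is_fraction E a' b' c'" "r = fraction_class a' b' c'"
        "F r = pairing_code (pairing_code a' b') c'" by blast
      have w: "a \<epsilon> \<omega>" "b \<epsilon> \<omega>" "c \<epsilon> \<omega>" "a' \<epsilon> \<omega>" "b' \<epsilon> \<omega>" "c' \<epsilon> \<omega>"
        using is_fractionD[OF q(1)] is_fractionD[OF r(1)] by blast+
      have "pairing_code (pairing_code a b) c = pairing_code (pairing_code a' b') c'"
        using * q(3) r(3) by simp
      then have "pairing_code a b = pairing_code a' b' \<and> c = c'"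
        using pairing_code_inj[of "pairing_code a b" c "pairing_code a' b'" c'] w by simp
      then show "q = r" using pairing_code_inj[of a b a' b'] w q(2) r(2) by simp
    qed
    show "F q \<epsilon> \<omega>" if "q \<epsilon> rationals E" for q using F[OF that] by blast
  qed
qed

section \<open>From Lindelof spaces to countable choice\<close>

lemma rat_less_fraction_class: "rat_less E q r \<longleftrightarrow> (\<exists>a b c a' b' c'.
    is_fraction E a b c \<and> is_fraction E a' b' c' \<and> q = fraction_class a b c \<and> r = fraction_class a' b' c' \<and>
    a \<otimes> c' \<oplus> b' \<otimes> c \<epsilon> a' \<otimes> c \<oplus> b \<otimes> c')"
proof -
  have "is_fraction E a b c \<and> is_fraction E a' b' c' \<and> q = rat E a b c \<and> r = rat E a' b' c' \<and>
      add E (mult E a c') (mult E b' c) \<epsilon> add E (mult E a' c) (mult E b c') \<longleftrightarrow>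
    is_fraction E a b c \<and> is_fraction E a' b' c' \<and> q = fraction_class a b c \<and> r = fraction_class a' b' c' \<and>
      a \<otimes> c' \<oplus> b' \<otimes> c \<epsilon> a' \<otimes> c \<oplus> b \<otimes> c'" for a b c a' b' c'
    by (intro conj_cong refl) (simp_all add: rat_eq is_fraction_def add_eq mult_eq)
  then show ?thesis unfolding rat_less_def by simp
qed

lemma dfn_rat_less [dfn_intros]: "dtm t \<Longrightarrow> dtm u \<Longrightarrow> dfn (\<lambda>e. rat_less E (t e) (u e))"
  by (rule dfn_comp2[where R = "rat_less E"], unfold rat_less_fraction_class, intro dfn_intros)

lemma mem_reals: "l \<epsilon> reals E \<longleftrightarrow> is_subset E l (rationals E) \<and>
     (\<exists>q. q \<epsilon> l) \<and> (\<exists>q. q \<epsilon> rationals E \<and> \<not> q \<epsilon> l) \<and>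
     (\<forall>q r. q \<epsilon> l \<and> r \<epsilon> rationals E \<and> rat_less E r q \<longrightarrow> r \<epsilon> l) \<and>
     (\<forall>q. q \<epsilon> l \<longrightarrow> (\<exists>r. r \<epsilon> l \<and> rat_less E q r))"
  unfolding reals_def
  by (rule mem_the_set, rule bounded_set_ex[of _ "pow (rationals E)"], intro dfn_intros) simp

text \<open>Iterating the step to the least member of \<open>K\<close> above the current one gives
  strictly increasing values. The start lies above zero, so zero itself is passed over.\<close>

lemma unbounded_enumeration:
  assumes K: "is_subset E K \<omega>" "\<And>n. n \<epsilon> \<omega> \<Longrightarrow> \<exists>k. k \<epsilon> K \<and> n \<epsilon> k"
  shows "\<exists>e. fdef e \<and> (\<forall>n. n \<epsilon> \<omega> \<longrightarrow> e n \<epsilon> K) \<and> inj_on e (ext_of \<omega>)"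
proof -
  define nx where "nx k = lst (sep K (\<lambda>m. k \<epsilon> m))" for k
  have D: "pdef (\<lambda>m. k \<epsilon> m)" for k by (intro dfn_intros)
  have nxt: "nx k \<epsilon> K \<and> k \<epsilon> nx k" if k: "k \<epsilon> \<omega>" for k
  proof -
    from K(2)[OF k] obtain m where "m \<epsilon> sep K (\<lambda>m. k \<epsilon> m)" unfolding mem_sep[OF D] by blast
    then have "nx k \<epsilon> sep K (\<lambda>m. k \<epsilon> m)" unfolding nx_def
      by (rule lst(1)[rotated]) (use is_subsetD[OF K(1)] in \<open>auto intro!: is_subsetI simp: mem_sep[OF D]\<close>)
    then show ?thesis unfolding mem_sep[OF D] .
  qed
  have [dfn_intros]: "dtm t \<Longrightarrow> dtm (\<lambda>e. nx (t e))" for t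
    by (rule dtm_comp1[where R = "nx"], unfold nx_def, intro dfn_intros)
  define e where "e n = rec (nx \<zero>) (\<lambda>_. nx) n" for n
  have h: "fdef2 (\<lambda>_. nx)" by (intro dfn_intros)
  have e0: "e \<zero> = nx \<zero>" unfolding e_def by (rule rec_zero[OF h])
  have eS: "e (\<sigma> n) = nx (e n)" if "n \<epsilon> \<omega>" for n unfolding e_def by (rule rec_succ[OF h that])
  have e: "fdef e" unfolding e_def by (intro dfn_intros)
  note [dfn_intros] = dtm_comp1[where R = e, OF e]
  have eK: "e n \<epsilon> K" if "n \<epsilon> \<omega>" for n
    using that
  proof (induction n rule: omega_induct)
    case zero
    then show ?case using nxt[OF zero_mem_omega] e0 by simp
  next
    case (succ n)
    then show ?case using nxt[of "e n"] eS is_subsetD[OF K(1)] by simp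
  qed (intro dfn_intros)
  then have ew: "e n \<epsilon> \<omega>" if "n \<epsilon> \<omega>" for n using that is_subsetD[OF K(1)] by blast
  have mono: "\<forall>m. m \<epsilon> n \<longrightarrow> e m \<epsilon> e n" if "n \<epsilon> \<omega>" for n
    using that
  proof (induction n rule: omega_induct)
    case (succ n)
    have "e n \<epsilon> e (\<sigma> n)" using nxt[OF ew[OF succ(1)]] eS[OF succ(1)] by simp
    then show ?case using succ.IH omega_trans[OF ew[OF succ_mem_omega[OF succ(1)]]] by auto
  qed (auto intro!: dfn_intros)
  have "inj_on e (ext_of \<omega>)"
  proof (rule inj_onI)
    fix m n assume "m \<in> ext_of \<omega>" "n \<in> ext_of \<omega>" "e m = e n"
    then show "m = n" using omega_linear[of m n] mono[of n] mono[of m] mem_irrefl[of "e m"] by auto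
  qed
  then show ?thesis using e eK by blast
qed

lemma T1_minus_point:
  assumes T: "topology_on E X T" and T1: "T1_space E X T" and U: "U \<epsilon> T"
  shows "diff E U (upair E y y) \<epsilon> T"
proof (cases "y \<epsilon> X")
  case False
  then have "diff E U (upair E y y) = U" using topologyD(1)[OF T U] by (intro set_ext) auto
  then show ?thesis using U by simp
next
  case True
  show ?thesis
  proof (rule open_locally[OF T])
    fix x assume "x \<epsilon> diff E U (upair E y y)"
    then have x: "x \<epsilon> U" "x \<noteq> y" by auto
    with True T1 topologyD(1)[OF T U] obtain V where "V \<epsilon> T" "x \<epsilon> V" "\<not> y \<epsilon> V"
      unfolding T1_space_def by blast
    then show "\<exists>V. V \<epsilon> T \<and> x \<epsilon> V \<and> is_subset E V (diff E U (upair E y y))"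
      using x topologyD(4)[OF T U] by (intro exI[of _ "inter E U V"]) (auto simp: is_subset_def)
  qed
qed

lemma lst_witness:
  assumes k: "fdef k" and C: "x \<epsilon> C" "\<And>u. u \<epsilon> C \<Longrightarrow> k u \<epsilon> \<omega>"
  shows "\<exists>u. u \<epsilon> C \<and> k u = lst (rep C k)" "\<And>u. u \<epsilon> C \<Longrightarrow> \<not> k u \<epsilon> lst (rep C k)"
    "\<And>u. u \<epsilon> C \<Longrightarrow> lst (rep C k) \<epsilon> \<sigma> (k u)"
proof -
  have *: "is_subset E (rep C k) \<omega>" using C(2) by (auto simp: is_subset_def mem_rep[OF k])
  have "k x \<epsilon> rep C k" using C(1) by (auto simp: mem_rep[OF k])
  from lst(1)[OF * this] show "\<exists>u. u \<epsilon> C \<and> k u = lst (rep C k)" by (auto simp: mem_rep[OF k])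
  show "\<not> k u \<epsilon> lst (rep C k)" if "u \<epsilon> C" for u
    by (rule lst(2)[OF *]) (use that in \<open>auto simp: mem_rep[OF k]\<close>)
  show "lst (rep C k) \<epsilon> \<sigma> (k u)" if "u \<epsilon> C" for u
    by (rule lst_le[OF *]) (use that in \<open>auto simp: mem_rep[OF k]\<close>)
qed

text \<open>A countable cover without finite subcover ranks the points: \<open>f y\<close> is the
  least code of a member containing \<open>y\<close>, and the ranks are unbounded. Picking a point
  from each of infinitely many ranks would need choice, so the Lindelof property is applied a second
  time, to a cover indexed by points. A set of points with pairwise different ranks meets each open
  \<open>V n\<close> in finitely many points, which is why all its subsets are closed.\<close>

lemma closed_discrete_sequence:
  assumes T: "topology_on E Y TY" and nc: "\<not> compact_space E Y TY"
    and L: "Lindelof_space E Y TY" and T1: "T1_space E Y TY"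
  shows "\<exists>p. fdef p \<and> (\<forall>n. n \<epsilon> \<omega> \<longrightarrow> p n \<epsilon> Y) \<and> inj_on p (ext_of \<omega>) \<and>
    (\<forall>A. is_subset E A \<omega> \<longrightarrow> diff E Y (rep A p) \<epsilon> TY)"
proof -
  from nc obtain S\<^sub>0 where S\<^sub>0: "open_cover E Y TY S\<^sub>0"
    "\<And>S'. is_subset E S' S\<^sub>0 \<Longrightarrow> is_finite E S' \<Longrightarrow> \<not> open_cover E Y TY S'" unfolding compact_space_def by blast
  with L obtain S where S': "is_subset E S S\<^sub>0" "is_countable E S" "open_cover E Y TY S"
    unfolding Lindelof_space_def by blast
  then have S: "is_subset E S TY" "union_of E S = Y" unfolding open_cover_def by blast+
  from S'(2) obtain g where g: "fdef g"
    "\<And>U V. U \<epsilon> S \<Longrightarrow> V \<epsilon> S \<Longrightarrow> g U = g V \<Longrightarrow> U = V" "\<And>U. U \<epsilon> S \<Longrightarrow> g U \<epsilon> \<omega>"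
    by (rule is_countableE) (rule that)
  note [dfn_intros] = dtm_comp1[where R = g, OF g(1)]
  define V where "V n = union_of E (sep S (\<lambda>U. g U \<epsilon> \<sigma> n))" for n
  define f where "f y = lst (rep (sep S (\<lambda>U. y \<epsilon> U)) g)" for y
  have [dfn_intros]: "dtm t \<Longrightarrow> dtm (\<lambda>e. V (t e))" for t
    by (rule dtm_comp1[where R = V], unfold V_def, intro dfn_intros)
  have [dfn_intros]: "dtm t \<Longrightarrow> dtm (\<lambda>e. f (t e))" for t
    by (rule dtm_comp1[where R = f], unfold f_def, intro dfn_intros)
  have DV: "pdef (\<lambda>U. g U \<epsilon> \<sigma> n)" for n by (intro dfn_intros)
  have Df: "pdef (\<lambda>U. y \<epsilon> U)" for y by (intro dfn_intros)
  have V_open: "V n \<epsilon> TY" for n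
    unfolding V_def by (rule topologyD(5)[OF T], rule is_subsetI)
      (use is_subsetD[OF S(1)] in \<open>auto simp: mem_sep[OF DV]\<close>)
  have f_wit: "(\<exists>U. U \<epsilon> S \<and> y \<epsilon> U \<and> g U = f y) \<and> (\<forall>U. U \<epsilon> S \<and> y \<epsilon> U \<longrightarrow> f y \<epsilon> \<sigma> (g U))"
    if y: "y \<epsilon> Y" for y
  proof -
    obtain U where "U \<epsilon> sep S (\<lambda>U. y \<epsilon> U)" using y S(2) by (auto simp: mem_sep[OF Df])
    note w = lst_witness[OF g(1) this, folded f_def, unfolded mem_sep[OF Df]]
    show ?thesis using w(1) w(3) g(3) by blast
  qed
  have f_omega: "f y \<epsilon> \<omega>" if "y \<epsilon> Y" for y using f_wit[OF that] g(3) by metis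
  have mem_V: "y \<epsilon> V n \<longleftrightarrow> f y \<epsilon> \<sigma> n" if y: "y \<epsilon> Y" and n: "n \<epsilon> \<omega>" for y n
  proof
    assume "y \<epsilon> V n"
    then obtain U where U: "U \<epsilon> S" "g U \<epsilon> \<sigma> n" "y \<epsilon> U" unfolding V_def mem_union_of mem_sep[OF DV] by blast
    then have "f y \<epsilon> \<sigma> (g U)" using f_wit[OF y] by blast
    then show "f y \<epsilon> \<sigma> n" using U(2) n by (rule le_trans)
  next
    assume "f y \<epsilon> \<sigma> n"
    then show "y \<epsilon> V n" using f_wit[OF y] unfolding V_def mem_union_of mem_sep[OF DV] by metis
  qed
  have V_self: "y \<epsilon> V (f y)" if "y \<epsilon> Y" for y using mem_V[OF that f_omega[OF that]] by simp
  have unbounded: "\<exists>y. y \<epsilon> Y \<and> n \<epsilon> f y" if n: "n \<epsilon> \<omega>" for n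
  proof (rule ccontr)
    assume "\<nexists>y. y \<epsilon> Y \<and> n \<epsilon> f y"
    then have "y \<epsilon> V n" if "y \<epsilon> Y" for y
      using mem_V[OF that n] omega_linear[OF n f_omega[OF that]] that by auto
    moreover have "V n \<epsilon> TY" by (rule V_open)
    ultimately have "V n = Y" using topologyD(1)[OF T] by (intro set_ext) blast
    then have "open_cover E Y TY (sep S (\<lambda>U. g U \<epsilon> \<sigma> n))"
      using is_subsetD[OF S(1)] unfolding open_cover_def V_def
      by (auto intro!: is_subsetI simp: mem_sep[OF DV])
    moreover have "is_finite E (sep S (\<lambda>U. g U \<epsilon> \<sigma> n))"
      by (rule finite_initial[OF g(1,2) succ_mem_omega[OF n]])
    moreover have "is_subset E (sep S (\<lambda>U. g U \<epsilon> \<sigma> n)) S\<^sub>0"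
      using is_subsetD[OF S'(1)] by (intro is_subsetI) (simp only: mem_sep[OF DV])
    ultimately show False using S\<^sub>0(2) by blast
  qed

  \<comment> \<open>A countable subcover of the sets \<open>H y\<close> picks countably many points \<open>y\<close>, since \<open>H y\<close> determines \<open>y\<close>.\<close>
  define H where "H y = diff E (V (f y)) (upair E y y)" for y
  have H: "fdef H" unfolding H_def by (intro dfn_intros)
  have "open_cover E Y TY (rep Y H)"
    unfolding open_cover_def
  proof
    have H_open: "H y \<epsilon> TY" for y unfolding H_def by (rule T1_minus_point[OF T T1 V_open])
    then show "is_subset E (rep Y H) TY" by (auto intro!: is_subsetI simp: mem_rep[OF H])
    show "union_of E (rep Y H) = Y"
    proof (rule set_ext)
      fix y
      have "\<exists>z. z \<epsilon> Y \<and> y \<epsilon> H z" if y: "y \<epsilon> Y"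
      proof -
        \<comment> \<open>A point of larger rank supplies a member around \<open>y\<close> that does
          not delete \<open>y\<close>.\<close>
        obtain z where z: "z \<epsilon> Y" "f y \<epsilon> f z" using unbounded[OF f_omega[OF y]] by blast
        then have "y \<epsilon> V (f z)" using mem_V[OF y f_omega[OF z(1)]] by simp
        moreover have "y \<noteq> z" using z(2) mem_irrefl by blast
        ultimately show ?thesis using z(1) unfolding H_def by auto
      qed
      then show "y \<epsilon> union_of E (rep Y H) \<longleftrightarrow> y \<epsilon> Y"
        using topologyD(1)[OF T H_open] by (auto simp: mem_rep[OF H])
    qed
  qed
  with L obtain C where C: "is_subset E C (rep Y H)" "is_countable E C" "union_of E C = Y"
    unfolding Lindelof_space_def open_cover_def by blast
  from C(2) obtain k where k: "fdef k"
    "\<And>U V. U \<epsilon> C \<Longrightarrow> V \<epsilon> C \<Longrightarrow> k U = k V \<Longrightarrow> U = V" "\<And>U. U \<epsilon> C \<Longrightarrow> k U \<epsilon> \<omega>"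
    by (rule is_countableE) (rule that)
  note [dfn_intros] = dtm_comp1[where R = k, OF k(1)] dtm_comp1[where R = H, OF H]
  have H_inj: "y = z" if "y \<epsilon> Y" "z \<epsilon> Y" "H y = H z" for y z
  proof (rule ccontr)
    assume ne: "y \<noteq> z"
    \<comment> \<open>If the rank of \<open>y\<close> is at most that of \<open>z\<close>, then
      \<open>y\<close> lies in \<open>H z\<close>, whereas \<open>H y\<close> omits it.\<close>
    have aux: False if y: "y \<epsilon> Y" and z: "z \<epsilon> Y" and eq: "H y = H z" and ne: "y \<noteq> z" and le: "f y \<epsilon> \<sigma> (f z)" for y z
    proof -
      have "y \<epsilon> H z" using mem_V[OF y f_omega[OF z]] le ne unfolding H_def by simp
      then have "y \<epsilon> H y" using eq by simp
      then show False unfolding H_def by simp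
    qed
    show False using omega_linear[OF f_omega[OF that(1)] f_omega[OF that(2)]]
        aux[OF that ne] aux[OF that(2,1) that(3)[symmetric] ne[symmetric]] by auto
  qed
  define D where "D = sep Y (\<lambda>y. H y \<epsilon> C)"
  have mem_D: "y \<epsilon> D \<longleftrightarrow> y \<epsilon> Y \<and> H y \<epsilon> C" for y
    unfolding D_def by (rule mem_sep) (intro dfn_intros)
  \<comment> \<open>Several of the selected points may share a rank; the one whose member of
    \<open>C\<close> has the least code is kept, which makes \<open>f\<close> injective on
    \<open>D\<^sub>0\<close>.\<close>
  define D\<^sub>0 where "D\<^sub>0 = sep D (\<lambda>y. \<forall>z. z \<epsilon> D \<and> f z = f y \<longrightarrow> \<not> k (H z) \<epsilon> k (H y))"
  have mem_D\<^sub>0: "y \<epsilon> D\<^sub>0 \<longleftrightarrow> y \<epsilon> D \<and> (\<forall>z. z \<epsilon> D \<and> f z = f y \<longrightarrow> \<not> k (H z) \<epsilon> k (H y))" for y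
    unfolding D\<^sub>0_def by (rule mem_sep) (intro dfn_intros)
  have D\<^sub>0_Y: "y \<epsilon> Y" if "y \<epsilon> D\<^sub>0" for y using that mem_D\<^sub>0 mem_D by blast
  have f_inj: "y = z" if y: "y \<epsilon> D\<^sub>0" and z: "z \<epsilon> D\<^sub>0" and eq: "f y = f z" for y z
  proof -
    have D: "y \<epsilon> D" "z \<epsilon> D" using y z mem_D\<^sub>0 by blast+
    then have OC: "H y \<epsilon> C" "H z \<epsilon> C" using mem_D by blast+
    have "\<not> k (H y) \<epsilon> k (H z)" "\<not> k (H z) \<epsilon> k (H y)" using y z eq D unfolding mem_D\<^sub>0 by (blast, metis)
    then have "k (H y) = k (H z)" using omega_linear[OF k(3)[OF OC(1)] k(3)[OF OC(2)]] by blast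
    then have "H y = H z" using k(2) OC by blast
    then show ?thesis using H_inj D mem_D by blast
  qed
  have f_unb: "\<exists>y. y \<epsilon> D\<^sub>0 \<and> n \<epsilon> f y" if n: "n \<epsilon> \<omega>" for n
  proof -
    \<comment> \<open>Ranks among the selected points stay unbounded: a member \<open>H y\<close>
      that contains a point of rank above \<open>n\<close> has \<open>f y\<close> at least that
      rank.\<close>
    obtain x where x: "x \<epsilon> Y" "n \<epsilon> f x" using unbounded[OF n] by blast
    then obtain U where U: "U \<epsilon> C" "x \<epsilon> U" using C(3) by auto
    then obtain y where y: "y \<epsilon> Y" "U = H y" using is_subsetD[OF C(1)] unfolding mem_rep[OF H] by blast
    then have yD: "y \<epsilon> D" using U(1) mem_D by blast
    have "x \<epsilon> V (f y)" using U(2) y(2) unfolding H_def by simp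
    then have "f x \<epsilon> \<sigma> (f y)" using mem_V[OF x(1) f_omega[OF y(1)]] by blast
    then have ny: "n \<epsilon> f y" using less_le_trans[OF x(2)] f_omega[OF y(1)] by blast
    let ?D = "sep D (\<lambda>z. f z = f y)"
    have DD: "pdef (\<lambda>z. f z = f y)" by (intro dfn_intros)
    have kO: "fdef (\<lambda>z. k (H z))" by (intro dfn_intros)
    have yDD: "y \<epsilon> ?D" using yD mem_sep[OF DD] by blast
    have "k (H u) \<epsilon> \<omega>" if "u \<epsilon> ?D" for u using that k(3) mem_D mem_sep[OF DD] by blast
    note w = lst_witness[OF kO yDD this]
    from w(1) obtain u where u: "u \<epsilon> ?D" "k (H u) = lst (rep ?D (\<lambda>z. k (H z)))" by blast
    have uD: "u \<epsilon> D" "f u = f y" using u(1) mem_sep[OF DD] by blast+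
    have "\<not> k (H z) \<epsilon> k (H u)" if z: "z \<epsilon> D" "f z = f u" for z
    proof -
      have "f z = f y" using z(2) uD(2) by (rule trans)
      then have "z \<epsilon> ?D" unfolding mem_sep[OF DD] using z(1) by blast
      then show ?thesis unfolding u(2) using w(2) by blast
    qed
    then have "u \<epsilon> D\<^sub>0" using uD mem_D\<^sub>0 by blast
    then show ?thesis using ny uD(2) by auto
  qed
  \<comment> \<open>Only finitely many points of \<open>D\<^sub>0\<close> lie in each \<open>V n\<close>, and they can be removed by \<open>T\<^sub>1\<close>.\<close>
  have closed: "diff E Y B \<epsilon> TY" if B: "is_subset E B D\<^sub>0" for B
  proof (rule open_locally[OF T])
    fix x assume "x \<epsilon> diff E Y B"
    then have x: "x \<epsilon> Y" "\<not> x \<epsilon> B" by auto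
    have BY: "b \<epsilon> D\<^sub>0 \<and> b \<epsilon> Y" if "b \<epsilon> B" for b using that is_subsetD[OF B] D\<^sub>0_Y by blast
    \<comment> \<open>\<open>finite_inter_open\<close> needs codes on the open sets themselves.
      \<open>G b\<close> omits just \<open>b\<close> from \<open>Y\<close>, so the union of its
      complement is \<open>b\<close> again and \<open>h\<close> recovers the rank of
      \<open>b\<close>.\<close>
    define h where "h U = f (union_of E (diff E Y U))" for U
    define G where "G b = diff E Y (upair E b b)" for b
    have h: "fdef h" and G: "fdef G" unfolding h_def G_def by (intro dfn_intros)+
    note [dfn_intros] = dtm_comp1[where R = h, OF h]
    have hG: "h (G b) = f b" if "b \<epsilon> B" for b
    proof -
      have "union_of E (diff E Y (G b)) = b" using BY[OF that] by (intro set_ext) (auto simp: G_def)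
      then show ?thesis unfolding h_def by simp
    qed
    have "sep Y (\<lambda>x. \<forall>U. U \<epsilon> rep B G \<and> h U \<epsilon> \<sigma> (f x\<^sub>0) \<longrightarrow> x \<epsilon> U) \<epsilon> TY" if "x\<^sub>0 \<epsilon> Y" for x\<^sub>0
    proof (rule finite_inter_open[OF T _ h])
      show "is_subset E (rep B G) TY"
        using T1_minus_point[OF T T1 topologyD(2)[OF T]] by (auto intro!: is_subsetI simp: mem_rep[OF G] G_def)
      show "U = W" if UW: "U \<epsilon> rep B G" "W \<epsilon> rep B G" "h U = h W" for U W
      proof -
        obtain b c where "b \<epsilon> B" "U = G b" "c \<epsilon> B" "W = G c" using UW(1,2) unfolding mem_rep[OF G] by blast
        then show ?thesis using UW(3) hG f_inj BY by metis
      qed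
      show "\<sigma> (f x\<^sub>0) \<epsilon> \<omega>" using f_omega[OF that] by simp
    qed
    note N = this[OF x(1)]
    let ?N = "sep Y (\<lambda>z. \<forall>U. U \<epsilon> rep B G \<and> h U \<epsilon> \<sigma> (f x) \<longrightarrow> z \<epsilon> U)"
    have DN: "pdef (\<lambda>z. \<forall>U. U \<epsilon> rep B G \<and> h U \<epsilon> \<sigma> (f x) \<longrightarrow> z \<epsilon> U)" by (intro dfn_intros)
    have "x \<epsilon> ?N" using x by (auto simp: mem_sep[OF DN] mem_rep[OF G] G_def)
    moreover have "is_subset E (inter E (V (f x)) ?N) (diff E Y B)"
    proof (rule is_subsetI)
      fix z assume z: "z \<epsilon> inter E (V (f x)) ?N"
      then have zV: "z \<epsilon> V (f x)" and zN: "z \<epsilon> Y" "\<And>U. U \<epsilon> rep B G \<Longrightarrow> h U \<epsilon> \<sigma> (f x) \<Longrightarrow> z \<epsilon> U"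
        unfolding mem_inter mem_sep[OF DN] by blast+
      have "\<not> z \<epsilon> B"
      proof
        assume zB: "z \<epsilon> B"
        have "h (G z) \<epsilon> \<sigma> (f x)" using mem_V[OF zN(1) f_omega[OF x(1)]] zV hG[OF zB] by simp
        moreover have "G z \<epsilon> rep B G" using zB mem_rep[OF G] by blast
        ultimately have "z \<epsilon> G z" using zN(2) by blast
        then show False by (simp add: G_def)
      qed
      then show "z \<epsilon> diff E Y B" using zN(1) by simp
    qed
    ultimately show "\<exists>U. U \<epsilon> TY \<and> x \<epsilon> U \<and> is_subset E U (diff E Y B)"
      using topologyD(4)[OF T V_open N] V_self[OF x(1)] mem_inter by blast
  qed

  have ff: "fdef f" by (intro dfn_intros)
  have "\<exists>e. fdef e \<and> (\<forall>n. n \<epsilon> \<omega> \<longrightarrow> e n \<epsilon> rep D\<^sub>0 f) \<and> inj_on e (ext_of \<omega>)"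
  proof (rule unbounded_enumeration)
    show "is_subset E (rep D\<^sub>0 f) \<omega>" using f_omega D\<^sub>0_Y by (auto intro!: is_subsetI simp: mem_rep[OF ff])
    show "\<exists>m. m \<epsilon> rep D\<^sub>0 f \<and> n \<epsilon> m" if "n \<epsilon> \<omega>" for n using f_unb[OF that] mem_rep[OF ff] by blast
  qed
  then obtain e where e: "fdef e" "\<And>n. n \<epsilon> \<omega> \<Longrightarrow> e n \<epsilon> rep D\<^sub>0 f" "inj_on e (ext_of \<omega>)" by blast
  note [dfn_intros] = dtm_comp1[where R = e, OF e(1)]
  \<comment> \<open>Ranks are injective on \<open>D\<^sub>0\<close>, so the set under the union is a
    singleton and \<open>p n\<close> is its element.\<close>
  define p where "p n = union_of E (sep D\<^sub>0 (\<lambda>y. f y = e n))" for n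
  have Dp: "pdef (\<lambda>y. f y = e n)" for n by (intro dfn_intros)
  have p: "p n \<epsilon> D\<^sub>0 \<and> f (p n) = e n" if n: "n \<epsilon> \<omega>" for n
  proof -
    obtain y where y: "y \<epsilon> D\<^sub>0" "f y = e n" using e(2)[OF n] unfolding mem_rep[OF ff] by metis
    then have "u \<epsilon> sep D\<^sub>0 (\<lambda>y. f y = e n) \<longleftrightarrow> u = y" for u unfolding mem_sep[OF Dp] using f_inj by metis
    then have "p n = y" unfolding p_def by (intro set_ext) simp
    then show ?thesis using y by simp
  qed
  have pf: "fdef p" unfolding p_def by (intro dfn_intros)
  show ?thesis
  proof (intro exI[of _ p] conjI allI impI pf)
    show "p n \<epsilon> Y" if "n \<epsilon> \<omega>" for n using p[OF that] D\<^sub>0_Y by blast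
    show "inj_on p (ext_of \<omega>)"
    proof (rule inj_onI)
      fix m n assume *: "m \<in> ext_of \<omega>" "n \<in> ext_of \<omega>" "p m = p n"
      then have "e m = e n" using p by (metis mem_Collect_eq)
      then show "m = n" using e(3) * by (auto dest: inj_onD)
    qed
    show "diff E Y (rep A p) \<epsilon> TY" if "is_subset E A \<omega>" for A
      by (rule closed, rule is_subsetI) (use is_subsetD[OF that] p in \<open>auto simp: mem_rep[OF pf]\<close>)
  qed
qed

lemma CAC_reals_if_Lindelof:
  assumes T: "topology_on E Y TY" and nc: "\<not> compact_space E Y TY"
    and L: "Lindelof_space E Y TY" and T1: "T1_space E Y TY"
  shows "CAC_reals E"
  unfolding CAC_reals_def
proof (intro allI impI, elim conjE)
  fix F assume F: "is_denumerable E F" "\<forall>a. a \<epsilon> F \<longrightarrow> is_subset E a (reals E) \<and> \<not> is_empty E a"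
  from closed_discrete_sequence[OF assms] obtain p where p: "fdef p" "\<And>n. n \<epsilon> \<omega> \<Longrightarrow> p n \<epsilon> Y"
    "inj_on p (ext_of \<omega>)" "\<And>A. is_subset E A \<omega> \<Longrightarrow> diff E Y (rep A p) \<epsilon> TY" by blast
  have "is_countable E F" using F(1) unfolding is_denumerable_def by blast
  then obtain i where i: "fdef i"
    "\<And>a b. a \<epsilon> F \<Longrightarrow> b \<epsilon> F \<Longrightarrow> i a = i b \<Longrightarrow> a = b" "\<And>a. a \<epsilon> F \<Longrightarrow> i a \<epsilon> \<omega>"
    by (rule is_countableE) (rule that)
  obtain c where c: "fdef c"
    "\<And>q r. q \<epsilon> rationals E \<Longrightarrow> r \<epsilon> rationals E \<Longrightarrow> c q = c r \<Longrightarrow> q = r" "\<And>q. q \<epsilon> rationals E \<Longrightarrow> c q \<epsilon> \<omega>"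
    by (rule is_countableE[OF countable_rationals]) (rule that)
  note [dfn_intros] = dtm_comp1[where R = p, OF p(1)] dtm_comp1[where R = i, OF i(1)] dtm_comp1[where R = c, OF c(1)]
  \<comment> \<open>Second coordinate zero is reserved for the base points; the successor keeps the
    codes of rationals away from it.\<close>
  define base where "base a = pairing_code (i a) \<zero>" for a
  define pt where "pt a q = pairing_code (i a) (\<sigma> (c q))" for a q
  have [dfn_intros]: "dtm t \<Longrightarrow> dtm (\<lambda>e. base (t e))" "dtm t \<Longrightarrow> dtm u \<Longrightarrow> dtm (\<lambda>e. pt (t e) (u e))" for t u
    unfolding base_def pt_def by (intro dfn_intros; assumption)+
  have base_omega: "base a \<epsilon> \<omega>" if "a \<epsilon> F" for a unfolding base_def using i(3)[OF that] by simp
  have pt_omega: "pt a q \<epsilon> \<omega>" if "a \<epsilon> F" "q \<epsilon> rationals E" for a q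
    unfolding pt_def using i(3)[OF that(1)] c(3)[OF that(2)] by simp
  have base_inj: "a = b" if "a \<epsilon> F" "b \<epsilon> F" "base a = base b" for a b
    using pairing_code_inj[of "i a" \<zero> "i b" \<zero>] i that unfolding base_def by simp
  have pt_base: "pt a q \<noteq> base b" if "a \<epsilon> F" "b \<epsilon> F" "q \<epsilon> rationals E" for a b q
    using pairing_code_inj[of "i a" "\<sigma> (c q)" "i b" \<zero>] i(3) c(3) that unfolding base_def pt_def by auto
  have pt_inj: "q = r" if "a \<epsilon> F" "b \<epsilon> F" "q \<epsilon> rationals E" "r \<epsilon> rationals E" "pt a q = pt b r" for a b q r
  proof -
    have "\<sigma> (c q) = \<sigma> (c r)"
      using pairing_code_inj[of "i a" "\<sigma> (c q)" "i b" "\<sigma> (c r)"] i(3) c(3) that unfolding pt_def by auto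
    then show ?thesis using succ_inj c that(3,4) by auto
  qed
  have p_inj: "m = n" if "m \<epsilon> \<omega>" "n \<epsilon> \<omega>" "p m = p n" for m n
    using p(3) that by (auto dest: inj_onD)
  have Fr: "r \<epsilon> rationals E" if "a \<epsilon> F" "l \<epsilon> a" "r \<epsilon> l" for a l r
  proof -
    have "l \<epsilon> reals E" using F(2) that(1,2) by (auto intro: is_subsetD)
    then show ?thesis using that(3) is_subsetD unfolding mem_reals by blast
  qed

  \<comment> \<open>Open sets arise by deleting points of the sequence, so \<open>A a r\<close>
    holds the indices to delete. What survives is the base point of \<open>a\<close> and the points
    of \<open>a\<close> for the rationals in \<open>r\<close>.\<close>
  define A where "A a r = sep \<omega> (\<lambda>n. n \<noteq> base a \<and> \<not> (\<exists>q. q \<epsilon> r \<and> n = pt a q))" for a r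
  have mem_A: "n \<epsilon> A a r \<longleftrightarrow> n \<epsilon> \<omega> \<and> n \<noteq> base a \<and> \<not> (\<exists>q. q \<epsilon> r \<and> n = pt a q)" for n a r
    unfolding A_def by (rule mem_sep) (intro dfn_intros)
  define B where "B = sep \<omega> (\<lambda>n. \<exists>a. a \<epsilon> F \<and> n = base a)"
  have mem_B: "n \<epsilon> B \<longleftrightarrow> n \<epsilon> \<omega> \<and> (\<exists>a. a \<epsilon> F \<and> n = base a)" for n
    unfolding B_def by (rule mem_sep) (intro dfn_intros)
  define co where "co A = diff E Y (rep A p)" for A
  have co: "p n \<epsilon> co A \<longleftrightarrow> \<not> n \<epsilon> A" if "is_subset E A \<omega>" "n \<epsilon> \<omega>" for n A
    unfolding co_def mem_diff mem_rep[OF p(1)] using p(2) p_inj is_subsetD[OF that(1)] that(2) by blast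
  have [dfn_intros]: "dtm t \<Longrightarrow> dtm u \<Longrightarrow> dtm (\<lambda>e. co (A (t e) (u e)))" for t u
    by (rule dtm_comp2[where R = "\<lambda>a r. co (A a r)"], unfold co_def A_def, intro dfn_intros)
  have AB: "is_subset E (A a r) \<omega>" "is_subset E B \<omega>" for a r
    by (rule is_subsetI, simp add: mem_A) (rule is_subsetI, simp add: mem_B)
  define C where "C = sep TY (\<lambda>U. U = co B \<or> (\<exists>a r. a \<epsilon> F \<and> r \<epsilon> a \<and> U = co (A a r)))"
  have mem_C: "U \<epsilon> C \<longleftrightarrow> U \<epsilon> TY \<and> (U = co B \<or> (\<exists>a r. a \<epsilon> F \<and> r \<epsilon> a \<and> U = co (A a r)))" for U
    unfolding C_def by (rule mem_sep) (intro dfn_intros)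
  have co_open: "co B \<epsilon> TY" "co (A a r) \<epsilon> TY" for a r
    unfolding co_def using p(4) AB by blast+
  have "open_cover E Y TY C"
    unfolding open_cover_def
  proof
    show "is_subset E C TY" by (rule is_subsetI) (simp add: mem_C)
    show "union_of E C = Y"
    proof (rule set_ext)
      fix y
      have "\<exists>U. U \<epsilon> C \<and> y \<epsilon> U" if y: "y \<epsilon> Y"
      proof (cases "\<exists>a. a \<epsilon> F \<and> y = p (base a)")
        case True
        then obtain a where a: "a \<epsilon> F" "y = p (base a)" by blast
        then obtain r where r: "r \<epsilon> a" using F(2) unfolding is_empty_def by blast
        have "y \<epsilon> co (A a r)" unfolding a(2) co[OF AB(1) base_omega[OF a(1)]] mem_A by simp
        then show ?thesis using a(1) r co_open mem_C by blast
      next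
        case False
        then have "y \<epsilon> co B" using y unfolding co_def mem_diff mem_rep[OF p(1)] mem_B by blast
        then show ?thesis using co_open mem_C by blast
      qed
      moreover have "y \<epsilon> Y" if "U \<epsilon> C" "y \<epsilon> U" for U using that topologyD(1)[OF T] mem_C by blast
      ultimately show "y \<epsilon> union_of E C \<longleftrightarrow> y \<epsilon> Y" unfolding mem_union_of by blast
    qed
  qed
  with L obtain C' where C': "is_subset E C' C" "is_countable E C'" "union_of E C' = Y"
    unfolding Lindelof_space_def open_cover_def by blast
  from C'(2) obtain k where k: "fdef k"
    "\<And>U V. U \<epsilon> C' \<Longrightarrow> V \<epsilon> C' \<Longrightarrow> k U = k V \<Longrightarrow> U = V" "\<And>U. U \<epsilon> C' \<Longrightarrow> k U \<epsilon> \<omega>"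
    by (rule is_countableE) (rule that)
  note [dfn_intros] = dtm_comp1[where R = k, OF k(1)]
  define S where "S a = sep C' (\<lambda>U. p (base a) \<epsilon> U)" for a
  have mem_S: "U \<epsilon> S a \<longleftrightarrow> U \<epsilon> C' \<and> p (base a) \<epsilon> U" for U a
    unfolding S_def by (rule mem_sep) (intro dfn_intros)
  have [dfn_intros]: "dtm t \<Longrightarrow> dtm (\<lambda>e. S (t e))" for t
    by (rule dtm_comp1[where R = S], unfold S_def, intro dfn_intros)
  \<comment> \<open>Least code in the subcover among the members containing the base point of
    \<open>a\<close>, again written as the union of a singleton to keep it definable.\<close>
  define W where "W a = union_of E (sep (S a) (\<lambda>U. k U = lst (rep (S a) k)))" for a
  have [dfn_intros]: "dtm t \<Longrightarrow> dtm (\<lambda>e. W (t e))" for t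
    by (rule dtm_comp1[where R = W], unfold W_def, intro dfn_intros)
  have W: "W a \<epsilon> S a" if a: "a \<epsilon> F" for a
  proof -
    have D: "pdef (\<lambda>U. k U = lst (rep (S a) k))" by (intro dfn_intros)
    obtain U\<^sub>0 where "U\<^sub>0 \<epsilon> S a" using C'(3) p(2)[OF base_omega[OF a]] unfolding mem_S by (metis mem_union_of)
    then obtain U where U: "U \<epsilon> S a" "k U = lst (rep (S a) k)"
      using lst_witness(1)[OF k(1), of U\<^sub>0 "S a"] k(3) unfolding mem_S by blast
    have "V \<epsilon> sep (S a) (\<lambda>U. k U = lst (rep (S a) k)) \<longleftrightarrow> V = U" for V
      unfolding mem_sep[OF D] using U k(2) unfolding mem_S by metis
    then have "W a = U" unfolding W_def by (intro set_ext) simp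
    then show ?thesis using U by simp
  qed
  \<comment> \<open>A real is a Dedekind cut, hence a set of rationals, and can be read back from
    the points of the sequence that survive in \<open>W a\<close>.\<close>
  define ch where "ch a = sep (rationals E) (\<lambda>q. p (pt a q) \<epsilon> W a)" for a
  have mem_ch: "q \<epsilon> ch a \<longleftrightarrow> q \<epsilon> rationals E \<and> p (pt a q) \<epsilon> W a" for q a
    unfolding ch_def by (rule mem_sep) (intro dfn_intros)
  have ch_def': "fdef ch" unfolding ch_def by (intro dfn_intros)
  have ch: "ch a \<epsilon> a" if a: "a \<epsilon> F" for a
  proof -
    have WC: "W a \<epsilon> C" "p (base a) \<epsilon> W a" using W[OF a] is_subsetD[OF C'(1)] unfolding mem_S by blast+
    have "W a \<noteq> co B" using WC(2) co[OF AB(2) base_omega[OF a]] a base_omega[OF a] mem_B by auto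
    then obtain b r where b: "b \<epsilon> F" "r \<epsilon> b" "W a = co (A b r)" using WC(1) mem_C by blast
    have "\<not> base a \<epsilon> A b r" using WC(2) co[OF AB(1) base_omega[OF a]] b(3) by simp
    \<comment> \<open>A set built for \<open>b\<close> keeps no base point but that of
      \<open>b\<close>, so the selected member must have been built for \<open>a\<close>
      itself.\<close>
    then have "base a = base b"
      unfolding mem_A using base_omega[OF a] pt_base[OF b(1) a] Fr[OF b(1,2)] by metis
    then have ab: "a = b" using base_inj a b(1) by blast
    have "ch a = r"
    proof (rule set_ext)
      fix q
      have "p (pt a q) \<epsilon> W a \<longleftrightarrow> q \<epsilon> r" if q: "q \<epsilon> rationals E"
        unfolding b(3) co[OF AB(1) pt_omega[OF a q]] mem_A ab[symmetric]
        using pt_omega[OF a q] pt_base[OF a a q] pt_inj[OF a a q] Fr[OF b(1,2)] by blast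
      then show "q \<epsilon> ch a \<longleftrightarrow> q \<epsilon> r" unfolding mem_ch using Fr[OF b(1,2)] by blast
    qed
    then show ?thesis using ab b(2) by simp
  qed
  have f: "is_function E (lam F ch) F (union_of E F)"
    by (rule lam_function[OF ch_def']) (use ch in auto)
  show "\<exists>f. is_function E f F (union_of E F) \<and> (\<forall>a. a \<epsilon> F \<longrightarrow> app E f a \<epsilon> a)"
    by (intro exI[of _ "lam F ch"] conjI allI impI f)
      (use function_ap(3)[OF f] ap_lam[OF ch_def'] ch in simp)
qed

section \<open>The order of the rational numbers\<close>

text \<open>HOL triples serve as notation for three elements of the structure at once; no internal
  set is formed from them except through \<open>to_rat\<close>.\<close>

definition is_frac :: "'v \<times> 'v \<times> 'v \<Rightarrow> bool" where
  "is_frac x \<longleftrightarrow> (case x of (a, b, c) \<Rightarrow> is_fraction E a b c)"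

definition frac_less :: "'v \<times> 'v \<times> 'v \<Rightarrow> 'v \<times> 'v \<times> 'v \<Rightarrow> bool" where
  "frac_less x y \<longleftrightarrow> (case x of (a, b, c) \<Rightarrow> case y of (a', b', c') \<Rightarrow> a \<otimes> c' \<oplus> b' \<otimes> c \<epsilon> a' \<otimes> c \<oplus> b \<otimes> c')"

definition frac_eq :: "'v \<times> 'v \<times> 'v \<Rightarrow> 'v \<times> 'v \<times> 'v \<Rightarrow> bool" where
  "frac_eq x y \<longleftrightarrow> (case x of (a, b, c) \<Rightarrow> case y of (a', b', c') \<Rightarrow> a \<otimes> c' \<oplus> b' \<otimes> c = a' \<otimes> c \<oplus> b \<otimes> c')"

definition to_rat :: "'v \<times> 'v \<times> 'v \<Rightarrow> 'v" where
  "to_rat x = (case x of (a, b, c) \<Rightarrow> fraction_class a b c)"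

lemma ad_less_eq_mono:
  assumes "p \<epsilon> q" "u = v" "q \<epsilon> \<omega>" "v \<epsilon> \<omega>"
  shows "p \<oplus> u \<epsilon> q \<oplus> v" "u \<oplus> p \<epsilon> v \<oplus> q"
proof -
  have "p \<epsilon> \<omega>" using assms omega_mem_omega by blast
  then show "p \<oplus> u \<epsilon> q \<oplus> v" "u \<oplus> p \<epsilon> v \<oplus> q"
    using assms ad_less[of v p q] ad_comm[of p v] ad_comm[of q v] by simp_all
qed

text \<open>Lacking subtraction, transitivity is obtained by adding the comparison of the first two
  fractions, scaled by \<open>c''\<close>, to that of the last two, scaled by \<open>c\<close>. Both
  sums contain the same extra summand; cancelling it and the factor \<open>c'\<close> leaves the
  comparison of the outer fractions.\<close>

lemma frac_identity:
  assumes "a \<epsilon> \<omega>" "b \<epsilon> \<omega>" "c \<epsilon> \<omega>" "a' \<epsilon> \<omega>" "b' \<epsilon> \<omega>" "c' \<epsilon> \<omega>" "a'' \<epsilon> \<omega>" "b'' \<epsilon> \<omega>" "c'' \<epsilon> \<omega>"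
  shows "(a \<otimes> c' \<oplus> b' \<otimes> c) \<otimes> c'' \<oplus> (a' \<otimes> c'' \<oplus> b'' \<otimes> c') \<otimes> c =
      (a \<otimes> c'' \<oplus> b'' \<otimes> c) \<otimes> c' \<oplus> (b' \<otimes> c \<otimes> c'' \<oplus> a' \<otimes> c \<otimes> c'')"
    "(a' \<otimes> c \<oplus> b \<otimes> c') \<otimes> c'' \<oplus> (a'' \<otimes> c' \<oplus> b' \<otimes> c'') \<otimes> c =
      (a'' \<otimes> c \<oplus> b \<otimes> c'') \<otimes> c' \<oplus> (b' \<otimes> c \<otimes> c'' \<oplus> a' \<otimes> c \<otimes> c'')"
  using assms by (simp_all add: distrib_left distrib_right ad_ac ml_ac)

lemma frac_trans:
  assumes x: "is_frac x" and y: "is_frac y" and z: "is_frac z"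
  shows "frac_eq x y \<Longrightarrow> frac_eq y z \<Longrightarrow> frac_eq x z"
    "frac_eq x y \<Longrightarrow> frac_less y z \<Longrightarrow> frac_less x z"
    "frac_less x y \<Longrightarrow> frac_eq y z \<Longrightarrow> frac_less x z"
    "frac_less x y \<Longrightarrow> frac_less y z \<Longrightarrow> frac_less x z"
proof -
  obtain a b c where xe: "x = (a, b, c)" by (cases x) auto
  obtain a' b' c' where ye: "y = (a', b', c')" by (cases y) auto
  obtain a'' b'' c'' where ze: "z = (a'', b'', c'')" by (cases z) auto
  have w: "a \<epsilon> \<omega>" "b \<epsilon> \<omega>" "c \<epsilon> \<omega>" "a' \<epsilon> \<omega>" "b' \<epsilon> \<omega>" "c' \<epsilon> \<omega>" "a'' \<epsilon> \<omega>" "b'' \<epsilon> \<omega>" "c'' \<epsilon> \<omega>"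
    and nz: "c \<noteq> \<zero>" "c' \<noteq> \<zero>" "c'' \<noteq> \<zero>"
    using x y z unfolding xe ye ze is_frac_def is_fraction_def by simp_all
  define P Q P' Q' R R' X where defs: "P = a \<otimes> c' \<oplus> b' \<otimes> c" "Q = a' \<otimes> c \<oplus> b \<otimes> c'"
    "P' = a' \<otimes> c'' \<oplus> b'' \<otimes> c'" "Q' = a'' \<otimes> c' \<oplus> b' \<otimes> c''"
    "R = a \<otimes> c'' \<oplus> b'' \<otimes> c" "R' = a'' \<otimes> c \<oplus> b \<otimes> c''"
    "X = b' \<otimes> c \<otimes> c'' \<oplus> a' \<otimes> c \<otimes> c''"
  have W: "P \<epsilon> \<omega>" "Q \<epsilon> \<omega>" "P' \<epsilon> \<omega>" "Q' \<epsilon> \<omega>" "R \<epsilon> \<omega>" "R' \<epsilon> \<omega>" "X \<epsilon> \<omega>"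
    using w unfolding defs by simp_all
  have id: "P \<otimes> c'' \<oplus> P' \<otimes> c = R \<otimes> c' \<oplus> X" "Q \<otimes> c'' \<oplus> Q' \<otimes> c = R' \<otimes> c' \<oplus> X"
    unfolding defs by (rule frac_identity[OF w])+
  have eq: "R = R'" if "P \<otimes> c'' \<oplus> P' \<otimes> c = Q \<otimes> c'' \<oplus> Q' \<otimes> c"
    using that ml_cancel[OF W(5,6) w(6) nz(2)] W w unfolding id by simp
  have less: "R \<epsilon> R'" if "P \<otimes> c'' \<oplus> P' \<otimes> c \<epsilon> Q \<otimes> c'' \<oplus> Q' \<otimes> c"
    using that ml_less_iff[OF W(5,6) w(6) nz(2)] W w unfolding id by simp
  have defs': "frac_eq x y \<longleftrightarrow> P = Q" "frac_eq y z \<longleftrightarrow> P' = Q'" "frac_eq x z \<longleftrightarrow> R = R'"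
    "frac_less x y \<longleftrightarrow> P \<epsilon> Q" "frac_less y z \<longleftrightarrow> P' \<epsilon> Q'" "frac_less x z \<longleftrightarrow> R \<epsilon> R'"
    unfolding frac_eq_def frac_less_def xe ye ze defs by simp_all
  show "frac_eq x y \<Longrightarrow> frac_eq y z \<Longrightarrow> frac_eq x z"
    unfolding defs' by (rule eq) simp
  show "frac_eq x y \<Longrightarrow> frac_less y z \<Longrightarrow> frac_less x z"
    unfolding defs' by (intro less ad_less_eq_mono(2) ml_less) (use W w nz in simp_all)
  show "frac_less x y \<Longrightarrow> frac_eq y z \<Longrightarrow> frac_less x z"
    unfolding defs' by (intro less ad_less_eq_mono(1) ml_less) (use W w nz in simp_all)
  show "frac_less x y \<Longrightarrow> frac_less y z \<Longrightarrow> frac_less x z"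
    unfolding defs' by (intro less less_add_mono ml_less) (use W w nz in simp_all)
qed

lemma frac_eq_sym: "frac_eq x y \<longleftrightarrow> frac_eq y x"
  unfolding frac_eq_def by (auto split: prod.splits)

lemma to_rat_eq_iff:
  assumes x: "is_frac x" and y: "is_frac y"
  shows "to_rat x = to_rat y \<longleftrightarrow> frac_eq x y"
proof -
  have mem: "t \<epsilon> to_rat x \<longleftrightarrow> (\<exists>a b c. is_frac (a, b, c) \<and> t = opair E (opair E a b) c \<and> frac_eq x (a, b, c))"
    for x t by (auto simp: to_rat_def mem_fraction_class frac_eq_def is_frac_def split: prod.split)
  show ?thesis
  proof
    assume eq: "to_rat x = to_rat y"
    obtain a b c where ye: "y = (a, b, c)" by (cases y) auto
    have "frac_eq y y" unfolding frac_eq_def ye by simp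
    then have "opair E (opair E a b) c \<epsilon> to_rat y" unfolding mem using y ye by blast
    then have "opair E (opair E a b) c \<epsilon> to_rat x" unfolding eq .
    then show "frac_eq x y" unfolding mem ye by auto
  next
    assume *: "frac_eq x y"
    then have "frac_eq x z \<longleftrightarrow> frac_eq y z" if "is_frac z" for z
      using frac_trans(1)[OF x y that] frac_trans(1)[OF y x that] frac_eq_sym[of x y] by blast
    then show "to_rat x = to_rat y" by (intro set_ext) (unfold mem, blast)
  qed
qed

lemma mem_rationals_frac: "q \<epsilon> rationals E \<longleftrightarrow> (\<exists>x. is_frac x \<and> q = to_rat x)"
  unfolding mem_rationals is_frac_def to_rat_def by auto

lemma rat_less_frac: "rat_less E q r \<longleftrightarrow> (\<exists>x y. is_frac x \<and> is_frac y \<and> q = to_rat x \<and> r = to_rat y \<and> frac_less x y)"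
  unfolding rat_less_fraction_class
  by (simp add: split_paired_Ex is_frac_def to_rat_def frac_less_def)

text \<open>\<open>rat_less\<close> asks only for some pair of representatives; mixed transitivity
  of \<open>frac_eq\<close> and \<open>frac_less\<close> makes the answer independent of the
  pair.\<close>

lemma rat_less_iff:
  assumes x: "is_frac x" and y: "is_frac y"
  shows "rat_less E (to_rat x) (to_rat y) \<longleftrightarrow> frac_less x y"
proof
  assume "rat_less E (to_rat x) (to_rat y)"
  then obtain x' y' where *: "is_frac x'" "is_frac y'" "to_rat x = to_rat x'" "to_rat y = to_rat y'" "frac_less x' y'"
    unfolding rat_less_frac by blast
  then have "frac_eq x x'" "frac_eq y' y" using to_rat_eq_iff x y frac_eq_sym by blast+
  then show "frac_less x y" using frac_trans(2)[OF x *(1) *(2)] frac_trans(3)[OF x *(2) y] *(5) by blast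
qed (use x y rat_less_frac in blast)

lemma frac_dense:
  assumes x: "is_frac x" and y: "is_frac y" and less: "frac_less x y"
  shows "\<exists>z. is_frac z \<and> frac_less x z \<and> frac_less z y"
proof -
  obtain a b c where xe: "x = (a, b, c)" by (cases x) auto
  obtain a' b' c' where ye: "y = (a', b', c')" by (cases y) auto
  have w: "a \<epsilon> \<omega>" "b \<epsilon> \<omega>" "c \<epsilon> \<omega>" "a' \<epsilon> \<omega>" "b' \<epsilon> \<omega>" "c' \<epsilon> \<omega>" and nz: "c \<noteq> \<zero>" "c' \<noteq> \<zero>"
    using x y unfolding xe ye is_frac_def is_fraction_def by simp_all
  have l: "a \<otimes> c' \<oplus> b' \<otimes> c \<epsilon> a' \<otimes> c \<oplus> b \<otimes> c'" using less unfolding frac_less_def xe ye by simp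
  \<comment> \<open>The mediant lies strictly between the two fractions: each cross-multiplied
    inequality is the given one with the same summand added to both sides.\<close>
  let ?z = "(a \<oplus> a', b \<oplus> b', c \<oplus> c')"
  have "c \<epsilon> \<sigma> (c \<oplus> c')" by (rule le_ad1[OF w(3,6)])
  then have "c \<oplus> c' \<noteq> \<zero>" using nz(1) by auto
  then have "is_frac ?z" using w unfolding is_frac_def is_fraction_def by simp
  moreover have "frac_less x ?z"
  proof -
    have "a \<otimes> (c \<oplus> c') \<oplus> (b \<oplus> b') \<otimes> c = (a \<otimes> c' \<oplus> b' \<otimes> c) \<oplus> (a \<otimes> c \<oplus> b \<otimes> c)"
      "(a \<oplus> a') \<otimes> c \<oplus> b \<otimes> (c \<oplus> c') = (a' \<otimes> c \<oplus> b \<otimes> c') \<oplus> (a \<otimes> c \<oplus> b \<otimes> c)"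
      using w by (simp_all add: distrib_left distrib_right ad_ac)
    then show ?thesis using l w unfolding frac_less_def xe by simp
  qed
  moreover have "frac_less ?z y"
  proof -
    have "(a \<oplus> a') \<otimes> c' \<oplus> b' \<otimes> (c \<oplus> c') = (a \<otimes> c' \<oplus> b' \<otimes> c) \<oplus> (a' \<otimes> c' \<oplus> b' \<otimes> c')"
      "a' \<otimes> (c \<oplus> c') \<oplus> (b \<oplus> b') \<otimes> c' = (a' \<otimes> c \<oplus> b \<otimes> c') \<oplus> (a' \<otimes> c' \<oplus> b' \<otimes> c')"
      using w by (simp_all add: distrib_left distrib_right ad_ac)
    then show ?thesis using l w unfolding frac_less_def ye by simp
  qed
  ultimately show ?thesis by blast
qed

section \<open>Embedding the power set of the natural numbers into the real numbers\<close>

definition triple :: "'v \<Rightarrow> 'v" where "triple y = y \<oplus> y \<oplus> y"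

lemma dtm_triple [dfn_intros]: "dtm t \<Longrightarrow> dtm (\<lambda>e. triple (t e))"
  unfolding triple_def by (intro dfn_intros)

lemma triple_closed [simp]: "y \<epsilon> \<omega> \<Longrightarrow> triple y \<epsilon> \<omega>"
  by (simp add: triple_def)

lemma triple_ml: "x \<epsilon> \<omega> \<Longrightarrow> y \<epsilon> \<omega> \<Longrightarrow> triple x \<otimes> y = triple (x \<otimes> y)"
  "x \<epsilon> \<omega> \<Longrightarrow> y \<epsilon> \<omega> \<Longrightarrow> x \<otimes> triple y = triple (x \<otimes> y)"
  by (simp_all add: triple_def distrib_left distrib_right)

lemma triple_succ: "y \<epsilon> \<omega> \<Longrightarrow> triple (\<sigma> y) = \<sigma> (\<sigma> (\<sigma> (triple y)))"
  by (simp add: triple_def)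

lemma le_add_mono:
  assumes "x \<epsilon> \<sigma> y" "u \<epsilon> \<sigma> v" "y \<epsilon> \<omega>" "v \<epsilon> \<omega>"
  shows "x \<oplus> u \<epsilon> \<sigma> (y \<oplus> v)"
proof -
  have w: "x \<epsilon> \<omega>" "u \<epsilon> \<omega>" using assms omega_mem_omega succ_mem_omega by blast+
  have "x \<oplus> u \<epsilon> \<sigma> (y \<oplus> u)" by (rule ad_le[OF assms(1,3) w(2)])
  moreover have "y \<oplus> u \<epsilon> \<sigma> (y \<oplus> v)"
    using ad_le[OF assms(2,4,3)] ad_comm[OF assms(3) w(2)] ad_comm[OF assms(3,4)] by simp
  ultimately show ?thesis by (rule le_trans) (use assms in simp)
qed

lemma triple_le: "x \<epsilon> \<sigma> y \<Longrightarrow> y \<epsilon> \<omega> \<Longrightarrow> triple x \<epsilon> \<sigma> (triple y)"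
  unfolding triple_def by (intro le_add_mono) simp_all

text \<open>
  The number \<open>num A n / den n\<close> is the sum of \<open>2 / 3\<^bsup>i + 1\<^esup>\<close> over the \<open>i < n\<close> in \<open>A\<close>.
\<close>
definition den :: "'v \<Rightarrow> 'v" where
  "den n = rec (\<sigma> \<zero>) (\<lambda>_ y. triple y) n"

definition num :: "'v \<Rightarrow> 'v \<Rightarrow> 'v" where
  "num A n = rec \<zero> (\<lambda>n y. if n \<epsilon> A then \<sigma> (\<sigma> (triple y)) else triple y) n"

lemma dtm_den [dfn_intros]: "dtm t \<Longrightarrow> dtm (\<lambda>e. den (t e))"
  by (rule dtm_comp1[where R = den], unfold den_def, intro dfn_intros)

lemma dtm_num [dfn_intros]: "dtm t \<Longrightarrow> dtm u \<Longrightarrow> dtm (\<lambda>e. num (t e) (u e))"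
  by (rule dtm_comp2[where R = num], unfold num_def, intro dfn_intros)

lemma den_zero [simp]: "den \<zero> = \<sigma> \<zero>"
  unfolding den_def by (rule rec_zero) (intro dfn_intros)

lemma den_succ [simp]: "n \<epsilon> \<omega> \<Longrightarrow> den (\<sigma> n) = triple (den n)"
  unfolding den_def by (rule rec_succ) (intro dfn_intros)

lemma num_zero [simp]: "num A \<zero> = \<zero>"
  unfolding num_def by (rule rec_zero) (intro dfn_intros)

lemma num_succ: "n \<epsilon> \<omega> \<Longrightarrow> num A (\<sigma> n) = (if n \<epsilon> A then \<sigma> (\<sigma> (triple (num A n))) else triple (num A n))"
  unfolding num_def by (rule rec_succ) (intro dfn_intros)

lemma den_omega: "n \<epsilon> \<omega> \<Longrightarrow> den n \<epsilon> \<omega> \<and> den n \<noteq> \<zero>"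
proof (induction n rule: omega_induct)
  case (succ n)
  then obtain m where m: "m \<epsilon> \<omega>" "den n = \<sigma> m" using omega_cases by blast
  then show ?case using succ by (simp add: triple_succ)
qed (auto intro!: dfn_intros)

lemma num_omega [simp]: "n \<epsilon> \<omega> \<Longrightarrow> num A n \<epsilon> \<omega>"
proof (induction n rule: omega_induct)
  case (succ n)
  then show ?case by (simp add: num_succ)
qed (auto intro!: dfn_intros)

text \<open>Cross-multiplied form of the fact that \<open>num / den\<close> does not decrease and
  \<open>(num + 1) / den\<close> does not increase: the ternary intervals selected by the digits are
  nested. A step replaces \<open>a\<close> by \<open>3a\<close> or \<open>3a + 2\<close>, and in
  both cases the new numerator plus one is at most \<open>3(a + 1)\<close>.\<close>

lemma num_den_mono:
  assumes "n \<epsilon> \<omega>"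
  shows "\<forall>m. m \<epsilon> \<sigma> n \<longrightarrow> num A m \<otimes> den n \<epsilon> \<sigma> (num A n \<otimes> den m) \<and>
    \<sigma> (num A n) \<otimes> den m \<epsilon> \<sigma> (\<sigma> (num A m) \<otimes> den n)"
  using assms
proof (induction n rule: omega_induct)
  case zero
  then show ?case by auto
next
  case (succ n)
  show ?case
  proof (intro allI impI)
    fix m assume "m \<epsilon> \<sigma> (\<sigma> n)"
    then consider "m \<epsilon> \<sigma> n" | "m = \<sigma> n" by auto
    then show "num A m \<otimes> den (\<sigma> n) \<epsilon> \<sigma> (num A (\<sigma> n) \<otimes> den m) \<and>
      \<sigma> (num A (\<sigma> n)) \<otimes> den m \<epsilon> \<sigma> (\<sigma> (num A m) \<otimes> den (\<sigma> n))"
    proof cases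
      case 1
      have m: "m \<epsilon> \<omega>" using omega_mem_omega[OF succ_mem_omega[OF succ(1)] 1] .
      let ?a = "num A n" and ?b = "num A m" and ?d = "den n" and ?c = "den m"
      have w: "?a \<epsilon> \<omega>" "?b \<epsilon> \<omega>" "?d \<epsilon> \<omega>" "?c \<epsilon> \<omega>" "num A (\<sigma> n) \<epsilon> \<omega>"
        using succ(1) m den_omega by simp_all
      have IH: "?b \<otimes> ?d \<epsilon> \<sigma> (?a \<otimes> ?c)" "\<sigma> ?a \<otimes> ?c \<epsilon> \<sigma> (\<sigma> ?b \<otimes> ?d)" using succ.IH 1 by blast+
      have "?b \<otimes> triple ?d \<epsilon> \<sigma> (triple ?a \<otimes> ?c)"
        using triple_le[OF IH(1)] w triple_ml by (simp del: mem_succ)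
      moreover have "triple ?a \<otimes> ?c \<epsilon> \<sigma> (num A (\<sigma> n) \<otimes> ?c)"
        by (rule ml_le) (use w succ(1) in \<open>auto simp: num_succ\<close>)
      ultimately have "?b \<otimes> triple ?d \<epsilon> \<sigma> (num A (\<sigma> n) \<otimes> ?c)" by (rule le_trans) (use w in simp)
      moreover have "\<sigma> (num A (\<sigma> n)) \<otimes> ?c \<epsilon> \<sigma> (triple (\<sigma> ?a) \<otimes> ?c)"
        by (rule ml_le) (use w succ(1) in \<open>auto simp: num_succ triple_succ\<close>)
      moreover have "triple (\<sigma> ?a) \<otimes> ?c \<epsilon> \<sigma> (\<sigma> ?b \<otimes> triple ?d)"
        using triple_le[OF IH(2)] w triple_ml by (simp del: mem_succ succ_ml)
      moreover have "\<sigma> ?b \<otimes> triple ?d \<epsilon> \<omega>" using w by (simp del: succ_ml)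
      ultimately show ?thesis using le_trans den_succ[OF succ(1)] by metis
    next
      case 2
      then show ?thesis by simp
    qed
  qed
qed (intro dfn_intros)

text \<open>Since the intervals are nested, every left end is strictly below every right end; the
  strictness comes from the interval with the larger index.\<close>

lemma num_den_less:
  assumes m: "m \<epsilon> \<omega>" and n: "n \<epsilon> \<omega>"
  shows "num A n \<otimes> den m \<epsilon> \<sigma> (num A m) \<otimes> den n"
proof -
  have less: "num A k \<otimes> den l \<epsilon> \<sigma> (num A k) \<otimes> den l" if "k \<epsilon> \<omega>" "l \<epsilon> \<omega>" for k l
    by (rule ml_less) (use that den_omega in simp_all)
  have w: "\<sigma> (num A m) \<otimes> den n \<epsilon> \<omega>" using m n den_omega by (simp del: succ_ml)
  consider "m \<epsilon> \<sigma> n" | "n \<epsilon> \<sigma> m" using omega_linear[OF m n] by auto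
  then show ?thesis
  proof cases
    case 1
    show ?thesis by (rule less_le_trans[OF less[OF n m] _ w]) (use num_den_mono[OF n] 1 in blast)
  next
    case 2
    show ?thesis by (rule le_less_trans[OF _ less[OF m n] w]) (use num_den_mono[OF m] 2 in blast)
  qed
qed

text \<open>The lower cut of the supremum of the partial sums, a point of Cantor's ternary set.
  Using the digits 0 and 2 only keeps different subsets of \<omega> apart, where binary digits would
  identify some of them.\<close>

definition cut :: "'v \<Rightarrow> 'v" where
  "cut A = sep (rationals E) (\<lambda>q. \<exists>n. n \<epsilon> \<omega> \<and> rat_less E q (fraction_class (num A n) \<zero> (den n)))"

lemma dtm_cut [dfn_intros]: "dtm t \<Longrightarrow> dtm (\<lambda>e. cut (t e))"
  by (rule dtm_comp1[where R = cut], unfold cut_def, intro dfn_intros)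

lemma is_frac_num_den: "n \<epsilon> \<omega> \<Longrightarrow> is_frac (num A n, \<zero>, den n)"
  using den_omega by (simp add: is_frac_def is_fraction_def)

lemma mem_cut:
  assumes "is_frac x"
  shows "to_rat x \<epsilon> cut A \<longleftrightarrow> (\<exists>n. n \<epsilon> \<omega> \<and> frac_less x (num A n, \<zero>, den n))"
proof -
  have D: "pdef (\<lambda>q. \<exists>n. n \<epsilon> \<omega> \<and> rat_less E q (fraction_class (num A n) \<zero> (den n)))" by (intro dfn_intros)
  have f: "fraction_class a b c = to_rat (a, b, c)" for a b c by (simp add: to_rat_def)
  have "to_rat x \<epsilon> cut A \<longleftrightarrow> to_rat x \<epsilon> rationals E \<and>
      (\<exists>n. n \<epsilon> \<omega> \<and> rat_less E (to_rat x) (fraction_class (num A n) \<zero> (den n)))"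
    unfolding cut_def mem_sep[OF D] ..
  then show ?thesis
    unfolding f using mem_rationals_frac rat_less_iff[OF assms is_frac_num_den] assms by blast
qed

lemma cut_rational: "q \<epsilon> cut A \<Longrightarrow> \<exists>x. is_frac x \<and> q = to_rat x"
proof -
  have D: "pdef (\<lambda>q. \<exists>n. n \<epsilon> \<omega> \<and> rat_less E q (fraction_class (num A n) \<zero> (den n)))" by (intro dfn_intros)
  show "q \<epsilon> cut A \<Longrightarrow> \<exists>x. is_frac x \<and> q = to_rat x"
    unfolding cut_def mem_sep[OF D] mem_rationals_frac by blast
qed

text \<open>The right end of any of the nested intervals bounds all partial sums. It shows that the
  cut is proper and later separates two different cuts.\<close>

lemma not_mem_cut:
  assumes m: "m \<epsilon> \<omega>"
  shows "is_frac (\<sigma> (num A m), \<zero>, den m)" "\<not> to_rat (\<sigma> (num A m), \<zero>, den m) \<epsilon> cut A"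
proof -
  show f: "is_frac (\<sigma> (num A m), \<zero>, den m)" using den_omega[OF m] m by (simp add: is_frac_def is_fraction_def)
  have "\<not> frac_less (\<sigma> (num A m), \<zero>, den m) (num A n, \<zero>, den n)" if "n \<epsilon> \<omega>" for n
    using mem_asym[OF num_den_less[OF m that]] m that den_omega by (simp add: frac_less_def)
  then show "\<not> to_rat (\<sigma> (num A m), \<zero>, den m) \<epsilon> cut A" unfolding mem_cut[OF f] by blast
qed

lemma cut_real: "cut A \<epsilon> reals E"
  unfolding mem_reals
proof (intro conjI allI impI)
  show "is_subset E (cut A) (rationals E)"
    using cut_rational mem_rationals_frac by (intro is_subsetI) blast
  \<comment> \<open>The triple represents -1, which is below the partial sum 0; a positive lower
    bound could fail, since \<open>A\<close> may be empty.\<close>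
  have "is_frac (\<zero>, \<sigma> \<zero>, \<sigma> \<zero>)" by (simp add: is_frac_def is_fraction_def)
  moreover have "frac_less (\<zero>, \<sigma> \<zero>, \<sigma> \<zero>) (num A \<zero>, \<zero>, den \<zero>)" by (simp add: frac_less_def)
  ultimately show "\<exists>q. q \<epsilon> cut A" using mem_cut zero_mem_omega by blast
  show "\<exists>q. q \<epsilon> rationals E \<and> \<not> q \<epsilon> cut A"
    using not_mem_cut[OF zero_mem_omega] mem_rationals_frac by blast
  show "r \<epsilon> cut A" if *: "q \<epsilon> cut A \<and> r \<epsilon> rationals E \<and> rat_less E r q" for q r
  proof -
    obtain x y where x: "is_frac x" "q = to_rat x" and y: "is_frac y" "r = to_rat y"
      using * cut_rational mem_rationals_frac by blast
    have "frac_less y x" using * rat_less_iff[OF y(1) x(1)] x y by blast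
    moreover obtain n where "n \<epsilon> \<omega>" "frac_less x (num A n, \<zero>, den n)" using * mem_cut[OF x(1)] x(2) by blast
    ultimately show ?thesis
      using mem_cut[OF y(1)] y(2) frac_trans(4)[OF y(1) x(1) is_frac_num_den] by blast
  qed
  show "\<exists>r. r \<epsilon> cut A \<and> rat_less E q r" if q: "q \<epsilon> cut A" for q
  proof -
    obtain x where x: "is_frac x" "q = to_rat x" using q cut_rational by blast
    then obtain n where n: "n \<epsilon> \<omega>" "frac_less x (num A n, \<zero>, den n)" using q mem_cut[OF x(1)] by blast
    obtain z where "is_frac z" "frac_less x z" "frac_less z (num A n, \<zero>, den n)"
      using frac_dense[OF x(1) is_frac_num_den[OF n(1)] n(2)] by blast
    then show ?thesis using mem_cut n(1) rat_less_iff[OF x(1)] x(2) by blast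
  qed
qed

lemma num_cong:
  assumes "n \<epsilon> \<omega>" "\<And>i. i \<epsilon> n \<Longrightarrow> i \<epsilon> A \<longleftrightarrow> i \<epsilon> B"
  shows "num A n = num B n"
proof -
  from assms(1) have "(\<forall>i. i \<epsilon> n \<longrightarrow> (i \<epsilon> A \<longleftrightarrow> i \<epsilon> B)) \<longrightarrow> num A n = num B n"
  proof (induction n rule: omega_induct)
    case (succ n)
    then show ?case by (simp add: num_succ)
  qed (simp, intro dfn_intros)
  then show ?thesis using assms(2) by blast
qed

text \<open>At the first difference \<open>k\<close>, lying in \<open>B\<close> only, the numerators
  become \<open>3a\<close> and \<open>3a + 2\<close> over the same denominator. The fraction with
  numerator \<open>3a + 1\<close>, the right end of the interval of \<open>A\<close>, is therefore
  below a partial sum of \<open>B\<close> without lying in the cut of \<open>A\<close>.\<close>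

lemma cut_inj:
  assumes A: "is_subset E A \<omega>" and B: "is_subset E B \<omega>" and eq: "cut A = cut B"
  shows "A = B"
proof (rule ccontr)
  have aux: "cut A \<noteq> cut B" if k: "k \<epsilon> \<omega>" "k \<epsilon> B" "\<not> k \<epsilon> A" "\<And>i. i \<epsilon> k \<Longrightarrow> i \<epsilon> A \<longleftrightarrow> i \<epsilon> B" for A B k
  proof -
    let ?x = "(\<sigma> (num A (\<sigma> k)), \<zero>, den (\<sigma> k))"
    note x = not_mem_cut[OF succ_mem_omega[OF k(1)], of A]
    have "num A (\<sigma> k) = triple (num A k)" "num B (\<sigma> k) = \<sigma> (\<sigma> (triple (num A k)))"
      using num_succ[OF k(1)] k(2,3) num_cong[OF k(1,4)] by simp_all
    then have "\<sigma> (num A (\<sigma> k)) \<epsilon> num B (\<sigma> k)" by simp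
    then have "\<sigma> (num A (\<sigma> k)) \<otimes> den (\<sigma> k) \<epsilon> num B (\<sigma> k) \<otimes> den (\<sigma> k)"
      by (rule ml_less) (use k(1) den_omega[OF succ_mem_omega[OF k(1)]] in simp_all)
    then have "frac_less ?x (num B (\<sigma> k), \<zero>, den (\<sigma> k))"
      using den_omega[OF succ_mem_omega[OF k(1)]] unfolding frac_less_def
      by (simp del: den_succ succ_ml)
    then have "to_rat ?x \<epsilon> cut B" using mem_cut[OF x(1)] succ_mem_omega[OF k(1)] by blast
    then show ?thesis using x(2) by auto
  qed
  assume "A \<noteq> B"
  then obtain j where j: "\<not> (j \<epsilon> A \<longleftrightarrow> j \<epsilon> B)" using set_ext by blast
  have D: "pdef (\<lambda>k. \<not> (k \<epsilon> A \<longleftrightarrow> k \<epsilon> B))" by (intro dfn_intros)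
  have "j \<epsilon> sep \<omega> (\<lambda>k. \<not> (k \<epsilon> A \<longleftrightarrow> k \<epsilon> B))"
    unfolding mem_sep[OF D] using j is_subsetD[OF A] is_subsetD[OF B] by blast
  then obtain k where "k \<epsilon> sep \<omega> (\<lambda>k. \<not> (k \<epsilon> A \<longleftrightarrow> k \<epsilon> B))"
    and min: "\<And>i. i \<epsilon> k \<Longrightarrow> \<not> i \<epsilon> sep \<omega> (\<lambda>k. \<not> (k \<epsilon> A \<longleftrightarrow> k \<epsilon> B))"
    using foundation_set by blast
  then have k: "k \<epsilon> \<omega>" "\<not> (k \<epsilon> A \<longleftrightarrow> k \<epsilon> B)" unfolding mem_sep[OF D] by blast+
  have ag: "i \<epsilon> A \<longleftrightarrow> i \<epsilon> B" if "i \<epsilon> k" for i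
    using min[OF that] omega_mem_omega[OF k(1) that] unfolding mem_sep[OF D] by blast
  then show False using k eq aux[of k B A] aux[of k A B] by metis
qed

section \<open>Countable choice for sets of reals and the discrete natural numbers\<close>

text \<open>\<open>CAC_reals\<close> speaks of infinite families only, so finite ones are treated by
  induction. A countable set that meets every member is a conclusion that both cases can
  share.\<close>

lemma CAC_reals_meet:
  assumes CAC: "CAC_reals E" and F: "is_countable E F"
    and ne: "\<And>a. a \<epsilon> F \<Longrightarrow> is_subset E a (reals E) \<and> (\<exists>x. x \<epsilon> a)"
  shows "\<exists>c. is_countable E c \<and> (\<forall>a. a \<epsilon> F \<longrightarrow> (\<exists>x. x \<epsilon> c \<and> x \<epsilon> a))"
proof (cases "is_finite E F")
  case True
  then obtain n h where n: "n \<epsilon> \<omega>" and h: "fdef h" "bij_betw h (ext_of F) (ext_of n)"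
    by (rule is_finiteE) (rule that)
  note [dfn_intros] = dtm_comp1[where R = h, OF h(1)]
  from n have "\<exists>c. is_finite E c \<and> (\<forall>a. a \<epsilon> F \<and> h a \<epsilon> n \<longrightarrow> (\<exists>x. x \<epsilon> c \<and> x \<epsilon> a))"
  proof (induction n rule: omega_induct)
    case zero
    then show ?case using finite_empty by auto
  next
    case (succ n)
    then obtain c where c: "is_finite E c" "\<And>a. a \<epsilon> F \<Longrightarrow> h a \<epsilon> n \<Longrightarrow> \<exists>x. x \<epsilon> c \<and> x \<epsilon> a" by blast
    show ?case
    proof (cases "\<exists>a. a \<epsilon> F \<and> h a = n")
      case True
      then obtain a where a: "a \<epsilon> F" "h a = n" by blast
      then obtain x where x: "x \<epsilon> a" using ne by blast
      have inj: "b = a" if "b \<epsilon> F" "h b = n" for b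
        using that a h(2) by (auto simp: bij_betw_def inj_on_def)
      let ?c = "union_of E (upair E c (upair E x x))"
      have mem: "y \<epsilon> ?c \<longleftrightarrow> y \<epsilon> c \<or> y = x" for y by auto
      have "is_finite E ?c" by (rule finite_insert[OF c(1) mem])
      moreover have "\<exists>x. x \<epsilon> ?c \<and> x \<epsilon> b" if b: "b \<epsilon> F" "h b \<epsilon> \<sigma> n" for b
      proof (cases "h b \<epsilon> n")
        case True
        then show ?thesis using c(2)[OF b(1)] mem by blast
      next
        case False
        then have "b = a" using b inj by simp
        then show ?thesis using x mem by blast
      qed
      ultimately show ?thesis by blast
    next
      case False
      then show ?thesis using c by auto
    qed
  qed (intro dfn_intros)
  then obtain c where c: "is_finite E c" "\<And>a. a \<epsilon> F \<and> h a \<epsilon> n \<Longrightarrow> \<exists>x. x \<epsilon> c \<and> x \<epsilon> a" by blast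
  have "h a \<epsilon> n" if "a \<epsilon> F" for a using h(2) that by (auto simp: bij_betw_def)
  then show ?thesis using c finite_countable by blast
next
  case False
  then have "is_denumerable E F" using F by (simp add: is_denumerable_def)
  then obtain f where f: "is_function E f F (union_of E F)" "\<And>a. a \<epsilon> F \<Longrightarrow> app E f a \<epsilon> a"
    using CAC ne unfolding CAC_reals_def is_empty_def by blast
  have D: "fdef (ap f)" by (intro dfn_intros)
  have "ap f a \<epsilon> a" if "a \<epsilon> F" for a using f(2)[OF that] function_ap(3)[OF f(1) that] by simp
  then show ?thesis
    using countable_rep[OF F D] by (intro exI[of _ "rep F (ap f)"]) (auto simp: mem_rep[OF D])
qed

lemma discrete_omega:
  "topology_on E \<omega> (pow \<omega>)" "\<not> compact_space E \<omega> (pow \<omega>)" "T1_space E \<omega> (pow \<omega>)"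
proof -
  show "topology_on E \<omega> (pow \<omega>)"
    unfolding topology_on_def by (auto simp: is_subset_def)
  show "T1_space E \<omega> (pow \<omega>)"
    unfolding T1_space_def
  proof (intro allI impI)
    fix x y assume "x \<epsilon> \<omega> \<and> y \<epsilon> \<omega> \<and> x \<noteq> y"
    then show "\<exists>U. U \<epsilon> pow \<omega> \<and> x \<epsilon> U \<and> \<not> y \<epsilon> U"
      by (intro exI[of _ "upair E x x"]) (auto simp: is_subset_def)
  qed
  show "\<not> compact_space E \<omega> (pow \<omega>)"
  proof
    assume "compact_space E \<omega> (pow \<omega>)"
    moreover have "open_cover E \<omega> (pow \<omega>) \<omega>"
      unfolding open_cover_def using omega_cover omega_mem_omega by (auto intro!: is_subsetI)
    ultimately obtain S where "is_subset E S \<omega>" "is_finite E S" "union_of E S = \<omega>"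
      unfolding compact_space_def open_cover_def by blast
    then show False using omega_no_finite_subcover by blast
  qed
qed

text \<open>The cover members containing a given \<open>n\<close> become, under \<open>cut\<close>,
  a non-empty set of reals \<open>A n\<close>. A countable set meeting all of these, pulled back
  along the injective \<open>cut\<close>, is a countable subcover.\<close>

lemma discrete_omega_Lindelof:
  assumes CAC: "CAC_reals E"
  shows "Lindelof_space E \<omega> (pow \<omega>)"
  unfolding Lindelof_space_def
proof (intro allI impI)
  fix S assume S: "open_cover E \<omega> (pow \<omega>) S"
  then have S': "is_subset E s \<omega>" if "s \<epsilon> S" for s
    using that unfolding open_cover_def is_subset_def[of E S] by simp
  have cut: "fdef cut" by (intro dfn_intros)
  define A where "A n = rep (sep S (\<lambda>s. n \<epsilon> s)) cut" for n
  have DS: "pdef (\<lambda>s. n \<epsilon> s)" for n by (intro dfn_intros)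
  have A: "fdef A" unfolding A_def by (intro dfn_intros)
  have mem_A: "x \<epsilon> A n \<longleftrightarrow> (\<exists>s. s \<epsilon> S \<and> n \<epsilon> s \<and> x = cut s)" for x n
    unfolding A_def mem_rep[OF cut] mem_sep[OF DS] by blast
  have "\<exists>c. is_countable E c \<and> (\<forall>a. a \<epsilon> rep \<omega> A \<longrightarrow> (\<exists>x. x \<epsilon> c \<and> x \<epsilon> a))"
  proof (rule CAC_reals_meet[OF CAC countable_rep[OF countable_omega A]])
    fix a assume "a \<epsilon> rep \<omega> A"
    then obtain n where n: "n \<epsilon> \<omega>" "a = A n" unfolding mem_rep[OF A] by blast
    then have "\<exists>s. s \<epsilon> S \<and> n \<epsilon> s" using S unfolding open_cover_def by (metis mem_union_of)
    then show "is_subset E a (reals E) \<and> (\<exists>x. x \<epsilon> a)"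
      using cut_real unfolding n(2) is_subset_def mem_A by blast
  qed
  then obtain c where c: "is_countable E c" "\<And>n. n \<epsilon> \<omega> \<Longrightarrow> \<exists>x. x \<epsilon> c \<and> x \<epsilon> A n"
    unfolding mem_rep[OF A] by blast
  let ?S = "sep S (\<lambda>s. cut s \<epsilon> c)"
  have D: "pdef (\<lambda>s. cut s \<epsilon> c)" by (intro dfn_intros)
  have "is_subset E ?S S" by (rule is_subsetI) (simp add: mem_sep[OF D])
  moreover have "is_countable E ?S"
  proof (rule countable_inj[OF c(1) cut])
    show "inj_on cut (ext_of ?S)" using cut_inj S' by (auto intro!: inj_onI simp: mem_sep[OF D])
    show "cut s \<epsilon> c" if "s \<epsilon> ?S" for s using that by (simp add: mem_sep[OF D])
  qed
  moreover have "open_cover E \<omega> (pow \<omega>) ?S"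
    unfolding open_cover_def
  proof
    show "is_subset E ?S (pow \<omega>)" by (rule is_subsetI) (use S' in \<open>simp add: mem_sep[OF D]\<close>)
    show "union_of E ?S = \<omega>"
    proof (rule set_ext)
      fix n
      have "\<exists>s. s \<epsilon> ?S \<and> n \<epsilon> s" if "n \<epsilon> \<omega>" using c(2)[OF that] unfolding mem_A mem_sep[OF D] by blast
      then show "n \<epsilon> union_of E ?S \<longleftrightarrow> n \<epsilon> \<omega>"
        using S' is_subsetD unfolding mem_union_of mem_sep[OF D] by blast
    qed
  qed
  ultimately show "\<exists>S'. is_subset E S' S \<and> is_countable E S' \<and> open_cover E \<omega> (pow \<omega>) S'" by blast
qed

text \<open>The topology is the singleton of the empty set. This is the P-space at which the
  right-hand side of (v) is instantiated to obtain a space \<open>Y\<close>.\<close>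

lemma empty_P_space:
  "topology_on E \<zero> (\<sigma> \<zero>)" "P_space E \<zero> (\<sigma> \<zero>)"
proof -
  show "topology_on E \<zero> (\<sigma> \<zero>)"
    unfolding topology_on_def by (auto simp: is_subset_def empty_iff)
  show "P_space E \<zero> (\<sigma> \<zero>)"
    unfolding P_space_def is_G_delta_def by (auto simp: empty_iff)
qed

lemma CAC_reals_iff:
  "CAC_reals E \<longleftrightarrow>
    (\<forall>X TX. topology_on E X TX \<and> P_space E X TX \<longrightarrow>
      (\<exists>Y TY. topology_on E Y TY \<and> \<not> compact_space E Y TY \<and>
        Lindelof_space E Y TY \<and> T1_space E Y TY \<and> projection_closed E X TX Y TY))"
  (is "_ \<longleftrightarrow> ?R")
proof
  assume "CAC_reals E"
  then have L: "Lindelof_space E \<omega> (pow \<omega>)" by (rule discrete_omega_Lindelof)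
  show ?R
  proof (intro allI impI, elim conjE)
    fix X TX assume "topology_on E X TX" "P_space E X TX"
    then have "projection_closed E X TX \<omega> (pow \<omega>)"
      using projection_closed_if_P_space discrete_omega(1) L by blast
    then show "\<exists>Y TY. topology_on E Y TY \<and> \<not> compact_space E Y TY \<and>
        Lindelof_space E Y TY \<and> T1_space E Y TY \<and> projection_closed E X TX Y TY"
      using discrete_omega L by blast
  qed
next
  assume ?R
  then show "CAC_reals E" using empty_P_space CAC_reals_if_Lindelof by blast
qed

end

theorem theorem4p15:
  fixes E :: "'v \<Rightarrow> 'v \<Rightarrow> bool"
  assumes "ZF E"
  shows
    "(\<forall>Y TY X TX. topology_on E Y TY \<and> \<not> countably_compact_space E Y TY \<and>
        topology_on E X TX \<and> projection_closed E X TX Y TY \<longrightarrow> P_space E X TX) \<and>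
     (\<forall>X TX Y TY. topology_on E X TX \<and> topology_on E Y TY \<and> P_space E X TX \<and>
        (Lindelof_space E Y TY \<or> second_countable_space E Y TY) \<longrightarrow>
        projection_closed E X TX Y TY) \<and>
     (\<forall>Y TY. topology_on E Y TY \<and> second_countable_space E Y TY \<and>
        \<not> countably_compact_space E Y TY \<longrightarrow>
        (\<forall>X TX. topology_on E X TX \<longrightarrow>
           (P_space E X TX \<longleftrightarrow> projection_closed E X TX Y TY))) \<and>
     (\<exists>Y TY. topology_on E Y TY \<and> second_countable_space E Y TY \<and>
        Lindelof_space E Y TY \<and> T0_space E Y TY \<and>
        (\<forall>X TX. topology_on E X TX \<longrightarrow>
           (P_space E X TX \<longleftrightarrow> projection_closed E X TX Y TY))) \<and>
     (CAC_reals E \<longleftrightarrow>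
        (\<forall>X TX. topology_on E X TX \<and> P_space E X TX \<longrightarrow>
           (\<exists>Y TY. topology_on E Y TY \<and> \<not> compact_space E Y TY \<and>
              Lindelof_space E Y TY \<and> T1_space E Y TY \<and> projection_closed E X TX Y TY)))"
proof -
  interpret ZF E by fact
  note i = P_space_if_projection_closed
  note ii = projection_closed_if_P_space
  have iii: "P_space E X TX \<longleftrightarrow> projection_closed E X TX Y TY"
    if "topology_on E Y TY" "second_countable_space E Y TY" "\<not> countably_compact_space E Y TY"
      "topology_on E X TX" for X TX Y TY
    using i ii that by blast
  have iv: "\<exists>Y TY. topology_on E Y TY \<and> second_countable_space E Y TY \<and>
      Lindelof_space E Y TY \<and> T0_space E Y TY \<and>
      (\<forall>X TX. topology_on E X TX \<longrightarrow> (P_space E X TX \<longleftrightarrow> projection_closed E X TX Y TY))"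
    using initial_topology iii by blast
  show ?thesis
    by (intro conjI iv CAC_reals_iff) (use i ii iii in blast)+
qed

end
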